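(* Let $n\ge1$, $I=\{1,\dots,n\}$, let $A=(a_{ij})_{n\times n}$ be a symmetric real matrix with $a_{ij}\ge0$ for all $i,j$, let $\boldsymbol\beta=(\beta_1,\dots,\beta_n)$ with $\beta_i>0$, let $\boldsymbol v=(v_1,\dots,v_n)\in(\mathbb R^2)^n$ and $\boldsymbol\alpha=(\alpha_1,\dots,\alpha_n)$ with $\alpha_i>0$. Then $\mathcal F_{\boldsymbol v,\boldsymbol\alpha}$ is bounded from below on $\Gamma^{\boldsymbol\beta}$ if and only if $\boldsymbol\beta$ satisfies: $\Lambda_J(\boldsymbol\beta)\ge0$ for all $\emptyset\ne J\subseteq I$, and if $\Lambda_J(\boldsymbol\beta)=0$ for some $\emptyset\ne J\subseteq I$ then $a_{ii}+\Lambda_{J\setminus\{i\}}(\boldsymbol\beta)>0$ for all $i\in J$.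
   Context: For $\emptyset\ne J\subseteq I$, $\Lambda_J(\boldsymbol\beta)=\sum_{i\in J}\beta_i\big(8\pi-\sum_{j\in J}a_{ij}\beta_j\big)$, and $\Lambda_\emptyset:=0$. $\Gamma^{\boldsymbol\beta}$ is the set of $n$-tuples $\boldsymbol\rho=(\rho_1,\dots,\rho_n)$ of measurable functions on $\mathbb R^2$ with $\rho_i\ge0$, $\int\rho_i\ln\rho_i<\infty$, $\int|x|^2\rho_i<\infty$, $\int\rho_i=\beta_i$ for all $i$. $\mathcal F_{\boldsymbol v,\boldsymbol\alpha}(\boldsymbol\rho)=\sum_{i=1}^n\int_{\mathbb R^2}\rho_i\ln\rho_i+\frac1{4\pi}\sum_{i,j=1}^na_{ij}\int_{\mathbb R^2}\int_{\mathbb R^2}\rho_i(x)\ln|x-y|\rho_j(y)\,d^2x\,d^2y+\sum_{i=1}^n\alpha_i\int_{\mathbb R^2}|x-v_i|^2\rho_i(x)\,d^2x.$ *)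

theory Defs
  imports "HOL-Analysis.Analysis"
begin

definition Lambda :: "(nat \<Rightarrow> nat \<Rightarrow> real) \<Rightarrow> (nat \<Rightarrow> real) \<Rightarrow> nat set \<Rightarrow> real" where
  "Lambda a \<beta> J = (\<Sum>i\<in>J. \<beta> i * (8 * pi - (\<Sum>j\<in>J. a i j * \<beta> j)))"

definition Gamma :: "nat \<Rightarrow> (nat \<Rightarrow> real) \<Rightarrow> (nat \<Rightarrow> real^2 \<Rightarrow> real) set" where
  "Gamma n \<beta> = {\<rho>. \<forall>i\<in>{1..n}.
      \<rho> i \<in> borel_measurable lborel \<and>
      (\<forall>x. 0 \<le> \<rho> i x) \<and>
      integrable lborel (\<lambda>x. \<rho> i x * ln (\<rho> i x)) \<and>
      integrable lborel (\<lambda>x. norm x ^ 2 * \<rho> i x) \<and>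
      integrable lborel (\<rho> i) \<and>
      (\<integral>x. \<rho> i x \<partial>lborel) = \<beta> i}"

definition FF :: "nat \<Rightarrow> (nat \<Rightarrow> nat \<Rightarrow> real) \<Rightarrow> (nat \<Rightarrow> real^2) \<Rightarrow> (nat \<Rightarrow> real)
    \<Rightarrow> (nat \<Rightarrow> real^2 \<Rightarrow> real) \<Rightarrow> real" where
  "FF n a v \<alpha> \<rho> =
     (\<Sum>i\<in>{1..n}. (\<integral>x. \<rho> i x * ln (\<rho> i x) \<partial>lborel))
   + 1 / (4 * pi) * (\<Sum>i\<in>{1..n}. \<Sum>j\<in>{1..n}. a i j *
        (\<integral>z. \<rho> i (fst z) * ln (dist (fst z) (snd z)) * \<rho> j (snd z)
            \<partial>(lborel \<Otimes>\<^sub>M lborel)))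
   + (\<Sum>i\<in>{1..n}. \<alpha> i * (\<integral>x. (norm (x - v i)) ^ 2 * \<rho> i x \<partial>lborel))"

end

theory Submission
  imports Defs
begin

text \<open>
  Boundedness. Randomly shifted dyadic grids replace \<open>ln |x - y|\<close>, up to a constant, by \<open>- ln 2\<close> times
  the expected number of dyadic squares containing both points, so no rearrangement is needed. At
  a fixed resolution the energy becomes the sum of \<open>m\<^sub>i ln m\<^sub>i\<close> over the leaves of a 4-ary tree plus
  \<open>ln 2 / (4 \<pi>) \<Lambda>(m(Q))\<close> summed over its inner nodes \<open>Q\<close>, where \<open>m(Q)\<close> is the vector of masses in \<open>Q\<close>.
  Since \<open>\<Lambda>\<close> is concave in each coordinate, the hypotheses at the vertices of the box of mass
  vectors say exactly that \<open>\<Lambda>(m)\<close> is at least a multiple of \<open>\<Sum>\<^sub>i min (m\<^sub>i, \<beta>\<^sub>i - m\<^sub>i)\<close>. This pays for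
  the entropy lost when mass escapes from a node, by way of an explicit subsolution of the tree
  recursion. Distances above 1 only help, so the plane is folded onto a torus, the confinement
  paying for the entropy of the folding.

  Unboundedness. If \<open>\<Lambda>\<^sub>J < 0\<close>, concentrate the species in \<open>J\<close> at a point. If \<open>\<Lambda>\<^sub>J = \<Lambda>\<^bsub>J - {i}\<^esub> = a\<^sub>i\<^sub>i = 0\<close>,
  concentrate those in \<open>J - {i}\<close> and spread species \<open>i\<close> evenly over \<open>K\<close> scales: this costs no
  energy and gains the entropy \<open>\<beta>\<^sub>i ln K\<close>.
\<close>

definition xlnx :: "real \<Rightarrow> real" where
  "xlnx t = t * ln t"

lemma xlnx_0 [simp]: "xlnx 0 = 0"
  by (simp add: xlnx_def)

lemma xlnx_ge_linear:
  assumes "0 \<le> r" "0 < g"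
  shows "r * ln g + r - g \<le> xlnx r"
proof (cases "r = 0")
  case False
  then have "0 < r" using assms by simp
  have "ln (g / r) \<le> g / r - 1"
    using \<open>0 < r\<close> assms by (intro ln_le_minus_one) simp
  then have "r * ln (g / r) \<le> r * (g / r - 1)"
    using \<open>0 < r\<close> by (intro mult_left_mono) auto
  then show ?thesis
    using \<open>0 < r\<close> assms by (simp add: ln_div xlnx_def algebra_simps)
qed (use assms in auto)

lemma mult_ln_minus_xlnx_le:
  assumes "0 \<le> e" "0 < t" "0 < \<nu>"
  shows "e * ln t - xlnx e \<le> \<nu> * t - e * (1 + ln \<nu>)"
  using xlnx_ge_linear[of e "\<nu> * t"] assms by (simp add: ln_mult algebra_simps)

lemma sum_xlnx_ge:
  fixes t :: "'c \<Rightarrow> real"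
  assumes "finite C" "card C \<le> 4" "\<And>c. c \<in> C \<Longrightarrow> 0 \<le> t c"
  shows "xlnx (sum t C) - ln 4 * sum t C \<le> (\<Sum>c\<in>C. xlnx (t c))"
proof (cases "sum t C = 0")
  case True
  then have "\<forall>c\<in>C. t c = 0"
    using assms(1,3) sum_nonneg_eq_0_iff[of C t] by auto
  then show ?thesis using True by simp
next
  case False
  define T where "T = sum t C"
  have T: "0 < T"
    using False assms(3) sum_nonneg[of C t] unfolding T_def by (simp add: less_le)
  have "T * ln (T / 4) + T - real (card C) * (T / 4) = (\<Sum>c\<in>C. t c * ln (T / 4) + t c - T / 4)"
    by (simp add: T_def sum.distrib sum_subtractf sum_distrib_right)
  also have "\<dots> \<le> (\<Sum>c\<in>C. xlnx (t c))"
    using T assms by (intro sum_mono xlnx_ge_linear) auto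
  finally have "T * ln (T / 4) + T - real (card C) * (T / 4) \<le> (\<Sum>c\<in>C. xlnx (t c))" .
  moreover have "real (card C) * (T / 4) \<le> 4 * (T / 4)"
    using T assms(2) by (intro mult_right_mono) auto
  moreover have "T * ln (T / 4) = xlnx T - ln 4 * T"
    using T by (simp add: ln_div xlnx_def algebra_simps)
  ultimately show ?thesis
    unfolding T_def[symmetric] by linarith
qed

lemma sum_xlnx_ge_escape:
  fixes t :: "'c \<Rightarrow> real"
  assumes "finite C" "card C \<le> 4" "\<And>c. c \<in> C \<Longrightarrow> 0 \<le> t c" "d \<in> C"
  defines "e \<equiv> sum t C - t d"
  shows "xlnx (sum t C) - (e * ln (sum t C) - xlnx e + (1 + ln 4) * e) \<le> (\<Sum>c\<in>C. xlnx (t c))"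
proof (cases "sum t C = 0")
  case True
  then have "\<forall>c\<in>C. t c = 0"
    using assms(1,3) sum_nonneg_eq_0_iff[of C t] by auto
  then show ?thesis using True assms(4) by (simp add: e_def)
next
  case False
  define T where "T = sum t C"
  have T: "0 < T"
    using False assms(3) sum_nonneg[of C t] unfolding T_def by (simp add: less_le)
  have e: "e = sum t (C - {d})"
    using assms by (simp add: e_def sum_diff1)
  have "card (C - {d}) \<le> 4"
    using assms by (simp add: le_diff_conv)
  then have 1: "xlnx e - ln 4 * e \<le> (\<Sum>c\<in>C-{d}. xlnx (t c))"
    unfolding e using assms by (intro sum_xlnx_ge) auto
  have "t d * ln T + t d - T \<le> xlnx (t d)"
    using T assms by (intro xlnx_ge_linear) auto
  with 1 have "t d * ln T + t d - T + (xlnx e - ln 4 * e) \<le> (\<Sum>c\<in>C. xlnx (t c))"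
    using assms by (simp add: sum.remove[of C d])
  moreover have "t d = T - e" by (simp add: e_def T_def)
  ultimately show ?thesis
    by (simp add: xlnx_def T_def[symmetric] algebra_simps)
qed

text \<open>Its derivative blows up logarithmically at \<open>t = b\<close>: a mass \<open>e\<close> escaping from a nearly full node raises
  it by about \<open>e ln (1/e)\<close>, the entropy lost.\<close>

definition xi :: "real \<Rightarrow> real \<Rightarrow> real" where
  "xi b t = xlnx b - xlnx (b - t)"

lemma xi_0 [simp]: "xi b 0 = 0"
  by (simp add: xi_def)

lemma xi_ge:
  assumes "0 < b" "0 \<le> t" "t \<le> b"
  shows "t * ln b \<le> xi b t"
proof (cases "t = b")
  case False
  then have "(b - t) * ln (b - t) \<le> (b - t) * ln b"
    using assms by (intro mult_left_mono) auto
  then show ?thesis by (simp add: xi_def xlnx_def algebra_simps)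
qed (simp add: xi_def xlnx_def)

lemma xi_le: "0 < b \<Longrightarrow> t \<le> b \<Longrightarrow> xi b t \<le> t * (1 + ln b)"
  using xlnx_ge_linear[of "b - t" b] by (simp add: xi_def xlnx_def algebra_simps)

lemma xi_ge_quadratic:
  assumes "0 < b" "0 \<le> t" "t \<le> b"
  shows "t * (1 + ln b) - t\<^sup>2 / b \<le> xi b t"
proof (cases "t = b")
  case False
  have "ln ((b - t) / b) \<le> (b - t) / b - 1"
    using False assms by (intro ln_le_minus_one) auto
  then have "(b - t) * ln ((b - t) / b) \<le> (b - t) * ((b - t) / b - 1)"
    using assms by (intro mult_left_mono) auto
  then show ?thesis
    using False assms by (simp add: xi_def xlnx_def ln_div field_simps power2_eq_square)
qed (use assms in \<open>simp add: xi_def xlnx_def field_simps power2_eq_square\<close>)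

lemma escape_le_xi:
  assumes b: "0 < b" and \<nu>: "0 < \<nu>" "\<nu> \<le> 1"
    and e: "0 \<le> e" "e \<le> t" and t: "0 < t" "t \<le> b"
  shows "e * ln t - xlnx e
    \<le> \<nu> * min t (b - t) + (2 + 2 * \<bar>ln b\<bar> - ln \<nu>) * e + (xi b (t - e) - xi b t)"
proof (cases "e = 0")
  case True
  then show ?thesis using assms by simp
next
  case False
  then have e0: "0 < e" using e by simp
  define d where "d = b - t"
  have d: "0 \<le> d" using t by (simp add: d_def)
  have lnb: "e * ln t \<le> e * \<bar>ln b\<bar>"
    using e t by (intro mult_left_mono order_trans[OF _ abs_ge_self]) auto
  have lnbb: "e * ln (d + e) \<le> e * \<bar>ln b\<bar>"
    using e0 d e by (intro mult_left_mono order_trans[OF _ abs_ge_self]) (auto simp: d_def)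
  have xi: "xi b (t - e) - xi b t = xlnx d - xlnx (d + e)"
    by (simp add: xi_def d_def algebra_simps)
  have "d * ln (d + e) + d - (d + e) \<le> xlnx d"
    using d e0 by (intro xlnx_ge_linear) auto
  then have xi2: "- e * ln (d + e) - e \<le> xi b (t - e) - xi b t"
    unfolding xi by (simp add: xlnx_def algebra_simps)
  have nn: "0 \<le> e * \<bar>ln b\<bar>" using e by simp
  have rhs: "(2 + 2 * \<bar>ln b\<bar> - ln \<nu>) * e = 2 * e + 2 * (e * \<bar>ln b\<bar>) - e * ln \<nu>"
    by (simp add: algebra_simps)
  show ?thesis
  proof (cases "t \<le> d")
    case True
    have "e * ln t - xlnx e \<le> \<nu> * t - e * (1 + ln \<nu>)"
      using e t \<nu> by (intro mult_ln_minus_xlnx_le) auto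
    moreover have "min t (b - t) = t" using True by (simp add: d_def)
    ultimately show ?thesis
      using xi2 lnbb nn e0 unfolding rhs by (simp only: distrib_left minus_mult_left[symmetric] mult_1_right)
  next
    case False
    have "e * ln (d + e) - xlnx e \<le> \<nu> * (d + e) - e * (1 + ln \<nu>)"
      using d e0 \<nu> by (intro mult_ln_minus_xlnx_le) auto
    moreover have "\<nu> * e \<le> e" using \<nu> e by (simp add: mult_left_le_one_le)
    ultimately have "- xlnx e \<le> \<nu> * d - e * ln \<nu> - e * ln (d+e)"
      by (simp add: algebra_simps)
    moreover have "min t (b - t) = d" using False by (simp add: d_def)
    ultimately show ?thesis
      using xi2 lnb nn e0 unfolding rhs by (simp only: distrib_left minus_mult_left[symmetric] mult_1_right)
  qed
qed

section \<open>Coercivity of \<open>\<Lambda>\<close> on the box of masses\<close>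

lemma Lambda_insert_split:
  fixes a :: "nat \<Rightarrow> nat \<Rightarrow> real" and m :: "nat \<Rightarrow> real" and t :: real
  assumes "finite I" "j \<in> I" "\<forall>i\<in>I. \<forall>k\<in>I. a i k = a k i"
  shows "Lambda a (m(j := t)) I = Lambda a m (I - {j})
     + t * (8 * pi - 2 * (\<Sum>k\<in>I-{j}. a j k * m k)) - a j j * t\<^sup>2"
proof -
  let ?I = "I - {j}"
  have sym: "(\<Sum>i\<in>?I. m i * (a i j * t)) = t * (\<Sum>k\<in>?I. a j k * m k)"
    unfolding sum_distrib_left using assms by (intro sum.cong) auto
  have "Lambda a (m(j := t)) I = t * (8 * pi - (a j j * t + (\<Sum>k\<in>?I. a j k * m k)))
    + (\<Sum>i\<in>?I. m i * (8 * pi - (a i j * t + (\<Sum>k\<in>?I. a i k * m k))))"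
    unfolding Lambda_def using assms by (simp add: sum.remove[of I j])
  also have "(\<Sum>i\<in>?I. m i * (8 * pi - (a i j * t + (\<Sum>k\<in>?I. a i k * m k))))
    = Lambda a m ?I - (\<Sum>i\<in>?I. m i * (a i j * t))"
    unfolding Lambda_def by (simp add: sum_subtractf[symmetric] algebra_simps)
  finally show ?thesis
    unfolding sym by (simp add: algebra_simps power2_eq_square del: fun_upd_apply)
qed

lemma Lambda_interpolate:
  fixes a :: "nat \<Rightarrow> nat \<Rightarrow> real" and m :: "nat \<Rightarrow> real" and b t :: real
  assumes "finite I" "j \<in> I" "\<forall>i\<in>I. \<forall>k\<in>I. a i k = a k i"
  shows "b * Lambda a (m(j := t)) I = (b - t) * Lambda a (m(j := 0)) I
    + t * Lambda a (m(j := b)) I + a j j * t * (b - t) * b"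
proof -
  note split = Lambda_insert_split[OF assms, of m]
  show ?thesis
    unfolding split[of t] split[of 0] split[of b] by (simp add: algebra_simps power2_eq_square)
qed

lemma Lambda_restrict:
  fixes a :: "nat \<Rightarrow> nat \<Rightarrow> real" and m \<beta> :: "nat \<Rightarrow> real"
  assumes "finite I" "J \<subseteq> I" "\<And>j. j \<in> J \<Longrightarrow> m j = \<beta> j" "\<And>j. j \<in> I - J \<Longrightarrow> m j = 0"
  shows "Lambda a m I = Lambda a \<beta> J"
proof -
  have *: "(\<Sum>j\<in>I. a i j * m j) = (\<Sum>j\<in>J. a i j * \<beta> j)" for i
    using assms by (intro sum.mono_neutral_cong_right) auto
  show ?thesis
    unfolding Lambda_def * using assms by (intro sum.mono_neutral_cong_right) auto
qed

lemma Lambda_move_to_vertices: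
  fixes a :: "nat \<Rightarrow> nat \<Rightarrow> real" and m \<beta> :: "nat \<Rightarrow> real"
  assumes I: "finite I" "\<forall>i\<in>I. \<forall>k\<in>I. a i k = a k i"
    and a: "\<And>i. i \<in> I \<Longrightarrow> 0 \<le> a i i" and \<beta>: "\<And>i. i \<in> I \<Longrightarrow> 0 < \<beta> i"
    and m: "\<And>i. i \<in> I \<Longrightarrow> 0 \<le> m i \<and> m i \<le> \<beta> i" and S: "finite S" "S \<subseteq> I"
  shows "\<exists>m'. (\<forall>j\<in>S. m' j = 0 \<or> m' j = \<beta> j) \<and> (\<forall>j. j \<notin> S \<longrightarrow> m' j = m j)
    \<and> Lambda a m' I \<le> Lambda a m I"
  using S
proof (induction S rule: finite_induct)
  case empty
  then show ?case by auto
next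
  case (insert j S)
  then obtain m' where m': "\<forall>j\<in>S. m' j = 0 \<or> m' j = \<beta> j" "\<forall>j. j \<notin> S \<longrightarrow> m' j = m j"
    "Lambda a m' I \<le> Lambda a m I" by auto
  have j: "j \<in> I" "j \<notin> S" using insert by auto
  have b: "0 < \<beta> j" "0 \<le> m j" "m j \<le> \<beta> j" using j \<beta> m by auto
  define L0 L1 L where "L0 = Lambda a (m'(j := 0)) I" "L1 = Lambda a (m'(j := \<beta> j)) I"
    "L = Lambda a m' I"
  have "m'(j := m j) = m'" using m' j by auto
  then have "\<beta> j * L = (\<beta> j - m j) * L0 + m j * L1 + a j j * m j * (\<beta> j - m j) * \<beta> j"
    using Lambda_interpolate[of I j a "\<beta> j" m' "m j"] I j unfolding L0_L1_L_def by simp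
  moreover have "0 \<le> a j j * m j * (\<beta> j - m j) * \<beta> j"
    using b a[OF j(1)] by simp
  ultimately have *: "(\<beta> j - m j) * L0 + m j * L1 \<le> \<beta> j * L" by simp
  have "L0 \<le> L \<or> L1 \<le> L"
  proof (rule ccontr)
    assume "\<not> ?thesis"
    then have "L < L0" "L < L1" by auto
    then have "(\<beta> j - m j) * L \<le> (\<beta> j - m j) * L0" "m j * L \<le> m j * L1"
      using b by (auto intro!: mult_left_mono)
    moreover have "(\<beta> j - m j) * L < (\<beta> j - m j) * L0 \<or> m j * L < m j * L1"
      using b \<open>L < L0\<close> \<open>L < L1\<close> by (cases "m j = 0") auto
    ultimately show False using * by (auto simp: algebra_simps)
  qed
  then show ?case
  proof
    assume "L0 \<le> L"
    then have "Lambda a (m'(j := 0)) I \<le> Lambda a m I"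
      using m' unfolding L0_L1_L_def by linarith
    then show ?thesis using m' j
      by (intro exI[of _ "m'(j := 0)"] conjI) (auto simp: fun_upd_def)
  next
    assume "L1 \<le> L"
    then have "Lambda a (m'(j := \<beta> j)) I \<le> Lambda a m I"
      using m' unfolding L0_L1_L_def by linarith
    then show ?thesis using m' j
      by (intro exI[of _ "m'(j := \<beta> j)"] conjI) (auto simp: fun_upd_def)
  qed
qed

lemma Lambda_coercive:
  fixes a :: "nat \<Rightarrow> nat \<Rightarrow> real" and \<beta> :: "nat \<Rightarrow> real"
  assumes I: "finite I" "I \<noteq> {}" and sym: "\<forall>i\<in>I. \<forall>k\<in>I. a i k = a k i"
    and a: "\<And>i. i \<in> I \<Longrightarrow> 0 \<le> a i i" and \<beta>: "\<And>i. i \<in> I \<Longrightarrow> 0 < \<beta> i"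
    and nonneg: "\<And>J. J \<subseteq> I \<Longrightarrow> 0 \<le> Lambda a \<beta> J"
    and edge: "\<And>J i. J \<subseteq> I \<Longrightarrow> i \<in> J \<Longrightarrow> Lambda a \<beta> J = 0 \<Longrightarrow> 0 < a i i + Lambda a \<beta> (J - {i})"
  obtains c where "0 < c" "\<And>m. (\<And>i. i \<in> I \<Longrightarrow> 0 \<le> m i \<and> m i \<le> \<beta> i) \<Longrightarrow>
    c * (\<Sum>i\<in>I. min (m i) (\<beta> i - m i)) \<le> Lambda a m I"
proof -
  define q where "q = (\<lambda>(J, i). (Lambda a \<beta> J + Lambda a \<beta> (J - {i})) / \<beta> i + a i i * \<beta> i / 2)"
  define D where "D = Sigma (Pow I) (\<lambda>J. J)"
  have D: "finite D" "D \<noteq> {}"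
    using I finite_subset[of _ I] unfolding D_def by (auto intro!: finite_SigmaI)
  have q: "0 < q p" if pD: "p \<in> D" for p
  proof -
    obtain J i where p: "p = (J, i)" "J \<subseteq> I" "i \<in> J" using pD unfolding D_def by auto
    have i: "i \<in> I" "0 < \<beta> i" "0 \<le> a i i" using p \<beta> a by auto
    have J: "0 \<le> Lambda a \<beta> J" "0 \<le> Lambda a \<beta> (J - {i})" using p nonneg[of J] nonneg[of "J - {i}"] by auto
    consider "0 < Lambda a \<beta> J + Lambda a \<beta> (J - {i})" | "0 < a i i"
      using edge[of J i] J i p by linarith
    then show ?thesis
    proof cases
      case 1
      then show ?thesis using i unfolding p q_def
        by (simp add: add_pos_nonneg)
    next
      case 2
      then show ?thesis using i J unfolding p q_def
        by (simp add: add_nonneg_pos)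
    qed
  qed
  define c where "c = Min (q ` D)"
  have c: "0 < c" using q D unfolding c_def by simp
  have single: "c * min (m i) (\<beta> i - m i) \<le> Lambda a m I"
    if m: "\<And>i. i \<in> I \<Longrightarrow> 0 \<le> m i \<and> m i \<le> \<beta> i" and i: "i \<in> I" for m i
  proof -
    obtain m' where m': "\<forall>j\<in>I - {i}. m' j = 0 \<or> m' j = \<beta> j" "\<forall>j. j \<notin> I - {i} \<longrightarrow> m' j = m j"
      "Lambda a m' I \<le> Lambda a m I"
      using Lambda_move_to_vertices[where I = I and S = "I - {i}" and m = m and a = a and \<beta> = \<beta>]
        I(1) sym a \<beta> m by auto
    define J where "J = insert i {j \<in> I - {i}. m' j = \<beta> j}"
    have J: "J \<subseteq> I" "i \<in> J" using i by (auto simp: J_def)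
    have b: "0 < \<beta> i" "0 \<le> m i" "m i \<le> \<beta> i" "0 \<le> a i i" using i \<beta> m a by auto
    have L1: "Lambda a (m'(i := \<beta> i)) I = Lambda a \<beta> J"
      using I J m' by (intro Lambda_restrict) (auto simp: J_def)
    have L0: "Lambda a (m'(i := 0)) I = Lambda a \<beta> (J - {i})"
      using I J m' by (intro Lambda_restrict) (auto simp: J_def)
    have "m'(i := m i) = m'" using m' by auto
    then have eq: "\<beta> i * Lambda a m' I = (\<beta> i - m i) * Lambda a \<beta> (J - {i}) + m i * Lambda a \<beta> J
        + a i i * m i * (\<beta> i - m i) * \<beta> i"
      using Lambda_interpolate[OF I(1) i sym, of "\<beta> i" m' "m i"] unfolding L0 L1 by simp
    define u where "u = min (m i) (\<beta> i - m i)"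
    have u: "0 \<le> u" "u \<le> m i" "u \<le> \<beta> i - m i" using b by (auto simp: u_def)
    have "u * (\<beta> i / 2) \<le> m i * (\<beta> i - m i)"
    proof (cases "m i \<le> \<beta> i / 2")
      case True
      then show ?thesis using u b by (intro mult_mono) auto
    next
      case False
      then have "u * (\<beta> i / 2) \<le> (\<beta> i - m i) * m i" using u b by (intro mult_mono) auto
      then show ?thesis by (simp add: mult.commute)
    qed
    then have "(a i i * \<beta> i) * (u * (\<beta> i / 2)) \<le> (a i i * \<beta> i) * (m i * (\<beta> i - m i))"
      using b by (intro mult_left_mono) auto
    moreover have "u * Lambda a \<beta> (J - {i}) \<le> (\<beta> i - m i) * Lambda a \<beta> (J - {i})"
      "u * Lambda a \<beta> J \<le> m i * Lambda a \<beta> J"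
      using u J nonneg[of J] nonneg[of "J - {i}"] by (auto intro!: mult_right_mono)
    moreover have "\<beta> i * (q (J, i) * u)
      = u * Lambda a \<beta> J + u * Lambda a \<beta> (J - {i}) + (a i i * \<beta> i) * (u * (\<beta> i / 2))"
      unfolding q_def using b by (simp add: field_simps)
    ultimately have "\<beta> i * (q (J, i) * u) \<le> \<beta> i * Lambda a m' I"
      unfolding eq by (simp add: mult_ac)
    then have "q (J, i) * u \<le> Lambda a m' I" using b by simp
    moreover have "c \<le> q (J, i)"
      unfolding c_def using D J by (intro Min_le) (auto simp: D_def)
    then have "c * u \<le> q (J, i) * u" using u by (intro mult_right_mono)
    ultimately show ?thesis using m' by (simp add: u_def)
  qed
  show ?thesis
  proof (rule that)
    have I0: "0 < real (card I)" using I by (simp add: card_gt_0_iff)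
    then show "0 < c / real (card I)" using c by simp
    fix m assume m: "\<And>i. i \<in> I \<Longrightarrow> 0 \<le> m i \<and> m i \<le> \<beta> i"
    have "(\<Sum>i\<in>I. c * min (m i) (\<beta> i - m i)) \<le> (\<Sum>i\<in>I. Lambda a m I)"
      using single[OF m] by (intro sum_mono) auto
    then show "c / real (card I) * (\<Sum>i\<in>I. min (m i) (\<beta> i - m i)) \<le> Lambda a m I"
      using I0 by (simp add: sum_distrib_left[symmetric] field_simps)
  qed
qed

section \<open>A subsolution of the tree recursion\<close>

text \<open>The quadratic term pays, with its large factor \<open>B\<close>, for every loss linear in the mass escaping from the
  heaviest child.\<close>

definition tree_potential :: "nat set \<Rightarrow> (nat \<Rightarrow> real) \<Rightarrow> real \<Rightarrow> (nat \<Rightarrow> real) \<Rightarrow> real" where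
  "tree_potential I \<beta> B m = (\<Sum>i\<in>I. xlnx (m i) + xi (\<beta> i) (m i)) - B * (\<Sum>i\<in>I. m i)\<^sup>2"

lemma split_loss_le_escape:
  fixes t :: "'c \<Rightarrow> real"
  assumes C: "finite C" "card C \<le> 4" "d \<in> C" and t: "\<And>c. c \<in> C \<Longrightarrow> 0 \<le> t c"
    and b: "0 < b" "sum t C \<le> b" and \<nu>: "0 < \<nu>" "\<nu> \<le> 1"
  shows "xlnx (sum t C) + xi b (sum t C) - (\<Sum>c\<in>C. xlnx (t c) + xi b (t c))
    \<le> \<nu> * min (sum t C) (b - sum t C)
      + (3 + 3 * \<bar>ln b\<bar> + ln 4 - ln \<nu>) * (sum t C - t d)"
proof (cases "sum t C = 0")
  case True
  then have "\<forall>c\<in>C. t c = 0"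
    using C t sum_nonneg_eq_0_iff[of C t] by auto
  then show ?thesis using True C b by simp
next
  case False
  define T where "T = sum t C"
  define e where "e = T - t d"
  have T: "0 < T" "T \<le> b"
    using False t sum_nonneg[of C t] b unfolding T_def by (simp_all add: less_le)
  have e: "e = sum t (C - {d})"
    using C by (simp add: e_def T_def sum_diff1)
  have e0: "0 \<le> e" "e \<le> T"
    using t C unfolding e by (auto simp: T_def intro!: sum_nonneg sum_mono2)
  have 1: "xlnx T - (e * ln T - xlnx e + (1 + ln 4) * e) \<le> (\<Sum>c\<in>C. xlnx (t c))"
    unfolding T_def e_def using C t by (intro sum_xlnx_ge_escape) auto
  have 2: "e * ln T - xlnx e
    \<le> \<nu> * min T (b - T) + (2 + 2 * \<bar>ln b\<bar> - ln \<nu>) * e + (xi b (T - e) - xi b T)"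
    using b \<nu> e0 T by (intro escape_le_xi) auto
  have "- \<bar>ln b\<bar> * e \<le> e * ln b"
    using e0 mult_left_mono[of "- \<bar>ln b\<bar>" "ln b" e] by (simp add: mult.commute)
  also have "\<dots> \<le> (\<Sum>c\<in>C-{d}. xi b (t c))"
    unfolding e sum_distrib_right using t b T C member_le_sum[of _ C t]
    by (intro sum_mono xi_ge) (auto simp: T_def intro: order_trans)
  finally have "xi b (T - e) - \<bar>ln b\<bar> * e \<le> (\<Sum>c\<in>C. xi b (t c))"
    using C by (simp add: sum.remove[of C d] e_def)
  with 1 2 show ?thesis
    unfolding T_def[symmetric] e_def[symmetric] by (simp add: sum.distrib algebra_simps)
qed

lemma sum_power2_le_power2_sum:
  fixes t :: "'c \<Rightarrow> real"
  assumes "finite C" "\<And>c. c \<in> C \<Longrightarrow> 0 \<le> t c"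
  shows "(\<Sum>c\<in>C. (t c)\<^sup>2) \<le> (sum t C)\<^sup>2"
proof -
  have "(\<Sum>c\<in>C. (t c)\<^sup>2) \<le> (\<Sum>c\<in>C. t c * sum t C)"
    unfolding power2_eq_square using assms member_le_sum[of _ C t]
    by (intro sum_mono mult_left_mono) auto
  then show ?thesis by (simp add: sum_distrib_right[symmetric] power2_eq_square)
qed

lemma xi_sum_le:
  fixes t :: "'c \<Rightarrow> real"
  assumes C: "finite C" and t: "\<And>c. c \<in> C \<Longrightarrow> 0 \<le> t c" and b: "0 < b" "sum t C \<le> b"
  shows "xi b (sum t C) - (\<Sum>c\<in>C. xi b (t c)) \<le> (sum t C)\<^sup>2 / b"
proof -
  have "(\<Sum>c\<in>C. t c * (1 + ln b) - (t c)\<^sup>2 / b) \<le> (\<Sum>c\<in>C. xi b (t c))"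
    using C t b member_le_sum[of _ C t] by (intro sum_mono xi_ge_quadratic) force+
  then have "sum t C * (1 + ln b) - (\<Sum>c\<in>C. (t c)\<^sup>2) / b \<le> (\<Sum>c\<in>C. xi b (t c))"
    by (simp add: sum_subtractf sum_distrib_right sum_divide_distrib)
  moreover have "xi b (sum t C) \<le> sum t C * (1 + ln b)"
    using b by (intro xi_le)
  moreover have "(\<Sum>c\<in>C. (t c)\<^sup>2) / b \<le> (sum t C)\<^sup>2 / b"
    using b C t sum_power2_le_power2_sum[of C t] by (intro divide_right_mono) auto
  ultimately show ?thesis by linarith
qed

lemma ln_4_bounds: "1 \<le> ln (4::real)" "ln (4::real) \<le> 2"
proof -
  have "ln (4::real) = 2 * ln 2" using ln_realpow[of "2::real" 2] by simp
  then show "1 \<le> ln (4::real)" "ln (4::real) \<le> 2"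
    using ln2_ge_two_thirds ln_2_less_1 by linarith+
qed

lemma Lambda_ge_near_0:
  fixes a :: "nat \<Rightarrow> nat \<Rightarrow> real" and m :: "nat \<Rightarrow> real"
  assumes "finite I" "\<And>i j. i \<in> I \<Longrightarrow> j \<in> I \<Longrightarrow> 0 \<le> a i j" "\<And>i. i \<in> I \<Longrightarrow> 0 \<le> m i"
  shows "8 * pi * sum m I - (\<Sum>i\<in>I. \<Sum>j\<in>I. a i j) * (sum m I)\<^sup>2 \<le> Lambda a m I"
proof -
  have m: "m i \<le> sum m I" if "i \<in> I" for i
    using that assms by (intro member_le_sum) auto
  have "(\<Sum>i\<in>I. \<Sum>j\<in>I. m i * (a i j * m j)) \<le> (\<Sum>i\<in>I. \<Sum>j\<in>I. sum m I * (a i j * sum m I))"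
    using m assms by (intro sum_mono mult_mono) (auto intro!: sum_nonneg)
  also have "\<dots> = (\<Sum>i\<in>I. \<Sum>j\<in>I. a i j) * (sum m I)\<^sup>2"
  proof -
    have "(\<Sum>i\<in>I. \<Sum>j\<in>I. s * (a i j * s)) = (\<Sum>i\<in>I. \<Sum>j\<in>I. a i j) * s\<^sup>2" for s
      by (simp add: sum_distrib_left power2_eq_square mult_ac)
    then show ?thesis .
  qed
  finally have "8 * pi * sum m I - (\<Sum>i\<in>I. \<Sum>j\<in>I. a i j) * (sum m I)\<^sup>2
    \<le> 8 * pi * sum m I - (\<Sum>i\<in>I. \<Sum>j\<in>I. m i * (a i j * m j))" by simp
  also have "\<dots> = Lambda a m I"
    unfolding Lambda_def
    by (simp add: right_diff_distrib sum_subtractf sum_distrib_left sum_distrib_right mult_ac)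
  finally show ?thesis .
qed

lemma tree_potential_split:
  fixes a :: "nat \<Rightarrow> nat \<Rightarrow> real" and \<beta> :: "nat \<Rightarrow> real"
  assumes I: "finite I" "I \<noteq> {}" and sym: "\<forall>i\<in>I. \<forall>k\<in>I. a i k = a k i"
    and a: "\<And>i j. i \<in> I \<Longrightarrow> j \<in> I \<Longrightarrow> 0 \<le> a i j" and \<beta>: "\<And>i. i \<in> I \<Longrightarrow> 0 < \<beta> i"
    and nonneg: "\<And>J. J \<subseteq> I \<Longrightarrow> 0 \<le> Lambda a \<beta> J"
    and edge: "\<And>J i. J \<subseteq> I \<Longrightarrow> i \<in> J \<Longrightarrow> Lambda a \<beta> J = 0 \<Longrightarrow> 0 < a i i + Lambda a \<beta> (J - {i})"
  obtains B where "0 \<le> B" "\<And>C (mc :: 'c \<Rightarrow> nat \<Rightarrow> real).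
    \<lbrakk>finite C; C \<noteq> {}; card C \<le> 4; \<And>c i. c \<in> C \<Longrightarrow> i \<in> I \<Longrightarrow> 0 \<le> mc c i;
      \<And>i. i \<in> I \<Longrightarrow> (\<Sum>c\<in>C. mc c i) \<le> \<beta> i\<rbrakk> \<Longrightarrow>
    tree_potential I \<beta> B (\<lambda>i. \<Sum>c\<in>C. mc c i) \<le>
      ln 4 / (8 * pi) * Lambda a (\<lambda>i. \<Sum>c\<in>C. mc c i) I + (\<Sum>c\<in>C. tree_potential I \<beta> B (mc c))"
proof -
  obtain c0 where c0: "0 < c0" "\<And>m. (\<And>i. i \<in> I \<Longrightarrow> 0 \<le> m i \<and> m i \<le> \<beta> i) \<Longrightarrow>
    c0 * (\<Sum>i\<in>I. min (m i) (\<beta> i - m i)) \<le> Lambda a m I"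
    by (rule Lambda_coercive[of I a \<beta>, OF I sym _ \<beta> nonneg edge]) (use a in auto)
  define k where "k = ln 4 / (8 * pi)"
  have k: "0 < k" "k * (8 * pi) = ln 4" using ln_4_bounds by (auto simp: k_def)
  define \<nu> where "\<nu> = min 1 (k * c0)"
  have \<nu>: "0 < \<nu>" "\<nu> \<le> 1" "\<nu> \<le> k * c0" using k c0 by (auto simp: \<nu>_def)
  define A where "A = (\<Sum>i\<in>I. \<Sum>j\<in>I. a i j)"
  define R where "R = (\<Sum>i\<in>I. 1 / \<beta> i)"
  define G where "G = k * A + R + 1"
  have A0: "0 \<le> A" unfolding A_def using a by (intro sum_nonneg) auto
  have R0: "0 \<le> R" unfolding R_def using \<beta> by (intro sum_nonneg) (auto simp: less_imp_le)
  have G0: "1 \<le> G" unfolding G_def using A0 R0 k by simp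
  define D where "D i = 3 + 3 * \<bar>ln (\<beta> i)\<bar> + ln 4 - ln \<nu>" for i
  have "ln \<nu> \<le> 0" using \<nu> by simp
  then have D0: "0 \<le> D i" for i unfolding D_def using ln_4_bounds by (smt (verit) abs_ge_zero)
  define D' where "D' = sum D I"
  have D': "0 \<le> D'" "\<And>i. i \<in> I \<Longrightarrow> D i \<le> D'"
    using D0 I by (auto simp: D'_def intro!: sum_nonneg member_le_sum)
  define B where "B = 16 * G + 2 * G * D'"
  have B0: "0 \<le> B" using G0 D' by (simp add: B_def)
  show ?thesis
  proof (rule that[OF B0])
    fix C and mc :: "'c \<Rightarrow> nat \<Rightarrow> real"
    assume C: "finite C" "C \<noteq> {}" "card C \<le> 4"
      and mc: "\<And>c i. c \<in> C \<Longrightarrow> i \<in> I \<Longrightarrow> 0 \<le> mc c i"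
      and m\<beta>: "\<And>i. i \<in> I \<Longrightarrow> (\<Sum>c\<in>C. mc c i) \<le> \<beta> i"
    define m where "m = (\<lambda>i. \<Sum>c\<in>C. mc c i)"
    define Mc where "Mc c = sum (mc c) I" for c
    define M where "M = sum m I"
    have m: "0 \<le> m i" "m i \<le> \<beta> i" if "i \<in> I" for i
      using that mc m\<beta> by (auto simp: m_def intro!: sum_nonneg)
    have M: "M = sum Mc C" unfolding M_def m_def Mc_def by (rule sum.swap)
    have Mc: "0 \<le> Mc c" if "c \<in> C" for c
      unfolding Mc_def using that mc by (intro sum_nonneg) auto
    have M0: "0 \<le> M" unfolding M using Mc by (intro sum_nonneg)
    have "Max (Mc ` C) \<in> Mc ` C" using C by (intro Max_in) auto
    then obtain d where d: "d \<in> C" "Mc d = Max (Mc ` C)" by auto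
    have dmax: "Mc c \<le> Mc d" if "c \<in> C" for c
      unfolding d(2) using that C by (intro Max_ge) auto
    define e where "e i = m i - mc d i" for i
    define E where "E = sum e I"
    have E: "E = M - Mc d" by (simp add: E_def e_def sum_subtractf M_def Mc_def)
    have e0: "0 \<le> e i" if "i \<in> I" for i
      unfolding e_def m_def using that mc C d member_le_sum[of d C "\<lambda>c. mc c i"] by simp
    have E0: "0 \<le> E" unfolding E_def using e0 by (intro sum_nonneg)
    have "(\<Sum>c\<in>C. (Mc c)\<^sup>2) \<le> (\<Sum>c\<in>C. Mc c * Mc d)"
      unfolding power2_eq_square using dmax Mc by (intro sum_mono mult_left_mono) auto
    also have "\<dots> = M * Mc d" by (simp add: M sum_distrib_right)
    finally have quad: "M * E \<le> M\<^sup>2 - (\<Sum>c\<in>C. (Mc c)\<^sup>2)"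
      by (simp add: E power2_eq_square algebra_simps)
    define X where "X i = xlnx (m i) + xi (\<beta> i) (m i) - (\<Sum>c\<in>C. xlnx (mc c i) + xi (\<beta> i) (mc c i))" for i
    have tp: "tree_potential I \<beta> B m - (\<Sum>c\<in>C. tree_potential I \<beta> B (mc c))
      = sum X I - B * (M\<^sup>2 - (\<Sum>c\<in>C. (Mc c)\<^sup>2))"
      unfolding tree_potential_def X_def M_def Mc_def
      by (simp add: sum_subtractf sum.swap[of _ C] sum_distrib_left algebra_simps)
    have "sum X I \<le> k * Lambda a m I + B * (M * E)"
    proof (cases "1 / (2 * G) \<le> M")
      case True
      have "X i \<le> \<nu> * min (m i) (\<beta> i - m i) + D' * e i" if i: "i \<in> I" for i
      proof -
        have "X i \<le> \<nu> * min (m i) (\<beta> i - m i) + D i * e i"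
          unfolding X_def D_def e_def m_def using C d mc i \<beta> m\<beta> \<nu>
          by (intro split_loss_le_escape) auto
        also have "D i * e i \<le> D' * e i" using D' e0 i by (intro mult_right_mono) auto
        finally show ?thesis by simp
      qed
      then have "sum X I \<le> (\<Sum>i\<in>I. \<nu> * min (m i) (\<beta> i - m i) + D' * e i)"
        by (intro sum_mono)
      also have "\<dots> = \<nu> * (\<Sum>i\<in>I. min (m i) (\<beta> i - m i)) + D' * E"
        by (simp add: sum.distrib sum_distrib_left E_def)
      also have "\<dots> \<le> k * Lambda a m I + B * (M * E)"
      proof (rule add_mono)
        have "\<nu> * (\<Sum>i\<in>I. min (m i) (\<beta> i - m i)) \<le> (k * c0) * (\<Sum>i\<in>I. min (m i) (\<beta> i - m i))"
          using \<nu> m by (intro mult_right_mono sum_nonneg) auto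
        also have "\<dots> \<le> k * Lambda a m I"
          using c0(2)[of m] m k by (simp add: mult.assoc)
        finally show "\<nu> * (\<Sum>i\<in>I. min (m i) (\<beta> i - m i)) \<le> k * Lambda a m I" .
        have "D' = (2 * G * D') * (1 / (2 * G))" using G0 by simp
        also have "\<dots> \<le> B * M" using True G0 D' by (intro mult_mono) (auto simp: B_def)
        finally have "D' * E \<le> B * M * E" using E0 by (intro mult_right_mono)
        then show "D' * E \<le> B * (M * E)" by (simp add: mult.assoc)
      qed
      finally show ?thesis .
    next
      case False
      then have small: "G * M \<le> 1 / 2" using G0 by (simp add: field_simps)
      have L: "ln 4 * M - k * A * M\<^sup>2 \<le> k * Lambda a m I"
      proof -
        have "k * (8 * pi * M - A * M\<^sup>2) \<le> k * Lambda a m I"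
          unfolding M_def A_def using I a m k by (intro mult_left_mono Lambda_ge_near_0) auto
        then show ?thesis using k by (simp add: right_diff_distrib mult.assoc[symmetric])
      qed
      have GM: "k * A * M\<^sup>2 + M\<^sup>2 * R \<le> G * M\<^sup>2"
        by (simp add: G_def algebra_simps)
      define Y where "Y i = xlnx (m i) - (\<Sum>c\<in>C. xlnx (mc c i))" for i
      have "xi (\<beta> i) (m i) - (\<Sum>c\<in>C. xi (\<beta> i) (mc c i)) \<le> M\<^sup>2 * (1 / \<beta> i)" if i: "i \<in> I" for i
      proof -
        have "xi (\<beta> i) (m i) - (\<Sum>c\<in>C. xi (\<beta> i) (mc c i)) \<le> (m i)\<^sup>2 / \<beta> i"
          unfolding m_def using C mc \<beta> m\<beta> i by (intro xi_sum_le) auto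
        also have "\<dots> \<le> M\<^sup>2 / \<beta> i"
          using \<beta>[OF i] m I i unfolding M_def
          by (intro divide_right_mono power_mono member_le_sum) auto
        finally show ?thesis by simp
      qed
      then have "sum X I \<le> (\<Sum>i\<in>I. Y i + M\<^sup>2 * (1 / \<beta> i))"
        unfolding X_def Y_def by (intro sum_mono) (force simp: sum.distrib)
      then have X: "sum X I \<le> sum Y I + M\<^sup>2 * R"
        by (simp add: sum.distrib sum_distrib_left R_def)
      show ?thesis
      proof (cases "M / 16 \<le> E")
        case True
        have "Y i \<le> ln 4 * m i" if i: "i \<in> I" for i
          using sum_xlnx_ge[of C "\<lambda>c. mc c i"] C mc i unfolding Y_def m_def by simp
        then have Y: "sum Y I \<le> ln 4 * M"
          unfolding M_def sum_distrib_left by (intro sum_mono)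
        have "G * M\<^sup>2 = 16 * G * (M * (M / 16))" by (simp add: power2_eq_square)
        also have "\<dots> \<le> B * (M * E)"
          using True M0 G0 D' E0 by (intro mult_mono) (auto simp: B_def)
        finally have "k * A * M\<^sup>2 + M\<^sup>2 * R \<le> B * (M * E)"
          using GM by linarith
        then show ?thesis using L X Y by linarith
      next
        case False
        have "Y i \<le> 1 / 4 * m i + 2 * ln 4 * e i" if i: "i \<in> I" for i
        proof (cases "m i = 0")
          case True
          then have "\<forall>c\<in>C. mc c i = 0"
            using C mc i sum_nonneg_eq_0_iff[of C "\<lambda>c. mc c i"] by (auto simp: m_def)
          then show ?thesis using True d by (simp add: Y_def e_def)
        next
          case False
          have "Y i \<le> e i * ln (m i) - xlnx (e i) + (1 + ln 4) * e i"
            using sum_xlnx_ge_escape[of C "\<lambda>c. mc c i" d] C mc i d unfolding Y_def m_def e_def by simp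
          moreover have "e i * ln (m i) - xlnx (e i) \<le> 1 / 4 * m i - e i * (1 + ln (1 / 4))"
            using e0[OF i] m[OF i] False by (intro mult_ln_minus_xlnx_le) auto
          ultimately show ?thesis by (simp add: ln_div algebra_simps)
        qed
        then have "sum Y I \<le> (\<Sum>i\<in>I. 1 / 4 * m i + 2 * ln 4 * e i)"
          by (intro sum_mono)
        also have "\<dots> = 1 / 4 * M + 2 * ln 4 * E"
          by (simp add: sum.distrib sum_distrib_left[symmetric] sum_divide_distrib[symmetric] E_def M_def)
        also have "2 * ln 4 * E \<le> 4 * (M / 16)"
          using False E0 M0 ln_4_bounds by (intro mult_mono) auto
        finally have Y: "sum Y I \<le> 1 / 2 * M" by simp
        have "G * M * M \<le> 1 / 2 * M" using small M0 by (intro mult_right_mono)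
        then have "k * A * M\<^sup>2 + M\<^sup>2 * R \<le> 1 / 2 * M"
          using GM by (simp add: power2_eq_square)
        moreover have "M \<le> ln 4 * M" using mult_right_mono[OF ln_4_bounds(1) M0] by simp
        moreover have "0 \<le> B * (M * E)" using B0 M0 E0 by simp
        ultimately show ?thesis using L X Y by linarith
      qed
    qed
    moreover have "B * (M * E) \<le> B * (M\<^sup>2 - (\<Sum>c\<in>C. (Mc c)\<^sup>2))"
      using quad B0 by (intro mult_left_mono)
    ultimately show "tree_potential I \<beta> B (\<lambda>i. \<Sum>c\<in>C. mc c i) \<le>
      ln 4 / (8 * pi) * Lambda a (\<lambda>i. \<Sum>c\<in>C. mc c i) I + (\<Sum>c\<in>C. tree_potential I \<beta> B (mc c))"
      using tp unfolding m_def[symmetric] k_def[symmetric] by linarith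
  qed
qed

lemma tree_lower_bound:
  fixes a :: "nat \<Rightarrow> nat \<Rightarrow> real" and \<beta> :: "nat \<Rightarrow> real" and \<mu> :: "'p \<Rightarrow> nat \<Rightarrow> real"
    and f :: "nat \<Rightarrow> 'p \<Rightarrow> 'c"
  assumes split: "\<And>C (mc :: 'c \<Rightarrow> nat \<Rightarrow> real).
    \<lbrakk>finite C; C \<noteq> {}; card C \<le> 4; \<And>c i. c \<in> C \<Longrightarrow> i \<in> I \<Longrightarrow> 0 \<le> mc c i;
      \<And>i. i \<in> I \<Longrightarrow> (\<Sum>c\<in>C. mc c i) \<le> \<beta> i\<rbrakk> \<Longrightarrow>
    tree_potential I \<beta> B (\<lambda>i. \<Sum>c\<in>C. mc c i) \<le>
      \<kappa> * Lambda a (\<lambda>i. \<Sum>c\<in>C. mc c i) I + (\<Sum>c\<in>C. tree_potential I \<beta> B (mc c))"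
    and P: "finite P" and \<mu>: "\<And>p i. p \<in> P \<Longrightarrow> i \<in> I \<Longrightarrow> 0 \<le> \<mu> p i"
      "\<And>i. i \<in> I \<Longrightarrow> (\<Sum>p\<in>P. \<mu> p i) \<le> \<beta> i"
    and h: "\<And>k p. k < K \<Longrightarrow> p \<in> P \<Longrightarrow> f k p = h (f (Suc k) p)"
      "\<And>k Q. k < K \<Longrightarrow> card {Q' \<in> f (Suc k) ` P. h Q' = Q} \<le> 4"
  defines "ms \<equiv> \<lambda>k Q i. \<Sum>p | p \<in> P \<and> f k p = Q. \<mu> p i"
  shows "(\<Sum>Q\<in>f 0 ` P. tree_potential I \<beta> B (ms 0 Q))
    \<le> \<kappa> * (\<Sum>k<K. \<Sum>Q\<in>f k ` P. Lambda a (ms k Q) I) + (\<Sum>Q\<in>f K ` P. tree_potential I \<beta> B (ms K Q))"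
proof -
  have step: "(\<Sum>Q\<in>f k ` P. tree_potential I \<beta> B (ms k Q))
    \<le> \<kappa> * (\<Sum>Q\<in>f k ` P. Lambda a (ms k Q) I)
      + (\<Sum>Q\<in>f (Suc k) ` P. tree_potential I \<beta> B (ms (Suc k) Q))" if k: "k < K" for k
  proof -
    define ch where "ch Q = {Q' \<in> f (Suc k) ` P. h Q' = Q}" for Q
    have ms: "ms k Q = (\<lambda>i. \<Sum>Q'\<in>ch Q. ms (Suc k) Q' i)" if "Q \<in> f k ` P" for Q
    proof
      fix i
      have "ms k Q i = (\<Sum>Q'\<in>ch Q. \<Sum>p | p \<in> {p\<in>P. f k p = Q} \<and> f (Suc k) p = Q'. \<mu> p i)"
        unfolding ms_def using P h(1)[OF k] by (intro sum.group[symmetric]) (auto simp: ch_def)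
      also have "\<dots> = (\<Sum>Q'\<in>ch Q. ms (Suc k) Q' i)"
        unfolding ms_def using h(1)[OF k] by (intro sum.cong) (auto simp: ch_def)
      finally show "ms k Q i = (\<Sum>Q'\<in>ch Q. ms (Suc k) Q' i)" .
    qed
    have "tree_potential I \<beta> B (ms k Q) \<le> \<kappa> * Lambda a (ms k Q) I
        + (\<Sum>Q'\<in>ch Q. tree_potential I \<beta> B (ms (Suc k) Q'))" if Q: "Q \<in> f k ` P" for Q
      unfolding ms[OF Q]
    proof (rule split)
      show "finite (ch Q)" "ch Q \<noteq> {}" "card (ch Q) \<le> 4"
        using P Q h(1)[OF k] h(2)[OF k, of Q] by (auto simp: ch_def)
      show "0 \<le> ms (Suc k) c i" if "i \<in> I" for c i
        using \<mu> that by (auto simp: ms_def intro!: sum_nonneg)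
      show "(\<Sum>c\<in>ch Q. ms (Suc k) c i) \<le> \<beta> i" if i: "i \<in> I" for i
      proof -
        have "(\<Sum>c\<in>ch Q. ms (Suc k) c i) = ms k Q i" using ms[OF Q] by simp
        also have "\<dots> \<le> (\<Sum>p\<in>P. \<mu> p i)"
          unfolding ms_def using P \<mu> i by (intro sum_mono2) auto
        finally show ?thesis using \<mu>(2)[OF i] by simp
      qed
    qed
    then have "(\<Sum>Q\<in>f k ` P. tree_potential I \<beta> B (ms k Q)) \<le> (\<Sum>Q\<in>f k ` P. \<kappa> * Lambda a (ms k Q) I
        + (\<Sum>Q'\<in>ch Q. tree_potential I \<beta> B (ms (Suc k) Q')))"
      by (intro sum_mono)
    also have "\<dots> = \<kappa> * (\<Sum>Q\<in>f k ` P. Lambda a (ms k Q) I)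
      + (\<Sum>Q\<in>f k ` P. \<Sum>Q'\<in>ch Q. tree_potential I \<beta> B (ms (Suc k) Q'))"
      by (simp add: sum.distrib sum_distrib_left)
    also have "(\<Sum>Q\<in>f k ` P. \<Sum>Q'\<in>ch Q. tree_potential I \<beta> B (ms (Suc k) Q'))
      = (\<Sum>Q'\<in>f (Suc k) ` P. tree_potential I \<beta> B (ms (Suc k) Q'))"
      unfolding ch_def using P h(1)[OF k] by (intro sum.group) auto
    finally show ?thesis .
  qed
  have "(\<Sum>Q\<in>f 0 ` P. tree_potential I \<beta> B (ms 0 Q))
    \<le> \<kappa> * (\<Sum>k<L. \<Sum>Q\<in>f k ` P. Lambda a (ms k Q) I)
      + (\<Sum>Q\<in>f L ` P. tree_potential I \<beta> B (ms L Q))" if "L \<le> K" for L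
    using that
  proof (induction L)
    case (Suc L)
    then show ?case using step[of L] by (simp add: distrib_left)
  qed simp
  then show ?thesis by simp
qed

lemma sum_Lambda_levels:
  fixes a :: "nat \<Rightarrow> nat \<Rightarrow> real" and \<mu> :: "'p \<Rightarrow> nat \<Rightarrow> real" and f :: "'p \<Rightarrow> 'c"
  assumes P: "finite P" and I: "finite I"
  shows "(\<Sum>Q\<in>f ` P. Lambda a (\<lambda>i. \<Sum>p | p \<in> P \<and> f p = Q. \<mu> p i) I)
    = 8 * pi * (\<Sum>i\<in>I. \<Sum>p\<in>P. \<mu> p i)
      - (\<Sum>i\<in>I. \<Sum>j\<in>I. a i j * (\<Sum>p\<in>P. \<Sum>q\<in>P. of_bool (f p = f q) * \<mu> p i * \<mu> q j))"
proof -
  define ms where "ms = (\<lambda>Q i. \<Sum>p | p \<in> P \<and> f p = Q. \<mu> p i)"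
  have pair: "(\<Sum>Q\<in>f ` P. ms Q i * ms Q j) = (\<Sum>p\<in>P. \<Sum>q\<in>P. of_bool (f p = f q) * \<mu> p i * \<mu> q j)" for i j
  proof -
    have "(\<Sum>p\<in>P. \<Sum>q\<in>P. of_bool (f p = f q) * \<mu> p i * \<mu> q j) = (\<Sum>p\<in>P. \<mu> p i * ms (f p) j)"
      unfolding ms_def sum_distrib_left using P
      by (intro sum.cong refl sum.mono_neutral_cong_right) auto
    also have "\<dots> = (\<Sum>Q\<in>f ` P. \<Sum>p | p \<in> P \<and> f p = Q. \<mu> p i * ms (f p) j)"
      using P by (intro sum.group[symmetric]) auto
    also have "\<dots> = (\<Sum>Q\<in>f ` P. ms Q i * ms Q j)"
      by (intro sum.cong refl) (simp add: ms_def sum_distrib_right)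
    finally show ?thesis ..
  qed
  have single: "(\<Sum>Q\<in>f ` P. ms Q i) = (\<Sum>p\<in>P. \<mu> p i)" for i
    unfolding ms_def using P by (intro sum.group) auto
  have "(\<Sum>Q\<in>f ` P. Lambda a (ms Q) I)
    = (\<Sum>Q\<in>f ` P. 8 * pi * (\<Sum>i\<in>I. ms Q i) - (\<Sum>i\<in>I. \<Sum>j\<in>I. a i j * (ms Q i * ms Q j)))"
    unfolding Lambda_def
    by (simp add: right_diff_distrib sum_subtractf sum_distrib_left sum_distrib_right mult_ac)
  also have "\<dots> = 8 * pi * (\<Sum>Q\<in>f ` P. \<Sum>i\<in>I. ms Q i) - (\<Sum>Q\<in>f ` P. \<Sum>i\<in>I. \<Sum>j\<in>I. a i j * (ms Q i * ms Q j))"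
    by (simp add: sum_subtractf sum_distrib_left)
  also have "(\<Sum>Q\<in>f ` P. \<Sum>i\<in>I. ms Q i) = (\<Sum>i\<in>I. \<Sum>p\<in>P. \<mu> p i)"
    unfolding sum.swap[of _ I] single by (rule refl)
  also have "(\<Sum>Q\<in>f ` P. \<Sum>i\<in>I. \<Sum>j\<in>I. a i j * (ms Q i * ms Q j))
    = (\<Sum>i\<in>I. \<Sum>j\<in>I. a i j * (\<Sum>Q\<in>f ` P. ms Q i * ms Q j))"
    unfolding sum_distrib_left by (subst sum.swap, rule sum.cong[OF refl], rule sum.swap)
  finally show ?thesis unfolding pair unfolding ms_def .
qed

lemma tree_entropy_bound:
  fixes a :: "nat \<Rightarrow> nat \<Rightarrow> real" and \<beta> :: "nat \<Rightarrow> real"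
  assumes I: "finite I" "I \<noteq> {}" and sym: "\<forall>i\<in>I. \<forall>k\<in>I. a i k = a k i"
    and a: "\<And>i j. i \<in> I \<Longrightarrow> j \<in> I \<Longrightarrow> 0 \<le> a i j" and \<beta>: "\<And>i. i \<in> I \<Longrightarrow> 0 < \<beta> i"
    and nonneg: "\<And>J. J \<subseteq> I \<Longrightarrow> 0 \<le> Lambda a \<beta> J"
    and edge: "\<And>J i. J \<subseteq> I \<Longrightarrow> i \<in> J \<Longrightarrow> Lambda a \<beta> J = 0 \<Longrightarrow> 0 < a i i + Lambda a \<beta> (J - {i})"
  obtains C where "\<And>P (\<mu> :: 'p \<Rightarrow> nat \<Rightarrow> real) K (f :: nat \<Rightarrow> 'p \<Rightarrow> 'c) h.
    \<lbrakk>finite P; P \<noteq> {}; \<And>p i. p \<in> P \<Longrightarrow> i \<in> I \<Longrightarrow> 0 \<le> \<mu> p i;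
     \<And>i. i \<in> I \<Longrightarrow> (\<Sum>p\<in>P. \<mu> p i) = \<beta> i;
     \<And>k p. k < K \<Longrightarrow> p \<in> P \<Longrightarrow> f k p = h (f (Suc k) p);
     \<And>k Q. k < K \<Longrightarrow> card {Q' \<in> f (Suc k) ` P. h Q' = Q} \<le> 4;
     inj_on (f K) P; \<And>p q. p \<in> P \<Longrightarrow> q \<in> P \<Longrightarrow> f 0 p = f 0 q\<rbrakk> \<Longrightarrow>
    C \<le> (\<Sum>p\<in>P. \<Sum>i\<in>I. xlnx (\<mu> p i)) + ln 4 * real K * sum \<beta> I
      - ln 4 / (8 * pi) * (\<Sum>i\<in>I. \<Sum>j\<in>I. a i j *
          (\<Sum>p\<in>P. \<Sum>q\<in>P. (\<Sum>k<K. of_bool (f k p = f k q)) * \<mu> p i * \<mu> q j))"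
proof -
  obtain B where B: "0 \<le> B" "\<And>C (mc :: 'c \<Rightarrow> nat \<Rightarrow> real).
    \<lbrakk>finite C; C \<noteq> {}; card C \<le> 4; \<And>c i. c \<in> C \<Longrightarrow> i \<in> I \<Longrightarrow> 0 \<le> mc c i;
      \<And>i. i \<in> I \<Longrightarrow> (\<Sum>c\<in>C. mc c i) \<le> \<beta> i\<rbrakk> \<Longrightarrow>
    tree_potential I \<beta> B (\<lambda>i. \<Sum>c\<in>C. mc c i) \<le>
      ln 4 / (8 * pi) * Lambda a (\<lambda>i. \<Sum>c\<in>C. mc c i) I + (\<Sum>c\<in>C. tree_potential I \<beta> B (mc c))"
  proof (rule tree_potential_split[where ?'c = 'c, of I a \<beta>, OF I sym a \<beta> nonneg edge])
    fix B assume "0 \<le> B" "\<And>C (mc :: 'c \<Rightarrow> nat \<Rightarrow> real).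
      \<lbrakk>finite C; C \<noteq> {}; card C \<le> 4; \<And>c i. c \<in> C \<Longrightarrow> i \<in> I \<Longrightarrow> 0 \<le> mc c i;
        \<And>i. i \<in> I \<Longrightarrow> (\<Sum>c\<in>C. mc c i) \<le> \<beta> i\<rbrakk> \<Longrightarrow>
      tree_potential I \<beta> B (\<lambda>i. \<Sum>c\<in>C. mc c i) \<le>
        ln 4 / (8 * pi) * Lambda a (\<lambda>i. \<Sum>c\<in>C. mc c i) I + (\<Sum>c\<in>C. tree_potential I \<beta> B (mc c))"
    then show thesis by (rule that)
  qed
  define C0 where "C0 = tree_potential I \<beta> B \<beta> - (\<Sum>i\<in>I. \<beta> i * (1 + ln (\<beta> i)))"
  show ?thesis
  proof (rule that[of C0])
    fix P and \<mu> :: "'p \<Rightarrow> nat \<Rightarrow> real" and K and f :: "nat \<Rightarrow> 'p \<Rightarrow> 'c" and h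
    assume P: "finite P" "P \<noteq> {}" and \<mu>: "\<And>p i. p \<in> P \<Longrightarrow> i \<in> I \<Longrightarrow> 0 \<le> \<mu> p i"
      and \<mu>\<beta>: "\<And>i. i \<in> I \<Longrightarrow> (\<Sum>p\<in>P. \<mu> p i) = \<beta> i"
      and h: "\<And>k p. k < K \<Longrightarrow> p \<in> P \<Longrightarrow> f k p = h (f (Suc k) p)"
        "\<And>k Q. k < K \<Longrightarrow> card {Q' \<in> f (Suc k) ` P. h Q' = Q} \<le> 4"
      and inj: "inj_on (f K) P" and const: "\<And>p q. p \<in> P \<Longrightarrow> q \<in> P \<Longrightarrow> f 0 p = f 0 q"
    define ms where "ms = (\<lambda>k Q i. \<Sum>p | p \<in> P \<and> f k p = Q. \<mu> p i)"
    have main: "(\<Sum>Q\<in>f 0 ` P. tree_potential I \<beta> B (ms 0 Q))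
      \<le> ln 4 / (8 * pi) * (\<Sum>k<K. \<Sum>Q\<in>f k ` P. Lambda a (ms k Q) I)
        + (\<Sum>Q\<in>f K ` P. tree_potential I \<beta> B (ms K Q))"
      unfolding ms_def
    proof (rule tree_lower_bound[where h = h])
      show "finite P" by fact
      show "tree_potential I \<beta> B (\<lambda>i. \<Sum>c\<in>C. mc c i) \<le>
          ln 4 / (8 * pi) * Lambda a (\<lambda>i. \<Sum>c\<in>C. mc c i) I + (\<Sum>c\<in>C. tree_potential I \<beta> B (mc c))"
        if "finite C" "C \<noteq> {}" "card C \<le> 4" "\<And>c i. c \<in> C \<Longrightarrow> i \<in> I \<Longrightarrow> 0 \<le> mc c i"
          "\<And>i. i \<in> I \<Longrightarrow> (\<Sum>c\<in>C. mc c i) \<le> \<beta> i" for C and mc :: "'c \<Rightarrow> nat \<Rightarrow> real"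
        using that by (rule B(2))
      show "(\<Sum>p\<in>P. \<mu> p i) \<le> \<beta> i" if "i \<in> I" for i
        using \<mu>\<beta>[OF that] by simp
    qed (fact \<mu> h)+
    obtain p0 where p0: "p0 \<in> P" using P by auto
    define Q0 where "Q0 = f 0 p0"
    have Q0: "f 0 p = Q0" if "p \<in> P" for p
      unfolding Q0_def using that p0 by (rule const)
    have "f 0 ` P = {Q0}" using Q0 p0 by force
    moreover have "{p \<in> P. f 0 p = Q0} = P" using Q0 by auto
    moreover have "tree_potential I \<beta> B (\<lambda>i. \<Sum>p\<in>P. \<mu> p i) = tree_potential I \<beta> B \<beta>"
      unfolding tree_potential_def using \<mu>\<beta> by simp
    ultimately have root: "(\<Sum>Q\<in>f 0 ` P. tree_potential I \<beta> B (ms 0 Q)) = tree_potential I \<beta> B \<beta>"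
      by (simp add: ms_def)
    have "ms K (f K p) = \<mu> p" if "p \<in> P" for p
    proof -
      have "{q \<in> P. f K q = f K p} = {p}" using inj that by (auto dest: inj_onD)
      then show ?thesis by (simp add: ms_def)
    qed
    then have "(\<Sum>Q\<in>f K ` P. tree_potential I \<beta> B (ms K Q)) = (\<Sum>p\<in>P. tree_potential I \<beta> B (\<mu> p))"
      using inj by (simp add: sum.reindex)
    also have "\<dots> \<le> (\<Sum>p\<in>P. \<Sum>i\<in>I. xlnx (\<mu> p i) + \<mu> p i * (1 + ln (\<beta> i)))"
    proof (rule sum_mono)
      fix p assume p: "p \<in> P"
      have "(\<Sum>i\<in>I. xlnx (\<mu> p i) + xi (\<beta> i) (\<mu> p i)) \<le> (\<Sum>i\<in>I. xlnx (\<mu> p i) + \<mu> p i * (1 + ln (\<beta> i)))"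
      proof (intro sum_mono add_left_mono xi_le \<beta>)
        fix i assume i: "i \<in> I"
        show "\<mu> p i \<le> \<beta> i"
          using member_le_sum[of p P "\<lambda>p. \<mu> p i"] P p \<mu> i \<mu>\<beta>[OF i] by simp
      qed
      moreover have "0 \<le> B * (\<Sum>i\<in>I. \<mu> p i)\<^sup>2" using B by simp
      ultimately show "tree_potential I \<beta> B (\<mu> p) \<le> (\<Sum>i\<in>I. xlnx (\<mu> p i) + \<mu> p i * (1 + ln (\<beta> i)))"
        unfolding tree_potential_def by linarith
    qed
    also have "\<dots> = (\<Sum>p\<in>P. \<Sum>i\<in>I. xlnx (\<mu> p i)) + (\<Sum>i\<in>I. \<Sum>p\<in>P. \<mu> p i * (1 + ln (\<beta> i)))"
      unfolding sum.distrib by (simp add: sum.swap[of _ P])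
    also have "(\<Sum>i\<in>I. \<Sum>p\<in>P. \<mu> p i * (1 + ln (\<beta> i))) = (\<Sum>i\<in>I. \<beta> i * (1 + ln (\<beta> i)))"
      using \<mu>\<beta> by (simp add: sum_distrib_right[symmetric])
    finally have leaves: "(\<Sum>Q\<in>f K ` P. tree_potential I \<beta> B (ms K Q))
      \<le> (\<Sum>p\<in>P. \<Sum>i\<in>I. xlnx (\<mu> p i)) + (\<Sum>i\<in>I. \<beta> i * (1 + ln (\<beta> i)))" .
    define Z where "Z k i j = (\<Sum>p\<in>P. \<Sum>q\<in>P. of_bool (f k p = f k q) * \<mu> p i * \<mu> q j)" for k i j
    have "(\<Sum>k<K. \<Sum>Q\<in>f k ` P. Lambda a (ms k Q) I)
      = (\<Sum>k<K. 8 * pi * sum \<beta> I - (\<Sum>i\<in>I. \<Sum>j\<in>I. a i j * Z k i j))"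
      unfolding ms_def sum_Lambda_levels[OF P(1) I(1)] Z_def using \<mu>\<beta> by simp
    also have "\<dots> = 8 * pi * (real K * sum \<beta> I) - (\<Sum>k<K. \<Sum>i\<in>I. \<Sum>j\<in>I. a i j * Z k i j)"
      by (simp add: sum_subtractf)
    also have "(\<Sum>k<K. \<Sum>i\<in>I. \<Sum>j\<in>I. a i j * Z k i j) = (\<Sum>i\<in>I. \<Sum>j\<in>I. a i j * (\<Sum>k<K. Z k i j))"
      unfolding sum_distrib_left by (subst sum.swap, rule sum.cong[OF refl], rule sum.swap)
    also have "(\<lambda>i j. \<Sum>k<K. Z k i j)
      = (\<lambda>i j. \<Sum>p\<in>P. \<Sum>q\<in>P. (\<Sum>k<K. of_bool (f k p = f k q)) * \<mu> p i * \<mu> q j)"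
      unfolding Z_def sum_distrib_right
      by (intro ext, subst sum.swap, rule sum.cong[OF refl], rule sum.swap)
    finally have levels: "ln 4 / (8 * pi) * (\<Sum>k<K. \<Sum>Q\<in>f k ` P. Lambda a (ms k Q) I)
      = ln 4 * real K * sum \<beta> I - ln 4 / (8 * pi) * (\<Sum>i\<in>I. \<Sum>j\<in>I. a i j *
          (\<Sum>p\<in>P. \<Sum>q\<in>P. (\<Sum>k<K. of_bool (f k p = f k q)) * \<mu> p i * \<mu> q j))"
      by (simp add: right_diff_distrib)
    show "C0 \<le> (\<Sum>p\<in>P. \<Sum>i\<in>I. xlnx (\<mu> p i)) + ln 4 * real K * sum \<beta> I
      - ln 4 / (8 * pi) * (\<Sum>i\<in>I. \<Sum>j\<in>I. a i j *
          (\<Sum>p\<in>P. \<Sum>q\<in>P. (\<Sum>k<K. of_bool (f k p = f k q)) * \<mu> p i * \<mu> q j))"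
      using main leaves unfolding root levels C0_def by linarith
  qed
qed

section \<open>Randomly shifted dyadic grids\<close>

definition shifted_label :: "nat \<Rightarrow> nat \<Rightarrow> int \<Rightarrow> int \<Rightarrow> int" where
  "shifted_label K k s u = ((u + s) mod 2 ^ K) div 2 ^ (K - k)"

lemma shifted_label_mod: "shifted_label K k s (u mod 2 ^ K) = shifted_label K k s u"
  by (simp add: shifted_label_def mod_add_left_eq)

lemma shifted_label_parent:
  assumes "k < K"
  shows "shifted_label K k s u = shifted_label K (Suc k) s u div 2"
proof -
  have "(2::int) ^ (K - k) = 2 ^ (K - Suc k) * 2"
    using assms by (metis Suc_diff_Suc power_Suc2)
  then show ?thesis by (simp add: shifted_label_def zdiv_zmult2_eq)
qed

lemma inj_on_shifted_mod: "inj_on (\<lambda>u. (u + s) mod N) {0..<N}" for N :: int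
proof (rule inj_onI)
  fix u w assume uw: "u \<in> {0..<N}" "w \<in> {0..<N}" "(u + s) mod N = (w + s) mod N"
  then have "u mod N = w mod N"
    by (metis add_diff_cancel_right' mod_diff_left_eq)
  then show "u = w" using uw by simp
qed

lemma inj_on_shifted_label: "inj_on (shifted_label K K s) {0..<2 ^ K}"
  using inj_on_shifted_mod[of s "2 ^ K"] by (simp add: shifted_label_def[abs_def])

lemma shifted_label_0: "shifted_label K 0 s u = 0"
  by (simp add: shifted_label_def div_pos_pos_trivial)

lemma card_shifted_label_Suc:
  assumes "k \<le> K"
  shows "card {s \<in> {0..<2 ^ K}. shifted_label K k s u \<noteq> shifted_label K k s (u + 1)} \<le> 2 ^ k"
    (is "card ?S \<le> _")
proof -
  define D :: int where "D = 2 ^ (K - k)"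
  have D: "0 < D" "(2::int) ^ K = D * 2 ^ k"
    using assms by (simp_all add: D_def power_add[symmetric])
  have "(\<lambda>s. (s + u) mod 2 ^ K) ` ?S \<subseteq> (\<lambda>j. D * j - 1) ` {1..2 ^ k}"
  proof
    fix r assume "r \<in> (\<lambda>s. (s + u) mod 2 ^ K) ` ?S"
    then obtain s where s: "r = (s + u) mod 2 ^ K"
      "shifted_label K k s u \<noteq> shifted_label K k s (u + 1)" by auto
    have r: "0 \<le> r" "r < 2 ^ K" unfolding s by simp_all
    have "(u + 1 + s) mod 2 ^ K = (r + 1) mod 2 ^ K"
      unfolding s mod_add_left_eq by (simp add: add_ac)
    then have ne: "r div D \<noteq> ((r + 1) mod 2 ^ K) div D"
      using s unfolding shifted_label_def D_def[symmetric] by (simp add: add_ac)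
    have "D dvd r + 1"
    proof (cases "r + 1 = 2 ^ K")
      case True
      then show ?thesis using D by simp
    next
      case False
      then have "(r + 1) mod 2 ^ K = r + 1" using r by (intro mod_pos_pos_trivial) auto
      then have ne': "r div D \<noteq> (r + 1) div D" using ne by simp
      show ?thesis
      proof (rule ccontr)
        assume "\<not> D dvd r + 1"
        then have "(r + 1) mod D \<noteq> 0" by (simp add: dvd_eq_mod_eq_0)
        moreover have "0 \<le> (r + 1) mod D" "(r + 1) mod D < D" using D by simp_all
        ultimately have m: "0 \<le> (r + 1) mod D - 1" "(r + 1) mod D - 1 < D" by auto
        have "r = D * ((r + 1) div D) + ((r + 1) mod D - 1)"
          using mult_div_mod_eq[of D "r + 1"] by linarith
        then have "r div D = (D * ((r + 1) div D) + ((r + 1) mod D - 1)) div D" by simp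
        also have "\<dots> = (r + 1) div D"
          using D m by (simp add: div_pos_pos_trivial)
        finally show False using ne' by simp
      qed
    qed
    then obtain j where j: "r + 1 = D * j" by (auto elim: dvdE)
    have "0 < D * j" "D * j \<le> D * 2 ^ k" using r j unfolding D(2) by linarith+
    then have "1 \<le> j" "j \<le> 2 ^ k" using D by (auto simp: zero_less_mult_iff)
    then show "r \<in> (\<lambda>j. D * j - 1) ` {1..2 ^ k}" using j by (intro image_eqI[of _ _ j]) auto
  qed
  then have "card ((\<lambda>s. (s + u) mod 2 ^ K) ` ?S) \<le> card ((\<lambda>j. D * j - 1) ` {1..2 ^ k})"
    by (intro card_mono) auto
  also have "\<dots> \<le> card {1..(2::int) ^ k}" by (intro card_image_le) auto
  also have "\<dots> = 2 ^ k" by (simp add: nat_power_eq)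
  also have "card ((\<lambda>s. (s + u) mod 2 ^ K) ` ?S) = card ?S"
    by (intro card_image inj_on_subset[OF inj_on_shifted_mod]) auto
  finally show ?thesis .
qed

lemma card_shifted_label_neq:
  assumes "k \<le> K"
  shows "card {s \<in> {0..<2 ^ K}. shifted_label K k s u \<noteq> shifted_label K k s w} \<le> nat \<bar>u - w\<bar> * 2 ^ k"
proof -
  define S where "S u w = {s \<in> {0..<2 ^ K}. shifted_label K k s u \<noteq> shifted_label K k s w}" for u w
  have fin: "finite (S u w)" for u w
    unfolding S_def by (rule finite_subset[of _ "{0..<2 ^ K}"]) auto
  have *: "card (S u (u + int d)) \<le> d * 2 ^ k" for u d
  proof (induction d)
    case 0
    then show ?case by (simp add: S_def)
  next
    case (Suc d)
    have "S u (u + int (Suc d)) \<subseteq> S u (u + int d) \<union> S (u + int d) (u + int d + 1)"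
      by (auto simp: S_def add_ac)
    then have "card (S u (u + int (Suc d))) \<le> card (S u (u + int d) \<union> S (u + int d) (u + int d + 1))"
      using fin by (intro card_mono) auto
    also have "\<dots> \<le> card (S u (u + int d)) + card (S (u + int d) (u + int d + 1))"
      by (rule card_Un_le)
    also have "\<dots> \<le> d * 2 ^ k + 2 ^ k"
      using Suc card_shifted_label_Suc[OF assms, of "u + int d"] by (intro add_mono) (auto simp: S_def)
    finally show ?case by simp
  qed
  have "S u w = S w u" by (auto simp: S_def)
  then have "card (S u w) \<le> nat \<bar>u - w\<bar> * 2 ^ k"
    using *[of u "nat (w - u)"] *[of w "nat (u - w)"] by (cases "u \<le> w") (auto simp: abs_if)
  then show ?thesis by (simp add: S_def)
qed

definition grid :: "nat \<Rightarrow> (int \<times> int) set" where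
  "grid K = {0..<2 ^ K} \<times> {0..<2 ^ K}"

definition plane_label :: "nat \<Rightarrow> int \<times> int \<Rightarrow> nat \<Rightarrow> int \<times> int \<Rightarrow> int \<times> int" where
  "plane_label K s k p = (shifted_label K k (fst s) (fst p), shifted_label K k (snd s) (snd p))"

lemma finite_grid [simp]: "finite (grid K)"
  by (simp add: grid_def)

lemma card_grid: "card (grid K) = 4 ^ K"
  by (simp add: grid_def nat_power_eq power_mult_distrib[symmetric])

lemma grid_nonempty: "grid K \<noteq> {}"
  by (auto simp: grid_def)

lemma plane_label_parent:
  "k < K \<Longrightarrow> plane_label K s k p = map_prod (\<lambda>x. x div 2) (\<lambda>x. x div 2) (plane_label K s (Suc k) p)"
  by (simp add: plane_label_def shifted_label_parent)

lemma card_children: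
  fixes A :: "(int \<times> int) set"
  shows "card {q \<in> A. map_prod (\<lambda>x. x div 2) (\<lambda>x. x div 2) q = Q} \<le> 4"
proof -
  have "{q \<in> A. map_prod (\<lambda>x. x div 2) (\<lambda>x. x div 2) q = Q}
    \<subseteq> {2 * fst Q, 2 * fst Q + 1} \<times> {2 * snd Q, 2 * snd Q + 1}" (is "_ \<subseteq> ?R")
    by auto
  then have "card {q \<in> A. map_prod (\<lambda>x. x div 2) (\<lambda>x. x div 2) q = Q} \<le> card ?R"
    by (intro card_mono) auto
  also have "\<dots> = 4" by (simp add: card_cartesian_product)
  finally show ?thesis .
qed

lemma inj_on_plane_label: "inj_on (plane_label K s K) (grid K)"
proof (rule inj_onI)
  fix p q assume "p \<in> grid K" "q \<in> grid K" "plane_label K s K p = plane_label K s K q"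
  then show "p = q"
    using inj_onD[OF inj_on_shifted_label[of K "fst s"], of "fst p" "fst q"]
      inj_onD[OF inj_on_shifted_label[of K "snd s"], of "snd p" "snd q"]
    by (auto simp: plane_label_def grid_def prod_eq_iff)
qed

text \<open>Averaging over the shifts is essential: for a fixed grid, two nearby points on opposite sides of a
  coarse grid line share hardly any squares.\<close>

definition coincidence :: "nat \<Rightarrow> int \<times> int \<Rightarrow> int \<times> int \<Rightarrow> real" where
  "coincidence K p q = (\<Sum>s\<in>grid K. \<Sum>k<K. of_bool (plane_label K s k p = plane_label K s k q)) / 4 ^ K"

lemma coincidence_level_ge:
  assumes "k \<le> K"
  shows "1 - 2 ^ k / 2 ^ K * real_of_int (\<bar>fst p - fst q\<bar> + \<bar>snd p - snd q\<bar>)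
    \<le> (\<Sum>s\<in>grid K. of_bool (plane_label K s k p = plane_label K s k q)) / 4 ^ K"
proof -
  define S where "S u w = {s \<in> {0..<2 ^ K}. shifted_label K k s u \<noteq> shifted_label K k s w}" for u w
  define N :: real where "N = 2 ^ K"
  have N: "0 < N" "4 ^ K = N * N" by (simp_all add: N_def power_mult_distrib[symmetric])
  have S: "real (card (S u w)) \<le> real_of_int \<bar>u - w\<bar> * 2 ^ k" for u w
  proof -
    have "real (card (S u w)) \<le> real (nat \<bar>u - w\<bar> * 2 ^ k)"
      unfolding S_def using card_shifted_label_neq[OF assms, of u w] by (intro of_nat_mono)
    then show ?thesis by simp
  qed
  have *: "(\<Sum>s\<in>{0..<2 ^ K}. of_bool (shifted_label K k s u \<noteq> shifted_label K k s w)) = real (card (S u w))" for u w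
    by (subst sum_of_bool_eq) (auto simp: S_def Int_def)
  have cN: "real (card {0..<(2::int) ^ K}) = N" by (simp add: N_def nat_power_eq)
  have "N * N - real (card (S (fst p) (fst q))) * N - N * real (card (S (snd p) (snd q)))
    = (\<Sum>s\<in>grid K. 1 - of_bool (shifted_label K k (fst s) (fst p) \<noteq> shifted_label K k (fst s) (fst q))
        - of_bool (shifted_label K k (snd s) (snd p) \<noteq> shifted_label K k (snd s) (snd q)))"
    unfolding grid_def sum.cartesian_product' sum_subtractf *[symmetric] cN[symmetric]
    by (simp add: sum_distrib_right sum_distrib_left mult_ac)
  also have "\<dots> \<le> (\<Sum>s\<in>grid K. of_bool (plane_label K s k p = plane_label K s k q))"
    by (intro sum_mono) (auto simp: plane_label_def)
  finally have "(N * N - real (card (S (fst p) (fst q))) * N - N * real (card (S (snd p) (snd q)))) / (N * N)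
    \<le> (\<Sum>s\<in>grid K. of_bool (plane_label K s k p = plane_label K s k q)) / (N * N)"
    using N by (intro divide_right_mono) auto
  moreover have "1 - 2 ^ k / N * real_of_int (\<bar>fst p - fst q\<bar> + \<bar>snd p - snd q\<bar>)
    \<le> 1 - (real (card (S (fst p) (fst q))) + real (card (S (snd p) (snd q)))) / N"
  proof -
    have "real (card (S (fst p) (fst q))) + real (card (S (snd p) (snd q)))
      \<le> 2 ^ k * real_of_int (\<bar>fst p - fst q\<bar> + \<bar>snd p - snd q\<bar>)"
      using S[of "fst p" "fst q"] S[of "snd p" "snd q"] by (simp add: algebra_simps)
    then show ?thesis using N by (simp add: divide_right_mono)
  qed
  moreover have "1 - (real (card (S (fst p) (fst q))) + real (card (S (snd p) (snd q)))) / N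
    = (N * N - real (card (S (fst p) (fst q))) * N - N * real (card (S (snd p) (snd q)))) / (N * N)"
    using N by (simp add: field_simps)
  ultimately show ?thesis unfolding N(2) N_def[symmetric] by linarith
qed

lemma coincidence_nonneg: "0 \<le> coincidence K p q"
  unfolding coincidence_def by (intro divide_nonneg_nonneg sum_nonneg) auto

lemma coincidence_ge:
  assumes "L \<le> K"
  shows "real L - 2 ^ L / 2 ^ K * real_of_int (\<bar>fst p - fst q\<bar> + \<bar>snd p - snd q\<bar>) \<le> coincidence K p q"
proof -
  define d where "d = real_of_int (\<bar>fst p - fst q\<bar> + \<bar>snd p - snd q\<bar>)"
  have d: "0 \<le> d" by (simp add: d_def)
  have geo: "(\<Sum>k<L. (2::real) ^ k) = 2 ^ L - 1" by (induction L) auto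
  have "real L - 2 ^ L / 2 ^ K * d \<le> real L - (2 ^ L - 1) / 2 ^ K * d"
    using d by (simp add: divide_right_mono mult_right_mono)
  also have "\<dots> = (\<Sum>k<L. 1 - 2 ^ k / 2 ^ K * d)"
    unfolding geo[symmetric] by (simp add: sum_subtractf sum_distrib_right sum_divide_distrib)
  also have "\<dots> \<le> (\<Sum>k<L. (\<Sum>s\<in>grid K. of_bool (plane_label K s k p = plane_label K s k q)) / 4 ^ K)"
    unfolding d_def using assms by (intro sum_mono coincidence_level_ge) auto
  also have "\<dots> \<le> (\<Sum>k<K. (\<Sum>s\<in>grid K. of_bool (plane_label K s k p = plane_label K s k q)) / 4 ^ K)"
    using assms by (intro sum_mono2 divide_nonneg_nonneg sum_nonneg) auto
  also have "\<dots> = coincidence K p q"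
    unfolding coincidence_def by (subst sum.swap) (simp add: sum_divide_distrib)
  finally show ?thesis by (simp add: d_def)
qed

lemma coincidence_mod:
  "coincidence K (fst p mod 2 ^ K, snd p mod 2 ^ K) (fst q mod 2 ^ K, snd q mod 2 ^ K) = coincidence K p q"
  by (simp add: coincidence_def plane_label_def shifted_label_mod)

definition torus_cell :: "nat \<Rightarrow> real^2 \<Rightarrow> int \<times> int" where
  "torus_cell K x = (\<lfloor>2 ^ K * x $ 1\<rfloor> mod 2 ^ K, \<lfloor>2 ^ K * x $ 2\<rfloor> mod 2 ^ K)"

lemma ln_max_dist_ge:
  fixes x y :: "real^2"
  shows "- ln 2 * coincidence K (torus_cell K x) (torus_cell K y) - 5 * ln 2 \<le> ln (max (dist x y) (1 / 2 ^ K))"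
proof -
  define r where "r = max (dist x y) (1 / 2 ^ K)"
  have r: "0 < r" "1 / 2 ^ K \<le> r" "dist x y \<le> r"
    by (simp_all add: r_def) (simp add: less_max_iff_disj)
  define c where "c = coincidence K (torus_cell K x) (torus_cell K y)"
  have c0: "0 \<le> c" by (simp add: c_def coincidence_nonneg)
  have "- ln 2 * c - 5 * ln 2 \<le> ln r"
  proof (cases "1 \<le> r")
    case True
    then have "0 \<le> ln r" by simp
    moreover have "0 \<le> ln 2 * c" "0 < ln (2::real)" using c0 by simp_all
    ultimately show ?thesis unfolding minus_mult_left[symmetric] by linarith
  next
    case False
    define l where "l = log 2 (1 / r)"
    define L where "L = nat \<lfloor>l\<rfloor>"
    have l0: "0 \<le> l" using False r by (simp add: l_def)
    have L: "real L \<le> l" "l - 1 \<le> real L" using l0 unfolding L_def by linarith+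
    have "2 ^ L = 2 powr real L" by (simp add: powr_realpow)
    also have "\<dots> \<le> 2 powr l" using L by simp
    also have "\<dots> = 1 / r" using r by (simp add: l_def)
    finally have L2: "2 ^ L \<le> 1 / r" .
    also have "\<dots> \<le> 2 ^ K" using r by (simp add: field_simps)
    finally have LK: "L \<le> K" by simp
    define p where "p = (\<lfloor>2 ^ K * x $ 1\<rfloor>, \<lfloor>2 ^ K * x $ 2\<rfloor>)"
    define q where "q = (\<lfloor>2 ^ K * y $ 1\<rfloor>, \<lfloor>2 ^ K * y $ 2\<rfloor>)"
    have c: "c = coincidence K p q"
      using coincidence_mod[of K p q] by (simp add: c_def torus_cell_def p_def q_def)
    have fl: "real_of_int \<bar>\<lfloor>2 ^ K * x $ i\<rfloor> - \<lfloor>2 ^ K * y $ i\<rfloor>\<bar> \<le> 2 ^ K * (2 * r)" for i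
    proof -
      have "\<bar>x $ i - y $ i\<bar> \<le> dist x y"
        using component_le_norm_cart[of "x - y" i] by (simp add: dist_norm)
      then have "2 ^ K * \<bar>x $ i - y $ i\<bar> \<le> 2 ^ K * r" using r by simp
      moreover have "2 ^ K * \<bar>x $ i - y $ i\<bar> = \<bar>2 ^ K * x $ i - 2 ^ K * y $ i\<bar>"
        by (simp add: abs_mult[symmetric] right_diff_distrib[symmetric] abs_mult)
      moreover have "1 \<le> 2 ^ K * r" using r by (simp add: field_simps)
      ultimately show ?thesis by linarith
    qed
    have "2 ^ L / 2 ^ K * real_of_int (\<bar>fst p - fst q\<bar> + \<bar>snd p - snd q\<bar>) \<le> 2 ^ L / 2 ^ K * (2 ^ K * (4 * r))"
      using fl[of 1] fl[of 2] by (intro mult_left_mono) (auto simp: p_def q_def)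
    also have "\<dots> = 2 ^ L * (4 * r)" by simp
    also have "\<dots> \<le> 1 / r * (4 * r)" using L2 r by (intro mult_right_mono) auto
    also have "\<dots> = 4" using r by simp
    finally have "l - 5 \<le> c"
      using coincidence_ge[OF LK, of p q] L unfolding c by linarith
    then have "ln 2 * (l - 5) \<le> ln 2 * c" by (intro mult_left_mono) auto
    moreover have "ln 2 * l = - ln r" using r by (simp add: l_def log_def ln_div)
    ultimately show ?thesis by (simp add: right_diff_distrib)
  qed
  then show ?thesis by (simp add: r_def c_def)
qed

lemma grid_entropy_bound:
  fixes a :: "nat \<Rightarrow> nat \<Rightarrow> real" and \<beta> :: "nat \<Rightarrow> real"
  assumes I: "finite I" "I \<noteq> {}" and sym: "\<forall>i\<in>I. \<forall>k\<in>I. a i k = a k i"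
    and a: "\<And>i j. i \<in> I \<Longrightarrow> j \<in> I \<Longrightarrow> 0 \<le> a i j" and \<beta>: "\<And>i. i \<in> I \<Longrightarrow> 0 < \<beta> i"
    and nonneg: "\<And>J. J \<subseteq> I \<Longrightarrow> 0 \<le> Lambda a \<beta> J"
    and edge: "\<And>J i. J \<subseteq> I \<Longrightarrow> i \<in> J \<Longrightarrow> Lambda a \<beta> J = 0 \<Longrightarrow> 0 < a i i + Lambda a \<beta> (J - {i})"
  obtains C where "\<And>K (\<mu> :: int \<times> int \<Rightarrow> nat \<Rightarrow> real).
    \<lbrakk>\<And>p i. p \<in> grid K \<Longrightarrow> i \<in> I \<Longrightarrow> 0 \<le> \<mu> p i;
     \<And>i. i \<in> I \<Longrightarrow> (\<Sum>p\<in>grid K. \<mu> p i) = \<beta> i\<rbrakk> \<Longrightarrow>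
    C \<le> (\<Sum>p\<in>grid K. \<Sum>i\<in>I. xlnx (\<mu> p i)) + ln 4 * real K * sum \<beta> I
      - ln 4 / (8 * pi) * (\<Sum>i\<in>I. \<Sum>j\<in>I. a i j *
          (\<Sum>p\<in>grid K. \<Sum>q\<in>grid K. coincidence K p q * \<mu> p i * \<mu> q j))"
proof (rule tree_entropy_bound[where ?'c = "int \<times> int" and ?'p = "int \<times> int", of I a \<beta>, OF I sym a \<beta> nonneg edge])
  fix C
  assume C: "\<And>P (\<mu> :: int \<times> int \<Rightarrow> nat \<Rightarrow> real) K (f :: nat \<Rightarrow> int \<times> int \<Rightarrow> int \<times> int) h.
    \<lbrakk>finite P; P \<noteq> {}; \<And>p i. p \<in> P \<Longrightarrow> i \<in> I \<Longrightarrow> 0 \<le> \<mu> p i;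
     \<And>i. i \<in> I \<Longrightarrow> (\<Sum>p\<in>P. \<mu> p i) = \<beta> i;
     \<And>k p. k < K \<Longrightarrow> p \<in> P \<Longrightarrow> f k p = h (f (Suc k) p);
     \<And>k Q. k < K \<Longrightarrow> card {Q' \<in> f (Suc k) ` P. h Q' = Q} \<le> 4;
     inj_on (f K) P; \<And>p q. p \<in> P \<Longrightarrow> q \<in> P \<Longrightarrow> f 0 p = f 0 q\<rbrakk> \<Longrightarrow>
    C \<le> (\<Sum>p\<in>P. \<Sum>i\<in>I. xlnx (\<mu> p i)) + ln 4 * real K * sum \<beta> I
      - ln 4 / (8 * pi) * (\<Sum>i\<in>I. \<Sum>j\<in>I. a i j *
          (\<Sum>p\<in>P. \<Sum>q\<in>P. (\<Sum>k<K. of_bool (f k p = f k q)) * \<mu> p i * \<mu> q j))"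
  show thesis
  proof (rule that[of C])
    fix K and \<mu> :: "int \<times> int \<Rightarrow> nat \<Rightarrow> real"
    assume \<mu>: "\<And>p i. p \<in> grid K \<Longrightarrow> i \<in> I \<Longrightarrow> 0 \<le> \<mu> p i"
      "\<And>i. i \<in> I \<Longrightarrow> (\<Sum>p\<in>grid K. \<mu> p i) = \<beta> i"
    define X where "X = (\<Sum>p\<in>grid K. \<Sum>i\<in>I. xlnx (\<mu> p i)) + ln 4 * real K * sum \<beta> I"
    define c where "c s p q = (\<Sum>k<K. of_bool (plane_label K s k p = plane_label K s k q) :: real)" for s p q
    define Y where "Y s = (\<Sum>i\<in>I. \<Sum>j\<in>I. a i j * (\<Sum>p\<in>grid K. \<Sum>q\<in>grid K. c s p q * \<mu> p i * \<mu> q j))" for s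
    have "C \<le> X - ln 4 / (8 * pi) * Y s" for s
      unfolding X_def Y_def c_def
      using finite_grid grid_nonempty \<mu> plane_label_parent card_children inj_on_plane_label
    proof (rule C)
      show "plane_label K s 0 p = plane_label K s 0 q" for p q
        by (simp add: plane_label_def shifted_label_0)
    qed
    then have "(\<Sum>s\<in>grid K. C) \<le> (\<Sum>s\<in>grid K. X - ln 4 / (8 * pi) * Y s)"
      by (intro sum_mono)
    then have "4 ^ K * C \<le> 4 ^ K * X - ln 4 / (8 * pi) * sum Y (grid K)"
      by (simp add: sum_subtractf card_grid sum_distrib_left)
    moreover have "sum Y (grid K) = 4 ^ K * (\<Sum>i\<in>I. \<Sum>j\<in>I. a i j *
        (\<Sum>p\<in>grid K. \<Sum>q\<in>grid K. coincidence K p q * \<mu> p i * \<mu> q j))"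
    proof -
      have cc: "4 ^ K * coincidence K p q = (\<Sum>s\<in>grid K. c s p q)" for p q
        by (simp add: coincidence_def c_def)
      have swap3: "(\<Sum>s\<in>grid K. \<Sum>p\<in>grid K. \<Sum>q\<in>grid K. F s p q)
        = (\<Sum>p\<in>grid K. \<Sum>q\<in>grid K. \<Sum>s\<in>grid K. F s p q)" for F :: "_ \<Rightarrow> _ \<Rightarrow> _ \<Rightarrow> real"
        by (subst sum.swap, rule sum.cong[OF refl], rule sum.swap)
      have "sum Y (grid K) = (\<Sum>i\<in>I. \<Sum>j\<in>I. \<Sum>s\<in>grid K. a i j * (\<Sum>p\<in>grid K. \<Sum>q\<in>grid K. c s p q * \<mu> p i * \<mu> q j))"
        unfolding Y_def by (subst sum.swap, rule sum.cong[OF refl], rule sum.swap)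
      also have "\<dots> = (\<Sum>i\<in>I. \<Sum>j\<in>I. a i j * (\<Sum>p\<in>grid K. \<Sum>q\<in>grid K. \<Sum>s\<in>grid K. c s p q * \<mu> p i * \<mu> q j))"
        by (intro sum.cong refl) (subst sum_distrib_left[symmetric], rule arg_cong[OF swap3])
      also have "\<dots> = (\<Sum>i\<in>I. \<Sum>j\<in>I. a i j * (\<Sum>p\<in>grid K. \<Sum>q\<in>grid K. 4 ^ K * (coincidence K p q * \<mu> p i * \<mu> q j)))"
        unfolding sum_distrib_right[symmetric] cc[symmetric] by (simp add: mult_ac)
      finally show ?thesis by (simp add: sum_distrib_left mult_ac)
    qed
    ultimately have "4 ^ K * C \<le> 4 ^ K * (X - ln 4 / (8 * pi) * (\<Sum>i\<in>I. \<Sum>j\<in>I. a i j *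
        (\<Sum>p\<in>grid K. \<Sum>q\<in>grid K. coincidence K p q * \<mu> p i * \<mu> q j)))"
      by (simp add: right_diff_distrib mult_ac)
    then show "C \<le> (\<Sum>p\<in>grid K. \<Sum>i\<in>I. xlnx (\<mu> p i)) + ln 4 * real K * sum \<beta> I
      - ln 4 / (8 * pi) * (\<Sum>i\<in>I. \<Sum>j\<in>I. a i j *
          (\<Sum>p\<in>grid K. \<Sum>q\<in>grid K. coincidence K p q * \<mu> p i * \<mu> q j))"
      by (simp add: X_def)
  qed
qed

section \<open>Integrability of the interaction\<close>

lemma integrable_lborel_mult:
  fixes f g :: "'a::euclidean_space \<Rightarrow> real"
  assumes f: "integrable lborel f" and g: "integrable lborel g"
  shows "integrable (lborel \<Otimes>\<^sub>M lborel) (\<lambda>z. f (fst z) * g (snd z))"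
proof -
  have [measurable]: "f \<in> borel_measurable borel" "g \<in> borel_measurable borel"
    using f g by auto
  show ?thesis
  proof (rule lborel_pair.Fubini_integrable)
    show "integrable lborel (\<lambda>x. \<integral>y. norm (f (fst (x, y)) * g (snd (x, y))) \<partial>lborel)"
      using f by (simp add: abs_mult)
    show "AE x in lborel. integrable lborel (\<lambda>y. f (fst (x, y)) * g (snd (x, y)))"
      using g by simp
  qed simp
qed

lemma integral_lborel_mult:
  fixes f g :: "'a::euclidean_space \<Rightarrow> real"
  assumes f: "integrable lborel f" and g: "integrable lborel g"
  shows "(\<integral>z. f (fst z) * g (snd z) \<partial>(lborel \<Otimes>\<^sub>M lborel)) = (\<integral>x. f x \<partial>lborel) * (\<integral>x. g x \<partial>lborel)"
  using lborel_pair.integral_fst'[OF integrable_lborel_mult[OF f g]] by simp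

lemma nn_integral_inverse_dist_finite:
  fixes x :: "real^2"
  shows "(\<integral>\<^sup>+y. ennreal (indicator {y. dist x y < 1} y / dist x y) \<partial>lborel) \<le> 16"
proof -
  define A where "A k = cbox (x - (\<chi> i. (1/2) ^ k)) (x + (\<chi> i. (1/2) ^ k))" for k :: nat
  have A: "emeasure lborel (A k) = ennreal (4 * (1/4) ^ k)" for k
  proof -
    have "emeasure lborel (A k) = ennreal (\<Prod>b\<in>Basis. ((x + (\<chi> i. (1/2) ^ k)) - (x - (\<chi> i. (1/2) ^ k))) \<bullet> b)"
      unfolding A_def by (intro emeasure_lborel_cbox) (auto simp: inner_simps Basis_vec_def inner_axis)
    also have "(\<Prod>b\<in>Basis. ((x + (\<chi> i. (1/2) ^ k)) - (x - (\<chi> i. (1/2::real) ^ k))) \<bullet> b) = (\<Prod>b\<in>(Basis :: (real^2) set). 2 * (1/2) ^ k)"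
      by (intro prod.cong refl) (auto simp: Basis_vec_def inner_axis)
    also have "\<dots> = 4 * (1/4) ^ k" by (simp add: power2_eq_square power_mult_distrib[symmetric])
    finally show ?thesis .
  qed
  have term_le_suminf: "F k \<le> (\<Sum>k. F k)" for F :: "nat \<Rightarrow> ennreal" and k
    using sum_le_suminf[OF summableI, of "{k}" F] by simp
  have "indicator {y. dist x y < 1} y / dist x y \<le> (\<Sum>k. ennreal (2 * 2 ^ k * indicator (A k) y))" for y
  proof (cases "0 < dist x y \<and> dist x y < 1")
    case True
    define d where "d = dist x y"
    define l where "l = log 2 (1 / d)"
    define k where "k = nat \<lfloor>l\<rfloor>"
    have d: "0 < d" "d < 1" using True by (auto simp: d_def)
    have "0 \<le> l" using d by (simp add: l_def)
    then have k: "real k \<le> l" "l < real k + 1" unfolding k_def by linarith+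
    have "2 ^ k = 2 powr real k" by (simp add: powr_realpow)
    also have "\<dots> \<le> 2 powr l" using k by simp
    also have "\<dots> = 1 / d" using d by (simp add: l_def)
    finally have 1: "d \<le> (1/2) ^ k" using d by (simp add: field_simps power_one_over)
    have "1 / d = 2 powr l" using d by (simp add: l_def)
    also have "\<dots> \<le> 2 powr (real k + 1)" using k by simp
    also have "\<dots> = 2 * 2 ^ k" by (simp add: powr_add powr_realpow)
    finally have 2: "1 / d \<le> 2 * 2 ^ k" .
    have "y \<in> A k"
    proof -
      have "\<bar>(x - y) $ i\<bar> \<le> (1/2) ^ k" for i
        using component_le_norm_cart[of "x - y" i] 1 by (simp add: d_def dist_norm)
      then show ?thesis unfolding A_def mem_box_cart by (simp add: abs_le_iff algebra_simps)
    qed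
    then have "ennreal (indicator {y. dist x y < 1} y / dist x y) \<le> ennreal (2 * 2 ^ k * indicator (A k) y)"
      using 2 True by (simp add: d_def ennreal_leI)
    also have "\<dots> \<le> (\<Sum>k. ennreal (2 * 2 ^ k * indicator (A k) y))"
      by (rule term_le_suminf)
    finally show ?thesis .
  next
    case False
    then have "dist x y = 0 \<or> indicator {y. dist x y < 1} y = (0::real)"
      by (auto simp: indicator_def)
    then have "indicator {y. dist x y < 1} y / dist x y = 0" by auto
    then show ?thesis by (metis ennreal_0 zero_le)
  qed
  then have "(\<integral>\<^sup>+y. ennreal (indicator {y. dist x y < 1} y / dist x y) \<partial>lborel)
    \<le> (\<integral>\<^sup>+y. (\<Sum>k. ennreal (2 * 2 ^ k * indicator (A k) y)) \<partial>lborel)"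
    by (intro nn_integral_mono)
  also have "\<dots> = (\<Sum>k. \<integral>\<^sup>+y. ennreal (2 * 2 ^ k * indicator (A k) y) \<partial>lborel)"
    by (intro nn_integral_suminf) (simp add: A_def)
  also have "\<dots> = (\<Sum>k. ennreal (8 * (1/2) ^ k))"
  proof (intro arg_cong[where f = suminf] ext)
    fix k
    have "(\<integral>\<^sup>+y. ennreal (2 * 2 ^ k * indicator (A k) y) \<partial>lborel) = (\<integral>\<^sup>+y. ennreal (2 * 2 ^ k) * indicator (A k) y \<partial>lborel)"
      by (intro nn_integral_cong) (simp add: indicator_def)
    also have "\<dots> = ennreal (2 * 2 ^ k) * ennreal (4 * (1/4) ^ k)"
      unfolding A[symmetric] by (intro nn_integral_cmult_indicator) (simp add: A_def)
    also have "\<dots> = ennreal (8 * (2 * (1/4)) ^ k)"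
      unfolding power_mult_distrib by (subst ennreal_mult[symmetric]) (auto simp: algebra_simps)
    finally show "(\<integral>\<^sup>+y. ennreal (2 * 2 ^ k * indicator (A k) y) \<partial>lborel) = ennreal (8 * (1/2) ^ k)" by simp
  qed
  also have "\<dots> = ennreal (\<Sum>k. 8 * (1/2) ^ k)"
    by (intro suminf_ennreal2 summable_mult summable_geometric) auto
  also have "(\<Sum>k. 8 * (1/2::real) ^ k) = 16"
    by (subst suminf_mult) (auto simp: suminf_geometric)
  finally show ?thesis by simp
qed

lemma abs_ln_dist_young:
  fixes r d :: real
  assumes "0 \<le> r" "0 \<le> d"
  shows "r * \<bar>ln d\<bar> \<le> r * d + \<bar>r * ln r\<bar> + of_bool (d < 1) / d"
proof -
  consider "d = 0" | "0 < d" "d < 1" | "1 \<le> d" using assms by linarith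
  then show ?thesis
  proof cases
    case 1
    then show ?thesis by simp
  next
    case 2
    have "r * ln (1 / d) + r - 1 / d \<le> xlnx r"
      using 2 assms by (intro xlnx_ge_linear) auto
    then have "r * \<bar>ln d\<bar> \<le> \<bar>r * ln r\<bar> + 1 / d"
      using 2 assms by (simp add: ln_div xlnx_def)
    moreover have "0 \<le> r * d" using 2 assms by simp
    ultimately show ?thesis using 2 by simp
  next
    case 3
    have "\<bar>ln d\<bar> \<le> d" using 3 ln_le_minus_one[of d] by simp
    then have "r * \<bar>ln d\<bar> \<le> r * d" using assms by (intro mult_left_mono)
    then show ?thesis using 3 by simp
  qed
qed

lemma integrable_interaction:
  fixes f g :: "real^2 \<Rightarrow> real"
  assumes f0: "\<And>x. 0 \<le> f x" and g0: "\<And>x. 0 \<le> g x"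
    and f: "integrable lborel f" "integrable lborel (\<lambda>x. f x * ln (f x))" "integrable lborel (\<lambda>x. norm x ^ 2 * f x)"
    and g: "integrable lborel g" "integrable lborel (\<lambda>x. norm x ^ 2 * g x)"
  shows "integrable (lborel \<Otimes>\<^sub>M lborel) (\<lambda>z. f (fst z) * ln (dist (fst z) (snd z)) * g (snd z))"
proof -
  have [measurable]: "f \<in> borel_measurable borel" "g \<in> borel_measurable borel"
    using f g by auto
  define s where "s x y = of_bool (dist x y < 1) / dist x y" for x y :: "real^2"
  have sm [measurable]: "(\<lambda>z. s (fst z) (snd z)) \<in> borel_measurable (borel \<Otimes>\<^sub>M borel)"
    unfolding s_def by measurable
  have sing: "integrable (lborel \<Otimes>\<^sub>M lborel) (\<lambda>z. s (fst z) (snd z) * g (snd z))"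
  proof (rule integrableI_nonneg)
    have "(\<integral>\<^sup>+z. ennreal (s (fst z) (snd z) * g (snd z)) \<partial>(lborel \<Otimes>\<^sub>M lborel))
      = (\<integral>\<^sup>+y. \<integral>\<^sup>+x. ennreal (s x y * g y) \<partial>lborel \<partial>lborel)"
      by (subst lborel_pair.nn_integral_snd[symmetric]) simp_all
    also have "\<dots> = (\<integral>\<^sup>+y. ennreal (g y) * (\<integral>\<^sup>+x. ennreal (s x y) \<partial>lborel) \<partial>lborel)"
      by (intro nn_integral_cong, subst nn_integral_cmult[symmetric])
         (auto simp: ennreal_mult[symmetric] g0 s_def mult.commute intro!: nn_integral_cong)
    also have "\<dots> \<le> (\<integral>\<^sup>+y. ennreal (g y) * 16 \<partial>lborel)"
    proof (intro nn_integral_mono mult_left_mono)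
      fix y :: "real^2"
      show "(\<integral>\<^sup>+x. ennreal (s x y) \<partial>lborel) \<le> 16"
        using nn_integral_inverse_dist_finite[of y]
        by (simp add: s_def dist_commute indicator_def of_bool_def cong: if_cong)
    qed simp
    also have "\<dots> = ennreal (\<integral>x. g x \<partial>lborel) * 16"
      using g g0 by (simp add: nn_integral_multc nn_integral_eq_integral)
    also have "\<dots> < \<infinity>" by (simp add: ennreal_mult_less_top)
    finally show "(\<integral>\<^sup>+z. ennreal (s (fst z) (snd z) * g (snd z)) \<partial>(lborel \<Otimes>\<^sub>M lborel)) < \<infinity>" .
  qed (auto simp: s_def g0)
  show ?thesis
  proof (rule Bochner_Integration.integrable_bound)
    show "integrable (lborel \<Otimes>\<^sub>M lborel) (\<lambda>z. (2 * (f (fst z) * g (snd z))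
        + (norm (fst z) ^ 2 * f (fst z)) * g (snd z) + f (fst z) * (norm (snd z) ^ 2 * g (snd z)))
      + \<bar>f (fst z) * ln (f (fst z))\<bar> * g (snd z) + s (fst z) (snd z) * g (snd z))"
      using f g sing
      by (intro Bochner_Integration.integrable_add integrable_mult_right integrable_lborel_mult
            [where f = "\<lambda>x. norm x ^ 2 * f x"] integrable_lborel_mult[where g = "\<lambda>x. norm x ^ 2 * g x"]
            integrable_lborel_mult[where f = "\<lambda>x. \<bar>f x * ln (f x)\<bar>"] integrable_lborel_mult[where f = f and g = g])
         (auto intro: integrable_abs)
    show "AE z in lborel \<Otimes>\<^sub>M lborel. norm (f (fst z) * ln (dist (fst z) (snd z)) * g (snd z))
      \<le> norm ((2 * (f (fst z) * g (snd z))
        + (norm (fst z) ^ 2 * f (fst z)) * g (snd z) + f (fst z) * (norm (snd z) ^ 2 * g (snd z)))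
      + \<bar>f (fst z) * ln (f (fst z))\<bar> * g (snd z) + s (fst z) (snd z) * g (snd z))"
    proof (rule AE_I2)
      fix z :: "(real^2) \<times> (real^2)"
      obtain x y where z: "z = (x, y)" by (cases z)
      have "dist x y \<le> norm x + norm y" by (simp add: dist_norm norm_triangle_ineq4)
      also have "\<dots> \<le> 2 + norm x ^ 2 + norm y ^ 2"
        using sum_squares_bound[of "norm x" 1] sum_squares_bound[of "norm y" 1]
          norm_ge_zero[of x] norm_ge_zero[of y] by (simp del: norm_ge_zero)
      finally have "f x * dist x y \<le> f x * (2 + norm x ^ 2 + norm y ^ 2)"
        using f0 by (intro mult_left_mono)
      with abs_ln_dist_young[of "f x" "dist x y"] f0[of x]
      have "f x * \<bar>ln (dist x y)\<bar> \<le> f x * (2 + norm x ^ 2 + norm y ^ 2) + \<bar>f x * ln (f x)\<bar> + s x y"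
        unfolding s_def by simp
      then have *: "f x * \<bar>ln (dist x y)\<bar> * g y
        \<le> (f x * (2 + norm x ^ 2 + norm y ^ 2) + \<bar>f x * ln (f x)\<bar> + s x y) * g y"
        using g0 by (intro mult_right_mono)
      have "norm (f x * ln (dist x y) * g y) = f x * \<bar>ln (dist x y)\<bar> * g y"
        using f0[of x] g0[of y] by (simp add: abs_mult)
      also have "\<dots> \<le> (2 * (f x * g y) + (norm x ^ 2 * f x) * g y + f x * (norm y ^ 2 * g y))
          + \<bar>f x * ln (f x)\<bar> * g y + s x y * g y"
        using * by (simp add: algebra_simps)
      also have "\<dots> \<le> norm \<dots>" by simp
      finally show "norm (f (fst z) * ln (dist (fst z) (snd z)) * g (snd z))
      \<le> norm ((2 * (f (fst z) * g (snd z))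
        + (norm (fst z) ^ 2 * f (fst z)) * g (snd z) + f (fst z) * (norm (snd z) ^ 2 * g (snd z)))
      + \<bar>f (fst z) * ln (f (fst z))\<bar> * g (snd z) + s (fst z) (snd z) * g (snd z))"
        by (simp add: z)
    qed
  qed measurable
qed

section \<open>Cell masses and lower bounds\<close>

lemma measurable_torus_cell [measurable]: "torus_cell K \<in> borel \<rightarrow>\<^sub>M count_space UNIV"
proof -
  have nth [measurable]: "(\<lambda>x::real^2. x $ i) \<in> borel_measurable borel" for i
    by (intro borel_measurable_continuous_onI continuous_intros)
  have *: "{x. \<lfloor>2 ^ K * x $ i\<rfloor> mod 2 ^ K = u} \<in> sets (borel :: (real^2) measure)" for i u
  proof -
    have "(\<lambda>x::real^2. \<lfloor>2 ^ K * x $ i\<rfloor>) -` {v. v mod 2 ^ K = u} \<inter> space borel \<in> sets borel"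
      by (rule measurable_sets[where A = "count_space UNIV"]) auto
    then show ?thesis by (simp add: vimage_def)
  qed
  have "torus_cell K -` {p} \<inter> space borel \<in> sets borel" for p
  proof -
    have "torus_cell K -` {p} = {x. \<lfloor>2 ^ K * x $ 1\<rfloor> mod 2 ^ K = fst p} \<inter> {x. \<lfloor>2 ^ K * x $ 2\<rfloor> mod 2 ^ K = snd p}"
      by (auto simp: torus_cell_def)
    then show ?thesis using * by auto
  qed
  then show ?thesis by (subst measurable_count_space_eq_countable) auto
qed

lemma torus_cell_in_grid: "torus_cell K x \<in> grid K"
  by (simp add: torus_cell_def grid_def)

definition cell_mass :: "nat \<Rightarrow> (real^2 \<Rightarrow> real) \<Rightarrow> int \<times> int \<Rightarrow> real" where
  "cell_mass K f p = (\<integral>x. f x * of_bool (torus_cell K x = p) \<partial>lborel)"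

lemma integrable_cell:
  assumes "integrable lborel f"
  shows "integrable lborel (\<lambda>x. f x * of_bool (torus_cell K x = p) :: real)"
proof -
  have [measurable]: "f \<in> borel_measurable borel" using assms by auto
  show ?thesis by (rule Bochner_Integration.integrable_bound[OF assms]) auto
qed

lemma cell_mass_nonneg: "(\<And>x. 0 \<le> f x) \<Longrightarrow> 0 \<le> cell_mass K f p"
  unfolding cell_mass_def by (intro Bochner_Integration.integral_nonneg) auto

lemma cell_expand: "f x * h (torus_cell K x) = (\<Sum>p\<in>grid K. h p * (f x * of_bool (torus_cell K x = p)))"
  for h :: "int \<times> int \<Rightarrow> real"
proof -
  have "(\<Sum>p\<in>grid K. h p * (f x * of_bool (torus_cell K x = p)))
    = (\<Sum>p\<in>{torus_cell K x}. h p * (f x * of_bool (torus_cell K x = p)))"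
    using torus_cell_in_grid by (intro sum.mono_neutral_right) auto
  then show ?thesis by simp
qed

lemma
  assumes "integrable lborel f"
  shows integrable_cell_function: "integrable lborel (\<lambda>x. f x * h (torus_cell K x))"
    and integral_cell_function:
      "(\<integral>x. f x * h (torus_cell K x) \<partial>lborel) = (\<Sum>p\<in>grid K. h p * cell_mass K f p)"
  unfolding cell_expand cell_mass_def using integrable_cell[OF assms] by simp_all

lemma sum_cell_mass:
  assumes "integrable lborel f"
  shows "(\<Sum>p\<in>grid K. cell_mass K f p) = (\<integral>x. f x \<partial>lborel)"
  using integral_cell_function[OF assms, of "\<lambda>_. 1" K] by simp

lemma cell_pair_expand:
  "f x * H (torus_cell K x) (torus_cell K y) * g y
    = (\<Sum>p\<in>grid K. \<Sum>q\<in>grid K. H p q * ((f x * of_bool (torus_cell K x = p)) * (g y * of_bool (torus_cell K y = q))))"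
  for H :: "int \<times> int \<Rightarrow> int \<times> int \<Rightarrow> real"
proof -
  have "f x * H (torus_cell K x) (torus_cell K y) * g y
    = (\<Sum>p\<in>grid K. H p (torus_cell K y) * (f x * of_bool (torus_cell K x = p))) * g y"
    by (simp only: cell_expand[of f x "\<lambda>p. H p (torus_cell K y)" K])
  also have "\<dots> = (\<Sum>p\<in>grid K. (f x * of_bool (torus_cell K x = p)) * (g y * H p (torus_cell K y)))"
    unfolding sum_distrib_right by (intro sum.cong) (simp_all add: mult_ac)
  also have "\<dots> = (\<Sum>p\<in>grid K. (f x * of_bool (torus_cell K x = p)) *
      (\<Sum>q\<in>grid K. H p q * (g y * of_bool (torus_cell K y = q))))"
    by (simp only: cell_expand[of g y "H _" K])
  finally show ?thesis by (simp add: sum_distrib_left mult_ac)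
qed

lemma
  assumes "integrable lborel f" "integrable lborel g"
  shows integrable_cell_pair: "integrable (lborel \<Otimes>\<^sub>M lborel)
      (\<lambda>z. f (fst z) * H (torus_cell K (fst z)) (torus_cell K (snd z)) * g (snd z))"
    and integral_cell_pair:
      "(\<integral>z. f (fst z) * H (torus_cell K (fst z)) (torus_cell K (snd z)) * g (snd z) \<partial>(lborel \<Otimes>\<^sub>M lborel))
        = (\<Sum>p\<in>grid K. \<Sum>q\<in>grid K. H p q * cell_mass K f p * cell_mass K g q)"
proof -
  note int = integrable_lborel_mult[OF integrable_cell[OF assms(1)] integrable_cell[OF assms(2)]]
  show "integrable (lborel \<Otimes>\<^sub>M lborel)
      (\<lambda>z. f (fst z) * H (torus_cell K (fst z)) (torus_cell K (snd z)) * g (snd z))"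
    unfolding cell_pair_expand
    by (intro Bochner_Integration.integrable_sum integrable_mult_right int)
  show "(\<integral>z. f (fst z) * H (torus_cell K (fst z)) (torus_cell K (snd z)) * g (snd z) \<partial>(lborel \<Otimes>\<^sub>M lborel))
        = (\<Sum>p\<in>grid K. \<Sum>q\<in>grid K. H p q * cell_mass K f p * cell_mass K g q)"
    unfolding cell_pair_expand
  proof -
    let ?F = "\<lambda>p q z. H p q * ((f (fst z) * of_bool (torus_cell K (fst z) = p)) * (g (snd z) * of_bool (torus_cell K (snd z) = q)))"
    have "(\<integral>z. (\<Sum>p\<in>grid K. \<Sum>q\<in>grid K. ?F p q z) \<partial>(lborel \<Otimes>\<^sub>M lborel))
      = (\<Sum>p\<in>grid K. \<integral>z. (\<Sum>q\<in>grid K. ?F p q z) \<partial>(lborel \<Otimes>\<^sub>M lborel))"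
      by (intro Bochner_Integration.integral_sum Bochner_Integration.integrable_sum integrable_mult_right int)
    also have "\<dots> = (\<Sum>p\<in>grid K. \<Sum>q\<in>grid K. \<integral>z. ?F p q z \<partial>(lborel \<Otimes>\<^sub>M lborel))"
      by (intro sum.cong refl Bochner_Integration.integral_sum integrable_mult_right int)
    also have "(\<lambda>p q. \<integral>z. ?F p q z \<partial>(lborel \<Otimes>\<^sub>M lborel)) = (\<lambda>p q. H p q * cell_mass K f p * cell_mass K g q)"
      unfolding integral_mult_right_zero integral_lborel_mult[OF integrable_cell[OF assms(1)] integrable_cell[OF assms(2)]]
        cell_mass_def by (simp add: mult.assoc)
    finally show "(\<integral>z. (\<Sum>p\<in>grid K. \<Sum>q\<in>grid K. ?F p q z) \<partial>(lborel \<Otimes>\<^sub>M lborel))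
      = (\<Sum>p\<in>grid K. \<Sum>q\<in>grid K. H p q * cell_mass K f p * cell_mass K g q)" .
  qed
qed

definition dyadic_weight :: "int \<Rightarrow> real" where
  "dyadic_weight z = (1/2) ^ nat \<bar>z\<bar>"

lemma dyadic_weight_pos: "0 < dyadic_weight z"
  by (simp add: dyadic_weight_def)

lemma sum_dyadic_weight: "(\<integral>\<^sup>+z. ennreal (dyadic_weight z) \<partial>count_space UNIV) \<le> 4"
proof -
  have geo: "(\<Sum>n. ennreal ((1/2) ^ n)) = 2"
  proof -
    have "(\<Sum>n. ennreal ((1/2) ^ n)) = ennreal (\<Sum>n. (1/2) ^ n)"
      by (intro suminf_ennreal2 summable_geometric) auto
    then show ?thesis by (simp add: suminf_geometric)
  qed
  have half: "(\<integral>\<^sup>+z. ennreal (dyadic_weight z) * indicator (range g) z \<partial>count_space UNIV) = 2"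
    if g: "inj g" "\<And>n. nat \<bar>g n\<bar> = n" for g :: "nat \<Rightarrow> int"
  proof -
    have "(\<integral>\<^sup>+z. ennreal (dyadic_weight z) * indicator (range g) z \<partial>count_space UNIV)
      = (\<integral>\<^sup>+z. ennreal (dyadic_weight z) \<partial>count_space (range g))"
      by (simp add: nn_integral_restrict_space[symmetric] restrict_count_space)
    also have "\<dots> = (\<integral>\<^sup>+n. ennreal (dyadic_weight (g n)) \<partial>count_space UNIV)"
      using g by (intro nn_integral_bij_count_space[symmetric]) (simp add: bij_betw_def)
    finally show ?thesis
      unfolding nn_integral_count_space_nat using geo g by (simp add: dyadic_weight_def)
  qed
  have cover: "z \<in> range int \<or> z \<in> range (\<lambda>n. - int n)" for z
    by (cases z rule: int_cases2) auto
  have "(\<integral>\<^sup>+z. ennreal (dyadic_weight z) \<partial>count_space UNIV)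
    \<le> (\<integral>\<^sup>+z. ennreal (dyadic_weight z) * indicator (range int) z
        + ennreal (dyadic_weight z) * indicator (range (\<lambda>n. - int n)) z \<partial>count_space UNIV)"
    using cover by (intro nn_integral_mono) (auto simp: indicator_def)
  also have "\<dots> = 2 + 2"
    using half[of int] half[of "\<lambda>n. - int n"] by (subst nn_integral_add) (simp_all add: inj_on_def)
  finally show ?thesis by simp
qed

lemma nn_integral_cell_weight_1:
  "(\<integral>\<^sup>+t. ennreal (of_bool (\<lfloor>2 ^ K * t\<rfloor> mod 2 ^ K = p) * dyadic_weight \<lfloor>t::real\<rfloor>) \<partial>lborel) \<le> ennreal (4 / 2 ^ K)"
proof -
  define N :: int where "N = 2 ^ K"
  have N: "0 < N" "2 ^ K = real_of_int N" by (simp_all add: N_def)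
  define S where "S z = {real_of_int z + real_of_int p / real_of_int N ..< real_of_int z + (real_of_int p + 1) / real_of_int N}" for z :: int
  have "ennreal (of_bool (\<lfloor>2 ^ K * t\<rfloor> mod 2 ^ K = p) * dyadic_weight \<lfloor>t\<rfloor>)
    \<le> (\<integral>\<^sup>+z. ennreal (dyadic_weight z) * indicator (S z) t \<partial>count_space UNIV)" for t
  proof (cases "\<lfloor>2 ^ K * t\<rfloor> mod 2 ^ K = p")
    case True
    define u where "u = \<lfloor>real_of_int N * t\<rfloor>"
    have "\<lfloor>t\<rfloor> = \<lfloor>(real_of_int N * t) / real_of_int N\<rfloor>" using N by simp
    also have "\<dots> = u div N" unfolding u_def using N by (intro floor_divide_real_eq_div) simp
    finally have "u = N * \<lfloor>t\<rfloor> + u mod N" by simp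
    also have "u mod N = p" using True by (simp add: u_def N_def)
    finally have u: "real_of_int u = real_of_int N * real_of_int \<lfloor>t\<rfloor> + real_of_int p"
      by (metis of_int_add of_int_mult)
    have "real_of_int u \<le> real_of_int N * t" "real_of_int N * t < real_of_int u + 1"
      unfolding u_def by linarith+
    then have "t \<in> S \<lfloor>t\<rfloor>" unfolding u S_def using N by (simp add: field_simps)
    then have "ennreal (of_bool (\<lfloor>2 ^ K * t\<rfloor> mod 2 ^ K = p) * dyadic_weight \<lfloor>t\<rfloor>)
      = ennreal (dyadic_weight \<lfloor>t\<rfloor>) * indicator (S \<lfloor>t\<rfloor>) t" using True by simp
    also have "\<dots> \<le> (\<integral>\<^sup>+z. ennreal (dyadic_weight z) * indicator (S z) t \<partial>count_space UNIV)"
      by (rule nn_integral_ge_point) simp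
    finally show ?thesis .
  qed simp
  then have "(\<integral>\<^sup>+t. ennreal (of_bool (\<lfloor>2 ^ K * t\<rfloor> mod 2 ^ K = p) * dyadic_weight \<lfloor>t::real\<rfloor>) \<partial>lborel)
    \<le> (\<integral>\<^sup>+t. \<integral>\<^sup>+z. ennreal (dyadic_weight z) * indicator (S z) t \<partial>count_space UNIV \<partial>lborel)"
    by (intro nn_integral_mono)
  also have "\<dots> = (\<integral>\<^sup>+z. \<integral>\<^sup>+t. ennreal (dyadic_weight z) * indicator (S z) t \<partial>lborel \<partial>count_space UNIV)"
    by (intro nn_integral_count_space_nn_integral) (auto simp: S_def)
  also have "\<dots> = (\<integral>\<^sup>+z. ennreal (dyadic_weight z) * ennreal (1 / 2 ^ K) \<partial>count_space UNIV)"
  proof (intro nn_integral_cong)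
    fix z
    have "(\<integral>\<^sup>+t. ennreal (dyadic_weight z) * indicator (S z) t \<partial>lborel) = ennreal (dyadic_weight z) * emeasure lborel (S z)"
      by (intro nn_integral_cmult_indicator) (simp add: S_def)
    also have "emeasure lborel (S z) = ennreal (1 / 2 ^ K)"
    proof -
      have "real_of_int z + real_of_int p / real_of_int N \<le> real_of_int z + (real_of_int p + 1) / real_of_int N"
        using N by (simp add: divide_right_mono)
      then have "emeasure lborel (S z) = ennreal (real_of_int z + (real_of_int p + 1) / real_of_int N - (real_of_int z + real_of_int p / real_of_int N))"
        unfolding S_def by (rule emeasure_lborel_Ico)
      also have "real_of_int z + (real_of_int p + 1) / real_of_int N - (real_of_int z + real_of_int p / real_of_int N) = 1 / 2 ^ K"
        unfolding N(2) by (simp add: diff_divide_distrib[symmetric])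
      finally show ?thesis .
    qed
    finally show "(\<integral>\<^sup>+t. ennreal (dyadic_weight z) * indicator (S z) t \<partial>lborel) = ennreal (dyadic_weight z) * ennreal (1 / 2 ^ K)" .
  qed
  also have "\<dots> = (\<integral>\<^sup>+z. ennreal (dyadic_weight z) \<partial>count_space UNIV) * ennreal (1 / 2 ^ K)"
    by (intro nn_integral_multc) simp
  also have "\<dots> \<le> 4 * ennreal (1 / 2 ^ K)"
    by (intro mult_right_mono sum_dyadic_weight) simp
  also have "\<dots> = ennreal (4 / 2 ^ K)"
    using ennreal_mult[of 4 "1 / 2 ^ K"] by simp
  finally show ?thesis .
qed

lemma prod_Basis_vec2:
  fixes h :: "real^2 \<Rightarrow> 'b::comm_monoid_mult"
  shows "(\<Prod>b\<in>(Basis :: (real^2) set). h b) = h (axis 1 1) * h (axis 2 1)"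
proof -
  have B: "(Basis :: (real^2) set) = {axis 1 1, axis 2 1}"
    by (auto simp: Basis_vec_def) (metis exhaust_2)
  have "axis 1 1 \<noteq> (axis 2 1 :: real^2)" by (simp add: axis_eq_axis)
  then show ?thesis unfolding B by simp
qed

lemma nn_integral_cell_weight:
  "(\<integral>\<^sup>+x. ennreal (of_bool (torus_cell K x = p) * (dyadic_weight \<lfloor>x $ 1\<rfloor> * dyadic_weight \<lfloor>x $ 2\<rfloor>)) \<partial>lborel)
    \<le> ennreal (16 / 4 ^ K)"
proof -
  define F where "F u t = ennreal (of_bool (\<lfloor>2 ^ K * t\<rfloor> mod 2 ^ K = u) * dyadic_weight \<lfloor>t\<rfloor>)" for u and t :: real
  have F [measurable]: "F u \<in> borel_measurable borel" for u
  proof -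
    have "(\<lambda>t::real. of_bool (\<lfloor>2 ^ K * t\<rfloor> mod 2 ^ K = u) :: real) \<in> borel_measurable borel"
      by (rule measurable_compose[of "\<lambda>t::real. \<lfloor>2 ^ K * t\<rfloor>" _ "count_space UNIV"]) auto
    moreover have "(\<lambda>t::real. dyadic_weight \<lfloor>t\<rfloor>) \<in> borel_measurable borel"
      by (rule measurable_compose[of floor _ "count_space UNIV"]) auto
    ultimately show ?thesis unfolding F_def by measurable
  qed
  define G where "G b = F (if b = (axis 1 1 :: real^2) then fst p else snd p)" for b
  have ne: "axis 2 1 \<noteq> (axis 1 1 :: real^2)" by (simp add: axis_eq_axis)
  have "(\<integral>\<^sup>+x. ennreal (of_bool (torus_cell K x = p) * (dyadic_weight \<lfloor>x $ 1\<rfloor> * dyadic_weight \<lfloor>x $ 2\<rfloor>)) \<partial>lborel)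
    = (\<integral>\<^sup>+x. (\<Prod>b\<in>Basis. G b (x \<bullet> b)) \<partial>lborel)"
  proof (intro nn_integral_cong)
    fix x :: "real^2"
    show "ennreal (of_bool (torus_cell K x = p) * (dyadic_weight \<lfloor>x $ 1\<rfloor> * dyadic_weight \<lfloor>x $ 2\<rfloor>)) = (\<Prod>b\<in>Basis. G b (x \<bullet> b))"
      unfolding prod_Basis_vec2 G_def F_def using ne
      by (cases p) (auto simp: inner_axis torus_cell_def ennreal_mult[symmetric] dyadic_weight_pos less_imp_le)
  qed
  also have "\<dots> = (\<Prod>b\<in>Basis. \<integral>\<^sup>+t. G b t \<partial>lborel)"
    by (intro nn_integral_lborel_prod) (auto simp: G_def)
  also have "\<dots> \<le> ennreal (4 / 2 ^ K) * ennreal (4 / 2 ^ K)"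
    unfolding prod_Basis_vec2 G_def F_def by (intro mult_mono nn_integral_cell_weight_1) auto
  also have "\<dots> = ennreal (16 / 4 ^ K)"
    by (subst ennreal_mult[symmetric]) (auto simp: power_mult_distrib[symmetric])
  finally show ?thesis .
qed

definition admissible :: "real \<Rightarrow> (real^2 \<Rightarrow> real) \<Rightarrow> bool" where
  "admissible b f \<longleftrightarrow> f \<in> borel_measurable lborel \<and> (\<forall>x. 0 \<le> f x) \<and>
      integrable lborel (\<lambda>x. f x * ln (f x)) \<and> integrable lborel (\<lambda>x. norm x ^ 2 * f x) \<and>
      integrable lborel f \<and> (\<integral>x. f x \<partial>lborel) = b"

lemma Gamma_eq_admissible: "Gamma n \<beta> = {\<rho>. \<forall>i\<in>{1..n}. admissible (\<beta> i) (\<rho> i)}"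
  by (simp add: Gamma_def admissible_def)

lemma integrable_second_moment:
  assumes "admissible b f"
  shows "integrable lborel (\<lambda>x. norm (x - v) ^ 2 * f x)"
proof -
  have f: "f \<in> borel_measurable borel" "\<And>x. 0 \<le> f x" "integrable lborel f"
    "integrable lborel (\<lambda>x. norm x ^ 2 * f x)"
    using assms by (auto simp: admissible_def)
  note [measurable] = f(1)
  show ?thesis
  proof (rule Bochner_Integration.integrable_bound)
    show "integrable lborel (\<lambda>x. 2 * (norm x ^ 2 * f x) + 2 * norm v ^ 2 * f x)"
      using f by (intro Bochner_Integration.integrable_add integrable_mult_right)
    show "AE x in lborel. norm (norm (x - v) ^ 2 * f x) \<le> norm (2 * (norm x ^ 2 * f x) + 2 * norm v ^ 2 * f x)"
    proof (rule AE_I2)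
      fix x
      have "norm (x - v) ^ 2 \<le> (norm x + norm v) ^ 2"
        by (intro power_mono norm_triangle_ineq4) auto
      also have "\<dots> \<le> 2 * norm x ^ 2 + 2 * norm v ^ 2"
        using sum_squares_bound[of "norm x" "norm v"] by (simp add: power2_sum)
      finally have "norm (x - v) ^ 2 * f x \<le> (2 * norm x ^ 2 + 2 * norm v ^ 2) * f x"
        using f by (intro mult_right_mono)
      then show "norm (norm (x - v) ^ 2 * f x) \<le> norm (2 * (norm x ^ 2 * f x) + 2 * norm v ^ 2 * f x)"
        using f(2)[of x] by (simp add: abs_mult algebra_simps)
    qed
  qed measurable
qed

lemma ln_dyadic_weight_ge:
  fixes x v :: "real^2"
  assumes "0 < \<alpha>"
  shows "- \<alpha> * norm (x - v) ^ 2 - (1 / \<alpha> + 2 * norm v + 2)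
    \<le> ln (dyadic_weight \<lfloor>x $ 1\<rfloor> * dyadic_weight \<lfloor>x $ 2\<rfloor>)"
proof -
  have single: "- norm x - 1 \<le> ln (dyadic_weight \<lfloor>x $ i\<rfloor>)" for i
  proof -
    have "\<bar>x $ i\<bar> \<le> norm x" by (rule component_le_norm_cart)
    then have "real_of_int \<bar>\<lfloor>x $ i\<rfloor>\<bar> \<le> norm x + 1" by linarith
    moreover have "real (nat \<bar>\<lfloor>x $ i\<rfloor>\<bar>) * ln 2 \<le> real (nat \<bar>\<lfloor>x $ i\<rfloor>\<bar>) * 1"
      using ln_2_less_1 by (intro mult_left_mono) auto
    moreover have "ln (dyadic_weight \<lfloor>x $ i\<rfloor>) = - (real (nat \<bar>\<lfloor>x $ i\<rfloor>\<bar>) * ln 2)"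
      by (simp add: dyadic_weight_def ln_realpow ln_div)
    ultimately show ?thesis by simp
  qed
  have "norm x \<le> norm (x - v) + norm v" using norm_triangle_ineq[of "x - v" v] by simp
  moreover have "2 * norm (x - v) \<le> \<alpha> * norm (x - v) ^ 2 + 1 / \<alpha>"
  proof -
    have "0 \<le> (\<alpha> * norm (x - v) - 1) ^ 2 / \<alpha>" using assms by simp
    also have "\<dots> = \<alpha> * norm (x - v) ^ 2 + 1 / \<alpha> - 2 * norm (x - v)"
      using assms by (simp add: power2_eq_square field_simps)
    finally show ?thesis by simp
  qed
  ultimately show ?thesis
    using single[of 1] single[of 2] dyadic_weight_pos[of "\<lfloor>x $ 1\<rfloor>"] dyadic_weight_pos[of "\<lfloor>x $ 2\<rfloor>"]
    by (simp add: ln_mult)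
qed

lemma entropy_ge_cells:
  fixes f :: "real^2 \<Rightarrow> real"
  assumes f: "admissible b f" and b: "0 < b" and \<alpha>: "0 < \<alpha>"
  shows "(\<Sum>p\<in>grid K. xlnx (cell_mass K f p)) + ln 4 * real K * b - b * (1 / \<alpha> + 2 * norm v + 33)
    \<le> (\<integral>x. f x * ln (f x) \<partial>lborel) + \<alpha> * (\<integral>x. norm (x - v) ^ 2 * f x \<partial>lborel)"
proof -
  have f': "f \<in> borel_measurable borel" "\<And>x. 0 \<le> f x" "integrable lborel f"
    "integrable lborel (\<lambda>x. f x * ln (f x))" "(\<integral>x. f x \<partial>lborel) = b"
    using f by (auto simp: admissible_def)
  note [measurable] = f'(1)
  define m where "m = cell_mass K f"
  have m0: "0 \<le> m p" for p unfolding m_def using f'(2) by (rule cell_mass_nonneg)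
  have msum: "sum m (grid K) = b" unfolding m_def using f' by (simp add: sum_cell_mass)
  define h where "h p = 4 ^ K * m p + b" for p
  have h0: "0 < h p" for p unfolding h_def using m0[of p] b by (simp add: add_nonneg_pos)
  define w :: "real^2 \<Rightarrow> real" where "w x = dyadic_weight \<lfloor>x $ 1\<rfloor> * dyadic_weight \<lfloor>x $ 2\<rfloor>" for x
  have w0: "0 < w x" for x unfolding w_def using dyadic_weight_pos by simp
  have nth [measurable]: "(\<lambda>x::real^2. x $ i) \<in> borel_measurable borel" for i
    by (intro borel_measurable_continuous_onI continuous_intros)
  have dw: "(\<lambda>x::real^2. dyadic_weight \<lfloor>x $ i\<rfloor>) \<in> borel_measurable borel" for i
    by (rule measurable_compose[of "\<lambda>x::real^2. \<lfloor>x $ i\<rfloor>" _ "count_space UNIV"]) auto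
  have wm [measurable]: "w \<in> borel_measurable borel"
    unfolding w_def using dw by (intro borel_measurable_times)
  have wc: "integrable lborel (\<lambda>x. w x * of_bool (torus_cell K x = p))"
    and wci: "(\<integral>x. w x * of_bool (torus_cell K x = p) \<partial>lborel) \<le> 16 / 4 ^ K" for p
  proof -
    have *: "(\<integral>\<^sup>+x. ennreal (w x * of_bool (torus_cell K x = p)) \<partial>lborel) \<le> ennreal (16 / 4 ^ K)"
      using nn_integral_cell_weight[of K p] by (simp add: w_def mult.commute)
    show 1: "integrable lborel (\<lambda>x. w x * of_bool (torus_cell K x = p))"
      using le_less_trans[OF * ennreal_less_top] w0 by (intro integrableI_nonneg) (auto simp: less_imp_le)
    have "ennreal (\<integral>x. w x * of_bool (torus_cell K x = p) \<partial>lborel) \<le> ennreal (16 / 4 ^ K)"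
      using * w0 by (subst nn_integral_eq_integral[symmetric, OF 1]) (auto simp: less_imp_le)
    then show "(\<integral>x. w x * of_bool (torus_cell K x = p) \<partial>lborel) \<le> 16 / 4 ^ K"
      by (simp add: ennreal_le_iff)
  qed
  define g where "g x = w x * h (torus_cell K x)" for x
  have g: "g x = (\<Sum>p\<in>grid K. h p * (w x * of_bool (torus_cell K x = p)))" for x
    unfolding g_def by (rule cell_expand)
  have gint: "integrable lborel g"
    unfolding g by (intro Bochner_Integration.integrable_sum integrable_mult_right wc)
  have "(\<integral>x. g x \<partial>lborel) = (\<Sum>p\<in>grid K. h p * (\<integral>x. w x * of_bool (torus_cell K x = p) \<partial>lborel))"
    unfolding g using wc by simp
  also have "\<dots> \<le> (\<Sum>p\<in>grid K. h p * (16 / 4 ^ K))"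
    using h0 wci by (intro sum_mono mult_left_mono) (auto simp: less_imp_le)
  also have "\<dots> = 16 / 4 ^ K * (4 ^ K * sum m (grid K) + 4 ^ K * b)"
  proof -
    have "sum h (grid K) = 4 ^ K * sum m (grid K) + 4 ^ K * b"
      by (simp add: h_def sum.distrib sum_distrib_left card_grid)
    then show ?thesis unfolding sum_distrib_right[symmetric] by (simp add: mult.commute)
  qed
  also have "\<dots> = 32 * b" by (simp add: msum distrib_left)
  finally have gle: "(\<integral>x. g x \<partial>lborel) \<le> 32 * b" .
  define c where "c = 1 / \<alpha> + 2 * norm v + 2"
  have int1: "integrable lborel (\<lambda>x. f x * ln (h (torus_cell K x)))"
    using f'(3) by (rule integrable_cell_function)
  have int2: "integrable lborel (\<lambda>x. norm (x - v) ^ 2 * f x)"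
    using f by (rule integrable_second_moment)
  have "(\<integral>x. f x * ln (h (torus_cell K x)) - \<alpha> * (norm (x - v) ^ 2 * f x) - c * f x + f x - g x \<partial>lborel)
    \<le> (\<integral>x. f x * ln (f x) \<partial>lborel)"
  proof (rule integral_mono)
    show "integrable lborel (\<lambda>x. f x * ln (h (torus_cell K x)) - \<alpha> * (norm (x - v) ^ 2 * f x) - c * f x + f x - g x)"
      using int1 int2 f' gint by (intro Bochner_Integration.integrable_diff Bochner_Integration.integrable_add integrable_mult_right)
    fix x
    have "f x * ln (g x) + f x - g x \<le> xlnx (f x)"
      using f' w0 h0 by (intro xlnx_ge_linear) (auto simp: g_def)
    moreover have "ln (g x) = ln (w x) + ln (h (torus_cell K x))"
      unfolding g_def using w0[of x] h0[of "torus_cell K x"] by (simp add: ln_mult)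
    moreover have "f x * (- \<alpha> * norm (x - v) ^ 2 - c) \<le> f x * ln (w x)"
      unfolding c_def w_def using f' \<alpha> by (intro mult_left_mono ln_dyadic_weight_ge)
    ultimately show "f x * ln (h (torus_cell K x)) - \<alpha> * (norm (x - v) ^ 2 * f x) - c * f x + f x - g x \<le> f x * ln (f x)"
      by (simp add: xlnx_def algebra_simps)
  qed (use f' in auto)
  moreover have "(\<integral>x. f x * ln (h (torus_cell K x)) - \<alpha> * (norm (x - v) ^ 2 * f x) - c * f x + f x - g x \<partial>lborel)
    = (\<Sum>p\<in>grid K. ln (h p) * m p) - \<alpha> * (\<integral>x. norm (x - v) ^ 2 * f x \<partial>lborel) - c * b + b - (\<integral>x. g x \<partial>lborel)"
    unfolding m_def integral_cell_function[OF f'(3), symmetric]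
    using int1 int2 f' gint by (simp add: f'(5)[symmetric])
  moreover have "(\<Sum>p\<in>grid K. xlnx (m p)) + ln 4 * real K * b \<le> (\<Sum>p\<in>grid K. ln (h p) * m p)"
  proof -
    have "xlnx (m p) + ln 4 * real K * m p \<le> ln (h p) * m p" for p
    proof (cases "m p = 0")
      case False
      then have mp: "0 < m p" using m0[of p] by simp
      have "ln (4 ^ K * m p) \<le> ln (h p)"
        using mp b by (subst ln_le_cancel_iff) (auto simp: h_def intro: add_pos_pos)
      then have "(real K * ln 4 + ln (m p)) * m p \<le> ln (h p) * m p"
        using mp by (simp add: ln_mult ln_realpow)
      then show ?thesis by (simp add: xlnx_def algebra_simps)
    qed simp
    then have "(\<Sum>p\<in>grid K. xlnx (m p) + ln 4 * real K * m p) \<le> (\<Sum>p\<in>grid K. ln (h p) * m p)"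
      by (intro sum_mono)
    then show ?thesis by (simp add: sum.distrib sum_distrib_left[symmetric] msum)
  qed
  ultimately show ?thesis
    using gle unfolding m_def c_def by (simp add: algebra_simps)
qed

text \<open>The part of \<open>ln d\<close> below resolution \<open>2\<^sup>-\<^sup>K\<close>. The value at \<open>d = 0\<close> is harmless because \<open>ln 0 = 0\<close>.\<close>

definition short_range :: "nat \<Rightarrow> real \<Rightarrow> real" where
  "short_range K d = (if 0 < d \<and> d < 1 / 2 ^ K then - ln (2 ^ K * d) else 0)"

lemma short_range_nonneg: "0 \<le> short_range K d"
proof -
  have "ln (2 ^ K * d) \<le> 0" if "0 < d" "d < 1 / 2 ^ K"
    using that by (simp add: field_simps)
  then show ?thesis by (simp add: short_range_def)
qed

lemma short_range_le: "short_range K d \<le> \<bar>ln d\<bar>"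
proof -
  have "- ln (2 ^ K * d) \<le> \<bar>ln d\<bar>" if "0 < d"
  proof -
    have "ln (2 ^ K * d) = ln (2 ^ K) + ln d" using that by (simp add: ln_mult)
    moreover have "0 \<le> ln ((2::real) ^ K)" by simp
    ultimately show ?thesis by linarith
  qed
  then show ?thesis by (simp add: short_range_def)
qed

lemma ln_ge_minus_short_range:
  assumes "0 \<le> d"
  shows "ln (max d (1 / 2 ^ K)) - short_range K d \<le> ln d"
proof -
  consider "d = 0" | "0 < d" "d < 1 / 2 ^ K" | "1 / 2 ^ K \<le> d" using assms by linarith
  then show ?thesis
  proof cases
    case 1
    then show ?thesis using ln_ge_zero[of "2 ^ K :: real"] by (simp add: short_range_def ln_div)
  next
    case 2
    then show ?thesis by (simp add: short_range_def max_def ln_div ln_mult)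
  next
    case 3
    then show ?thesis by (simp add: short_range_def max_def)
  qed
qed

lemma short_range_measurable [measurable]: "short_range K \<in> borel_measurable borel"
  unfolding short_range_def[abs_def] by measurable

lemma
  fixes f g :: "real^2 \<Rightarrow> real"
  assumes f: "admissible b f" and g: "admissible c g"
  shows integrable_short_range:
      "integrable (lborel \<Otimes>\<^sub>M lborel) (\<lambda>z. f (fst z) * short_range K (dist (fst z) (snd z)) * g (snd z))"
    and short_range_tendsto_0:
      "(\<lambda>K. \<integral>z. f (fst z) * short_range K (dist (fst z) (snd z)) * g (snd z) \<partial>(lborel \<Otimes>\<^sub>M lborel)) \<longlonglongrightarrow> 0"
proof -
  have f': "f \<in> borel_measurable borel" "\<And>x. 0 \<le> f x" and g': "g \<in> borel_measurable borel" "\<And>x. 0 \<le> g x"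
    using f g by (auto simp: admissible_def)
  note [measurable] = f'(1) g'(1)
  let ?w = "\<lambda>z. \<bar>f (fst z) * ln (dist (fst z) (snd z)) * g (snd z)\<bar>"
  let ?s = "\<lambda>K z. f (fst z) * short_range K (dist (fst z) (snd z)) * g (snd z)"
  have w: "integrable (lborel \<Otimes>\<^sub>M lborel) ?w"
    using f g by (intro integrable_abs integrable_interaction) (auto simp: admissible_def)
  have le: "norm (?s K z) \<le> ?w z" for K z
    using f'(2)[of "fst z"] g'(2)[of "snd z"] short_range_nonneg[of K "dist (fst z) (snd z)"]
      short_range_le[of K "dist (fst z) (snd z)"]
    by (simp add: abs_mult mult_left_mono mult_right_mono)
  have lim: "(\<lambda>K. ?s K z) \<longlonglongrightarrow> 0" for z
  proof -
    have "\<forall>\<^sub>F K in sequentially. short_range K (dist (fst z) (snd z)) = 0"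
    proof (cases "dist (fst z) (snd z) = 0")
      case True
      then show ?thesis by (simp add: short_range_def)
    next
      case False
      have "(\<lambda>K. (1/2::real) ^ K) \<longlonglongrightarrow> 0" by (rule LIMSEQ_power_zero) simp
      then have "\<forall>\<^sub>F K in sequentially. (1/2) ^ K < dist (fst z) (snd z)"
        using False by (intro order_tendstoD(2)) auto
      then show ?thesis
        by (rule eventually_mono) (simp add: short_range_def power_one_over)
    qed
    then show ?thesis by (intro tendsto_eventually) (auto elim: eventually_mono)
  qed
  show "integrable (lborel \<Otimes>\<^sub>M lborel) (?s K)"
    by (rule Bochner_Integration.integrable_bound[OF w]) (use le in auto)
  have "(\<lambda>K. \<integral>z. ?s K z \<partial>(lborel \<Otimes>\<^sub>M lborel)) \<longlonglongrightarrow> (\<integral>z. 0 \<partial>((lborel :: (real^2) measure) \<Otimes>\<^sub>M (lborel :: (real^2) measure)))"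
    by (rule integral_dominated_convergence[OF _ _ w]) (use lim le in auto)
  then show "(\<lambda>K. \<integral>z. ?s K z \<partial>(lborel \<Otimes>\<^sub>M lborel)) \<longlonglongrightarrow> 0" by simp
qed

lemma interaction_ge_cells:
  fixes f g :: "real^2 \<Rightarrow> real"
  assumes f: "admissible b f" and g: "admissible c g"
  shows "- ln 2 * (\<Sum>p\<in>grid K. \<Sum>q\<in>grid K. coincidence K p q * cell_mass K f p * cell_mass K g q)
      - 5 * ln 2 * (b * c)
      - (\<integral>z. f (fst z) * short_range K (dist (fst z) (snd z)) * g (snd z) \<partial>(lborel \<Otimes>\<^sub>M lborel))
    \<le> (\<integral>z. f (fst z) * ln (dist (fst z) (snd z)) * g (snd z) \<partial>(lborel \<Otimes>\<^sub>M lborel))"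
proof -
  have f': "\<And>x. 0 \<le> f x" "integrable lborel f" "(\<integral>x. f x \<partial>lborel) = b"
    and g': "\<And>x. 0 \<le> g x" "integrable lborel g" "(\<integral>x. g x \<partial>lborel) = c"
    using f g by (auto simp: admissible_def)
  let ?c = "\<lambda>z. f (fst z) * coincidence K (torus_cell K (fst z)) (torus_cell K (snd z)) * g (snd z)"
  let ?s = "\<lambda>z. f (fst z) * short_range K (dist (fst z) (snd z)) * g (snd z)"
  let ?M = "(lborel :: (real^2) measure) \<Otimes>\<^sub>M (lborel :: (real^2) measure)"
  have c: "integrable ?M ?c" by (rule integrable_cell_pair[OF f'(2) g'(2)])
  have fg: "integrable ?M (\<lambda>z. f (fst z) * g (snd z))" by (rule integrable_lborel_mult[OF f'(2) g'(2)])
  have s: "integrable ?M ?s" by (rule integrable_short_range[OF f g])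
  have "(\<integral>z. - ln 2 * ?c z - 5 * ln 2 * (f (fst z) * g (snd z)) - ?s z \<partial>?M)
    \<le> (\<integral>z. f (fst z) * ln (dist (fst z) (snd z)) * g (snd z) \<partial>?M)"
  proof (rule integral_mono)
    show "integrable ?M (\<lambda>z. - ln 2 * ?c z - 5 * ln 2 * (f (fst z) * g (snd z)) - ?s z)"
      using c fg s by (intro Bochner_Integration.integrable_diff integrable_mult_right)
    show "integrable ?M (\<lambda>z. f (fst z) * ln (dist (fst z) (snd z)) * g (snd z))"
      using f g by (intro integrable_interaction) (auto simp: admissible_def)
    fix z :: "(real^2) \<times> (real^2)"
    define d where "d = dist (fst z) (snd z)"
    have "- ln 2 * coincidence K (torus_cell K (fst z)) (torus_cell K (snd z)) - 5 * ln 2 - short_range K d \<le> ln d"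
      using ln_max_dist_ge[of K "fst z" "snd z"] ln_ge_minus_short_range[of d K] unfolding d_def by simp
    then have "(f (fst z) * g (snd z)) * (- ln 2 * coincidence K (torus_cell K (fst z)) (torus_cell K (snd z)) - 5 * ln 2 - short_range K d)
      \<le> (f (fst z) * g (snd z)) * ln d"
      using f' g' by (intro mult_left_mono) auto
    then show "- ln 2 * ?c z - 5 * ln 2 * (f (fst z) * g (snd z)) - ?s z \<le> f (fst z) * ln (dist (fst z) (snd z)) * g (snd z)"
      unfolding d_def[symmetric] by (simp add: algebra_simps)
  qed
  also have "(\<integral>z. - ln 2 * ?c z - 5 * ln 2 * (f (fst z) * g (snd z)) - ?s z \<partial>?M)
    = - ln 2 * (\<integral>z. ?c z \<partial>?M) - 5 * ln 2 * (\<integral>z. f (fst z) * g (snd z) \<partial>?M) - (\<integral>z. ?s z \<partial>?M)"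
    using c fg s by (simp del: integral_mult_right_zero integral_mult_left_zero add: integral_mult_right)
  finally show ?thesis
    unfolding integral_cell_pair[OF f'(2) g'(2)] integral_lborel_mult[OF f'(2) g'(2)] f'(3) g'(3) by simp
qed

lemma FF_bounded_below:
  fixes n :: nat and a :: "nat \<Rightarrow> nat \<Rightarrow> real" and \<beta> \<alpha> :: "nat \<Rightarrow> real" and v :: "nat \<Rightarrow> real^2"
  assumes n: "n \<ge> 1" and sym: "\<forall>i\<in>{1..n}. \<forall>j\<in>{1..n}. a i j = a j i"
    and a: "\<And>i j. i \<in> {1..n} \<Longrightarrow> j \<in> {1..n} \<Longrightarrow> 0 \<le> a i j"
    and \<beta>: "\<And>i. i \<in> {1..n} \<Longrightarrow> 0 < \<beta> i" and \<alpha>: "\<And>i. i \<in> {1..n} \<Longrightarrow> 0 < \<alpha> i"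
    and nonneg: "\<And>J. J \<subseteq> {1..n} \<Longrightarrow> 0 \<le> Lambda a \<beta> J"
    and edge: "\<And>J i. J \<subseteq> {1..n} \<Longrightarrow> i \<in> J \<Longrightarrow> Lambda a \<beta> J = 0 \<Longrightarrow> 0 < a i i + Lambda a \<beta> (J - {i})"
  shows "\<exists>C. \<forall>\<rho>\<in>Gamma n \<beta>. C \<le> FF n a v \<alpha> \<rho>"
proof -
  define I where "I = {1..n}"
  have I: "finite I" "I \<noteq> {}" using n by (auto simp: I_def)
  note I_assms = sym[folded I_def] a[folded I_def] \<beta>[folded I_def] nonneg[folded I_def] edge[folded I_def]
  obtain C where C: "\<And>K (\<mu> :: int \<times> int \<Rightarrow> nat \<Rightarrow> real).
    \<lbrakk>\<And>p i. p \<in> grid K \<Longrightarrow> i \<in> I \<Longrightarrow> 0 \<le> \<mu> p i;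
     \<And>i. i \<in> I \<Longrightarrow> (\<Sum>p\<in>grid K. \<mu> p i) = \<beta> i\<rbrakk> \<Longrightarrow>
    C \<le> (\<Sum>p\<in>grid K. \<Sum>i\<in>I. xlnx (\<mu> p i)) + ln 4 * real K * sum \<beta> I
      - ln 4 / (8 * pi) * (\<Sum>i\<in>I. \<Sum>j\<in>I. a i j *
          (\<Sum>p\<in>grid K. \<Sum>q\<in>grid K. coincidence K p q * \<mu> p i * \<mu> q j))"
  proof (rule grid_entropy_bound[of I a \<beta>, OF I I_assms])
    fix C assume "\<And>K (\<mu> :: int \<times> int \<Rightarrow> nat \<Rightarrow> real).
    \<lbrakk>\<And>p i. p \<in> grid K \<Longrightarrow> i \<in> I \<Longrightarrow> 0 \<le> \<mu> p i;
     \<And>i. i \<in> I \<Longrightarrow> (\<Sum>p\<in>grid K. \<mu> p i) = \<beta> i\<rbrakk> \<Longrightarrow>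
    C \<le> (\<Sum>p\<in>grid K. \<Sum>i\<in>I. xlnx (\<mu> p i)) + ln 4 * real K * sum \<beta> I
      - ln 4 / (8 * pi) * (\<Sum>i\<in>I. \<Sum>j\<in>I. a i j *
          (\<Sum>p\<in>grid K. \<Sum>q\<in>grid K. coincidence K p q * \<mu> p i * \<mu> q j))"
    then show thesis by (rule that)
  qed
  define C' where "C' = C - (\<Sum>i\<in>I. \<beta> i * (1 / \<alpha> i + 2 * norm (v i) + 33))
    - 1 / (4 * pi) * (\<Sum>i\<in>I. \<Sum>j\<in>I. a i j * (5 * ln 2 * (\<beta> i * \<beta> j)))"
  have "C' \<le> FF n a v \<alpha> \<rho>" if \<rho>: "\<rho> \<in> Gamma n \<beta>" for \<rho>
  proof -
    have adm: "admissible (\<beta> i) (\<rho> i)" if "i \<in> I" for i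
      using \<rho> that by (simp add: Gamma_eq_admissible I_def)
    define S where "S K i j = (\<integral>z. \<rho> i (fst z) * short_range K (dist (fst z) (snd z)) * \<rho> j (snd z) \<partial>(lborel \<Otimes>\<^sub>M lborel))" for K i j
    define D where "D i j = (\<integral>z. \<rho> i (fst z) * ln (dist (fst z) (snd z)) * \<rho> j (snd z) \<partial>(lborel \<Otimes>\<^sub>M lborel))" for i j
    define E where "E i = (\<integral>x. \<rho> i x * ln (\<rho> i x) \<partial>lborel)" for i
    define V where "V i = (\<integral>x. norm (x - v i) ^ 2 * \<rho> i x \<partial>lborel)" for i
    have FF: "FF n a v \<alpha> \<rho> = (\<Sum>i\<in>I. E i) + 1 / (4 * pi) * (\<Sum>i\<in>I. \<Sum>j\<in>I. a i j * D i j) + (\<Sum>i\<in>I. \<alpha> i * V i)"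
      by (simp add: FF_def I_def E_def D_def V_def)
    have bound: "C' - 1 / (4 * pi) * (\<Sum>i\<in>I. \<Sum>j\<in>I. a i j * S K i j) \<le> FF n a v \<alpha> \<rho>" for K
    proof -
      define \<mu> where "\<mu> p i = cell_mass K (\<rho> i) p" for p i
      define Z where "Z i j = (\<Sum>p\<in>grid K. \<Sum>q\<in>grid K. coincidence K p q * \<mu> p i * \<mu> q j)" for i j
      have 1: "C \<le> (\<Sum>p\<in>grid K. \<Sum>i\<in>I. xlnx (\<mu> p i)) + ln 4 * real K * sum \<beta> I
          - ln 4 / (8 * pi) * (\<Sum>i\<in>I. \<Sum>j\<in>I. a i j * Z i j)"
        unfolding Z_def
      proof (rule C)
        show "0 \<le> \<mu> p i" if "i \<in> I" for p i
          unfolding \<mu>_def using adm[OF that] by (intro cell_mass_nonneg) (auto simp: admissible_def)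
        show "(\<Sum>p\<in>grid K. \<mu> p i) = \<beta> i" if "i \<in> I" for i
          unfolding \<mu>_def using adm[OF that] by (simp add: admissible_def sum_cell_mass)
      qed
      have "(\<Sum>i\<in>I. (\<Sum>p\<in>grid K. xlnx (\<mu> p i)) + ln 4 * real K * \<beta> i - \<beta> i * (1 / \<alpha> i + 2 * norm (v i) + 33))
        \<le> (\<Sum>i\<in>I. E i + \<alpha> i * V i)"
      proof (rule sum_mono)
        fix i assume i: "i \<in> I"
        show "(\<Sum>p\<in>grid K. xlnx (\<mu> p i)) + ln 4 * real K * \<beta> i - \<beta> i * (1 / \<alpha> i + 2 * norm (v i) + 33) \<le> E i + \<alpha> i * V i"
          unfolding \<mu>_def E_def V_def using adm[OF i] \<beta> \<alpha> i by (intro entropy_ge_cells) (auto simp: I_def)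
      qed
      then have 2: "(\<Sum>p\<in>grid K. \<Sum>i\<in>I. xlnx (\<mu> p i)) + ln 4 * real K * sum \<beta> I
          - (\<Sum>i\<in>I. \<beta> i * (1 / \<alpha> i + 2 * norm (v i) + 33)) \<le> (\<Sum>i\<in>I. E i) + (\<Sum>i\<in>I. \<alpha> i * V i)"
        by (simp add: sum.distrib sum_subtractf sum_distrib_left[symmetric] sum.swap[of _ I "grid K"])
      have "(\<Sum>i\<in>I. \<Sum>j\<in>I. a i j * (- ln 2 * Z i j - 5 * ln 2 * (\<beta> i * \<beta> j) - S K i j)) \<le> (\<Sum>i\<in>I. \<Sum>j\<in>I. a i j * D i j)"
      proof (intro sum_mono mult_left_mono)
        fix i j assume ij: "i \<in> I" "j \<in> I"
        show "- ln 2 * Z i j - 5 * ln 2 * (\<beta> i * \<beta> j) - S K i j \<le> D i j"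
          unfolding Z_def \<mu>_def S_def D_def using adm ij by (intro interaction_ge_cells)
        show "0 \<le> a i j" using a ij by (simp add: I_def)
      qed
      then have "- ln 2 * (\<Sum>i\<in>I. \<Sum>j\<in>I. a i j * Z i j) - (\<Sum>i\<in>I. \<Sum>j\<in>I. a i j * (5 * ln 2 * (\<beta> i * \<beta> j)))
          - (\<Sum>i\<in>I. \<Sum>j\<in>I. a i j * S K i j) \<le> (\<Sum>i\<in>I. \<Sum>j\<in>I. a i j * D i j)"
        by (simp add: right_diff_distrib sum_subtractf sum_distrib_left sum_negf mult_ac)
      then have "1 / (4 * pi) * (- ln 2 * (\<Sum>i\<in>I. \<Sum>j\<in>I. a i j * Z i j) - (\<Sum>i\<in>I. \<Sum>j\<in>I. a i j * (5 * ln 2 * (\<beta> i * \<beta> j)))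
          - (\<Sum>i\<in>I. \<Sum>j\<in>I. a i j * S K i j)) \<le> 1 / (4 * pi) * (\<Sum>i\<in>I. \<Sum>j\<in>I. a i j * D i j)"
        by (intro mult_left_mono) auto
      moreover have "ln 4 / (8 * pi) = 1 / (4 * pi) * ln (2::real)"
        using ln_realpow[of "2::real" 2] by (simp add: field_simps)
      ultimately show ?thesis
        using 1 2 unfolding FF C'_def by (simp only: right_diff_distrib mult.assoc minus_mult_left[symmetric] mult_minus_right)
    qed
    have "(\<lambda>K. C' - 1 / (4 * pi) * (\<Sum>i\<in>I. \<Sum>j\<in>I. a i j * S K i j)) \<longlonglongrightarrow> C' - 1 / (4 * pi) * (\<Sum>i\<in>I. \<Sum>j\<in>I. a i j * 0)"
      unfolding S_def using adm by (intro tendsto_intros short_range_tendsto_0)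
    then have "C' - 1 / (4 * pi) * (\<Sum>i\<in>I. \<Sum>j\<in>I. a i j * 0) \<le> FF n a v \<alpha> \<rho>"
      by (rule LIMSEQ_le_const2) (use bound in auto)
    then show ?thesis by simp
  qed
  then show ?thesis by blast
qed

section \<open>Trial densities\<close>

definition dyadic_box :: "nat \<Rightarrow> (real^2) set" where
  "dyadic_box k = box (\<chi> i. (1/2) ^ Suc k) (\<chi> i. (1/2) ^ k)"

lemma mem_dyadic_box: "x \<in> dyadic_box k \<longleftrightarrow> (\<forall>i. (1/2) ^ Suc k < x $ i \<and> x $ i < (1/2) ^ k)"
  by (simp add: dyadic_box_def mem_box_cart)

lemma sets_dyadic_box [measurable]: "dyadic_box k \<in> sets borel"
  by (simp add: dyadic_box_def)

lemma emeasure_dyadic_box: "emeasure lborel (dyadic_box k) = ennreal ((1/4) ^ Suc k)"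
proof -
  have "emeasure lborel (dyadic_box k)
    = ennreal (\<Prod>b\<in>Basis. ((\<chi> i. (1/2) ^ k) - (\<chi> i. (1/2) ^ Suc k) :: real^2) \<bullet> b)"
    unfolding dyadic_box_def by (intro emeasure_lborel_box) (auto simp: Basis_vec_def inner_axis)
  also have "(\<Prod>b\<in>Basis. ((\<chi> i. (1/2) ^ k) - (\<chi> i. (1/2) ^ Suc k) :: real^2) \<bullet> b) = (1/4) ^ Suc k"
    unfolding prod_Basis_vec2 by (simp add: inner_axis power_mult_distrib[symmetric])
  finally show ?thesis .
qed

lemma integrable_indicator_dyadic_box: "integrable lborel (indicator (dyadic_box k) :: real^2 \<Rightarrow> real)"
  by (simp add: emeasure_dyadic_box)

lemma integral_indicator_dyadic_box: "(\<integral>x. indicator (dyadic_box k) x \<partial>lborel) = (1/4 :: real) ^ Suc k"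
  by (simp add: measure_def emeasure_dyadic_box del: power_Suc)

lemma dyadic_box_unique:
  assumes "x \<in> dyadic_box k" "x \<in> dyadic_box l"
  shows "k = l"
proof -
  have False if "k < l" "x \<in> dyadic_box k" "x \<in> dyadic_box l" for k l
  proof -
    have "(1/2::real) ^ l \<le> (1/2) ^ Suc k" using that by (intro power_decreasing) auto
    moreover have "(1/2) ^ Suc k < x $ 1" "x $ 1 < (1/2) ^ l" using that by (auto simp: mem_dyadic_box)
    ultimately show False by linarith
  qed
  then show ?thesis using assms by (metis linorder_neqE_nat)
qed

lemma dyadic_box_pos:
  assumes "x \<in> dyadic_box k"
  shows "0 < x $ i"
proof -
  have "(1/2) ^ Suc k < x $ i" using assms unfolding mem_dyadic_box by blast
  moreover have "0 < (1/2::real) ^ Suc k" by simp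
  ultimately show ?thesis by linarith
qed

lemma dist_dyadic_box_le:
  assumes "x \<in> dyadic_box k" "y \<in> dyadic_box l"
  shows "dist x y \<le> 2 * (1/2) ^ min k l"
proof -
  have "\<bar>(x - y) $ i\<bar> \<le> (1/2) ^ min k l" for i
  proof -
    have "0 < x $ i" "0 < y $ i" "x $ i < (1/2) ^ k" "y $ i < (1/2) ^ l"
      using assms dyadic_box_pos by (auto simp: mem_dyadic_box)
    moreover have "(1/2::real) ^ k \<le> (1/2) ^ min k l" "(1/2::real) ^ l \<le> (1/2) ^ min k l"
      by (auto intro!: power_decreasing)
    ultimately show ?thesis unfolding vector_minus_component abs_le_iff by linarith
  qed
  note * = this[of 1] this[of 2]
  have "dist x y \<le> (\<Sum>i\<in>UNIV. \<bar>(x - y) $ i\<bar>)"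
    unfolding dist_norm by (rule norm_le_l1_cart)
  also have "\<dots> \<le> 2 * (1/2) ^ min k l" using * by (simp add: sum_2)
  finally show ?thesis .
qed

lemma norm_dyadic_box_le:
  assumes "x \<in> dyadic_box k"
  shows "norm x \<le> 2"
proof -
  have "\<bar>x $ i\<bar> \<le> 1" for i
  proof -
    have "0 < x $ i" "x $ i < (1/2) ^ k"
      using assms dyadic_box_pos by (auto simp: mem_dyadic_box)
    moreover have "(1/2::real) ^ k \<le> 1" by (intro power_le_one) auto
    ultimately show ?thesis by simp
  qed
  note * = this[of 1] this[of 2]
  have "norm x \<le> (\<Sum>i\<in>UNIV. \<bar>x $ i\<bar>)" by (rule norm_le_l1_cart)
  also have "\<dots> \<le> 2" using * by (simp add: sum_2)
  finally show ?thesis .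
qed

text \<open>Mass \<open>b\<close> spread evenly over the scales in \<open>S\<close>: one scale models concentration at a point,
  a long interval of scales models the density proportional to \<open>|x|\<^sup>-\<^sup>2\<close>.\<close>

definition profile :: "nat set \<Rightarrow> real \<Rightarrow> real^2 \<Rightarrow> real" where
  "profile S b x = (\<Sum>k\<in>S. b / real (card S) * 4 ^ Suc k * indicator (dyadic_box k) x)"

lemma profile_compose:
  assumes S: "finite S" and \<phi>: "\<phi> 0 = (0::real)"
  shows "\<phi> (profile S b x) = (\<Sum>k\<in>S. \<phi> (b / real (card S) * 4 ^ Suc k) * indicator (dyadic_box k) x)"
proof (cases "\<exists>k\<in>S. x \<in> dyadic_box k")
  case True
  then obtain k where k: "k \<in> S" "x \<in> dyadic_box k" by blast
  have *: "(\<Sum>l\<in>S. c l * indicator (dyadic_box l) x) = c k" for c :: "nat \<Rightarrow> real"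
  proof -
    have "c l * indicator (dyadic_box l) x = 0" if "l \<noteq> k" for l
      using dyadic_box_unique[OF _ k(2), of l] that by (auto simp: indicator_def)
    then have "(\<Sum>l\<in>S. c l * indicator (dyadic_box l) x) = (\<Sum>l\<in>{k}. c l * indicator (dyadic_box l) x)"
      using S k by (intro sum.mono_neutral_right) auto
    then show ?thesis using k by simp
  qed
  show ?thesis unfolding profile_def * ..
next
  case False
  then have z: "(\<Sum>l\<in>S. c l * indicator (dyadic_box l) x) = 0" for c :: "nat \<Rightarrow> real"
    by (intro sum.neutral) (auto simp: indicator_def)
  show ?thesis unfolding profile_def z by (rule \<phi>)
qed

lemma
  assumes S: "finite S" and \<phi>: "\<phi> 0 = (0::real)"
  shows integrable_profile_compose: "integrable lborel (\<lambda>x. \<phi> (profile S b x))"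
    and integral_profile_compose: "(\<integral>x. \<phi> (profile S b x) \<partial>lborel)
      = (\<Sum>k\<in>S. \<phi> (b / real (card S) * 4 ^ Suc k) * (1/4) ^ Suc k)"
proof -
  show "integrable lborel (\<lambda>x. \<phi> (profile S b x))"
    unfolding profile_compose[of S \<phi>, OF assms]
    by (intro Bochner_Integration.integrable_sum integrable_mult_right integrable_indicator_dyadic_box)
  show "(\<integral>x. \<phi> (profile S b x) \<partial>lborel) = (\<Sum>k\<in>S. \<phi> (b / real (card S) * 4 ^ Suc k) * (1/4) ^ Suc k)"
  proof -
    have "(\<integral>x. \<phi> (profile S b x) \<partial>lborel)
      = (\<Sum>k\<in>S. \<integral>x. \<phi> (b / real (card S) * 4 ^ Suc k) * indicator (dyadic_box k) x \<partial>lborel)"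
      unfolding profile_compose[of S \<phi>, OF assms]
      by (intro Bochner_Integration.integral_sum integrable_mult_right integrable_indicator_dyadic_box)
    then show ?thesis unfolding integral_mult_right_zero integral_indicator_dyadic_box .
  qed
qed

lemma profile_nonneg: "0 \<le> b \<Longrightarrow> 0 \<le> profile S b x"
  unfolding profile_def by (intro sum_nonneg) auto

lemma profile_eq_0: "2 < norm x \<Longrightarrow> profile S b x = 0"
  unfolding profile_def using norm_dyadic_box_le[of x] by (intro sum.neutral) (force simp: indicator_def)

lemma scale_cancel: "(1/4::real) ^ Suc k * 4 ^ Suc k = 1"
  unfolding power_mult_distrib[symmetric] by simp

lemma integral_profile:
  assumes "finite S" "S \<noteq> {}"
  shows "(\<integral>x. profile S b x \<partial>lborel) = b"
proof -
  have "(\<integral>x. profile S b x \<partial>lborel) = (\<Sum>k\<in>S. b / real (card S) * ((1/4) ^ Suc k * 4 ^ Suc k))"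
    using integral_profile_compose[OF assms(1), of "\<lambda>r. r" b] by (simp only: mult_ac)
  then show ?thesis unfolding scale_cancel using assms by simp
qed

lemma entropy_profile:
  assumes S: "finite S" "S \<noteq> {}" and b: "0 < b"
  shows "(\<integral>x. profile S b x * ln (profile S b x) \<partial>lborel)
    = b * (ln b + ln 4 - ln (real (card S)) + ln 4 * ((\<Sum>k\<in>S. real k) / real (card S)))"
proof -
  have c: "0 < real (card S)" using S by (simp add: card_gt_0_iff)
  have "(\<integral>x. profile S b x * ln (profile S b x) \<partial>lborel)
    = (\<Sum>k\<in>S. (b / real (card S) * 4 ^ Suc k) * ln (b / real (card S) * 4 ^ Suc k) * (1/4) ^ Suc k)"
    using integral_profile_compose[OF S(1), of "\<lambda>r. r * ln r" b] by simp
  also have "\<dots> = (\<Sum>k\<in>S. b / real (card S) * (ln b - ln (real (card S)) + ln 4) + b * ln 4 / real (card S) * real k)"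
  proof (rule sum.cong)
    fix k assume "k \<in> S"
    have "ln (b / real (card S) * 4 ^ Suc k) = ln b - ln (real (card S)) + real (Suc k) * ln 4"
      using b c by (simp add: ln_mult ln_div ln_realpow del: power_Suc of_nat_Suc)
    then have "(b / real (card S) * 4 ^ Suc k) * ln (b / real (card S) * 4 ^ Suc k) * (1/4) ^ Suc k
      = b / real (card S) * (ln b - ln (real (card S)) + real (Suc k) * ln 4) * ((1/4) ^ Suc k * 4 ^ Suc k)"
      by (simp only: mult_ac)
    then show "(b / real (card S) * 4 ^ Suc k) * ln (b / real (card S) * 4 ^ Suc k) * (1/4) ^ Suc k
      = b / real (card S) * (ln b - ln (real (card S)) + ln 4) + b * ln 4 / real (card S) * real k"
      unfolding scale_cancel by (simp add: algebra_simps add_divide_distrib)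
  qed simp
  also have "\<dots> = b * (ln b - ln (real (card S)) + ln 4) + b * ln 4 / real (card S) * (\<Sum>k\<in>S. real k)"
    using c by (simp add: sum.distrib sum_distrib_left)
  finally show ?thesis by (simp add: algebra_simps)
qed

lemma admissible_profile:
  assumes S: "finite S" "S \<noteq> {}" and b: "0 < b"
  shows "admissible b (profile S b)"
proof -
  have i: "integrable lborel (profile S b)"
    using integrable_profile_compose[OF S(1), of "\<lambda>r. r" b] by simp
  then have m [measurable]: "profile S b \<in> borel_measurable borel" by auto
  have "integrable lborel (\<lambda>x. norm x ^ 2 * profile S b x)"
  proof (rule Bochner_Integration.integrable_bound)
    show "integrable lborel (\<lambda>x. 4 * profile S b x)" using i by simp
    show "AE x in lborel. norm (norm x ^ 2 * profile S b x) \<le> norm (4 * profile S b x)"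
    proof (rule AE_I2)
      fix x :: "real^2"
      show "norm (norm x ^ 2 * profile S b x) \<le> norm (4 * profile S b x)"
      proof (cases "norm x \<le> 2")
        case True
        then have "norm x ^ 2 \<le> 2 ^ 2" by (intro power_mono) auto
        then show ?thesis by (simp add: abs_mult mult_right_mono)
      next
        case False
        then show ?thesis by (simp add: profile_eq_0)
      qed
    qed
  qed measurable
  then show ?thesis
    unfolding admissible_def
    using i b profile_nonneg[of b S] integral_profile[OF S]
      integrable_profile_compose[OF S(1), of "\<lambda>r. r * ln r" b] by auto
qed

lemma second_moment_profile_le:
  assumes S: "finite S" "S \<noteq> {}" and b: "0 < b"
  shows "(\<integral>x. norm (x - v) ^ 2 * profile S b x \<partial>lborel) \<le> (2 + norm v) ^ 2 * b"
proof -
  note adm = admissible_profile[OF assms]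
  then have i: "integrable lborel (profile S b)" by (simp add: admissible_def)
  have "(\<integral>x. norm (x - v) ^ 2 * profile S b x \<partial>lborel) \<le> (\<integral>x. (2 + norm v) ^ 2 * profile S b x \<partial>lborel)"
  proof (rule integral_mono)
    show "integrable lborel (\<lambda>x. norm (x - v) ^ 2 * profile S b x)"
      using adm by (rule integrable_second_moment)
    show "integrable lborel (\<lambda>x. (2 + norm v) ^ 2 * profile S b x)" using i by simp
    fix x :: "real^2"
    show "norm (x - v) ^ 2 * profile S b x \<le> (2 + norm v) ^ 2 * profile S b x"
    proof (cases "norm x \<le> 2")
      case True
      then have "norm (x - v) \<le> 2 + norm v" using norm_triangle_ineq4[of x v] by linarith
      then show ?thesis using b profile_nonneg[of b S x] by (intro mult_right_mono power_mono) auto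
    next
      case False
      then show ?thesis by (simp add: profile_eq_0)
    qed
  qed
  then show ?thesis using i integral_profile[OF S, of b] by simp
qed

lemma AE_fst_neq_snd: "AE z in lborel \<Otimes>\<^sub>M lborel. fst z \<noteq> (snd z :: real^2)"
proof (rule lborel_pair.AE_pair_measure)
  show "AE x in lborel. AE y in lborel. fst (x, y) \<noteq> (snd (x, y) :: real^2)"
    using AE_lborel_singleton by (auto simp: eq_commute)
qed measurable

lemma interaction_profile_le:
  assumes S: "finite S" "S \<noteq> {}" and T: "finite T" "T \<noteq> {}" and b: "0 < b" and c: "0 < c"
  shows "(\<integral>z. profile S b (fst z) * ln (dist (fst z) (snd z)) * profile T c (snd z) \<partial>(lborel \<Otimes>\<^sub>M lborel))
    \<le> b * c * (ln 2 - ln 2 * ((\<Sum>k\<in>S. \<Sum>l\<in>T. real (min k l)) / (real (card S) * real (card T))))"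
proof -
  let ?M = "(lborel :: (real^2) measure) \<Otimes>\<^sub>M (lborel :: (real^2) measure)"
  define s where "s = b / real (card S)"
  define t where "t = c / real (card T)"
  have st: "0 \<le> s" "0 \<le> t" using b c by (auto simp: s_def t_def)
  define U where "U k x = s * 4 ^ Suc k * indicator (dyadic_box k) x" for k and x :: "real^2"
  define V where "V k x = t * 4 ^ Suc k * indicator (dyadic_box k) x" for k and x :: "real^2"
  have UV: "profile S b = (\<lambda>x. \<Sum>k\<in>S. U k x)" "profile T c = (\<lambda>x. \<Sum>k\<in>T. V k x)"
    by (auto simp: profile_def U_def V_def s_def t_def)
  have UV0: "0 \<le> U k x" "0 \<le> V k x" for k x using st by (auto simp: U_def V_def)
  have Ui: "integrable lborel (U k)" and Vi: "integrable lborel (V k)" for k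
    unfolding U_def V_def by (intro integrable_mult_right integrable_indicator_dyadic_box)+
  have U1: "(\<integral>x. U k x \<partial>lborel) = s" and V1: "(\<integral>x. V k x \<partial>lborel) = t" for k
    unfolding U_def V_def using scale_cancel[of k] integral_indicator_dyadic_box[of k]
    by (simp_all del: power_Suc add: mult_ac)
  note UVi = integrable_lborel_mult[OF Ui Vi]
  have "(\<integral>z. profile S b (fst z) * ln (dist (fst z) (snd z)) * profile T c (snd z) \<partial>?M)
    \<le> (\<integral>z. (\<Sum>k\<in>S. \<Sum>l\<in>T. (ln 2 - ln 2 * real (min k l)) * (U k (fst z) * V l (snd z))) \<partial>?M)"
  proof (rule integral_mono_AE)
    show "integrable ?M (\<lambda>z. profile S b (fst z) * ln (dist (fst z) (snd z)) * profile T c (snd z))"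
      using admissible_profile[OF S b] admissible_profile[OF T c]
      by (intro integrable_interaction) (auto simp: admissible_def)
    show "integrable ?M (\<lambda>z. \<Sum>k\<in>S. \<Sum>l\<in>T. (ln 2 - ln 2 * real (min k l)) * (U k (fst z) * V l (snd z)))"
      by (intro Bochner_Integration.integrable_sum integrable_mult_right UVi)
    show "AE z in ?M. profile S b (fst z) * ln (dist (fst z) (snd z)) * profile T c (snd z)
      \<le> (\<Sum>k\<in>S. \<Sum>l\<in>T. (ln 2 - ln 2 * real (min k l)) * (U k (fst z) * V l (snd z)))"
      using AE_fst_neq_snd
    proof (rule AE_mp, intro AE_I2 impI)
      fix z :: "(real^2) \<times> (real^2)"
      assume ne: "fst z \<noteq> snd z"
      have "profile S b (fst z) * ln (dist (fst z) (snd z)) * profile T c (snd z)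
        = (\<Sum>k\<in>S. \<Sum>l\<in>T. ln (dist (fst z) (snd z)) * (U k (fst z) * V l (snd z)))"
        unfolding UV by (simp add: sum_product sum_distrib_left sum_distrib_right mult_ac)
      also have "\<dots> \<le> (\<Sum>k\<in>S. \<Sum>l\<in>T. (ln 2 - ln 2 * real (min k l)) * (U k (fst z) * V l (snd z)))"
      proof (intro sum_mono)
        fix k l
        show "ln (dist (fst z) (snd z)) * (U k (fst z) * V l (snd z)) \<le> (ln 2 - ln 2 * real (min k l)) * (U k (fst z) * V l (snd z))"
        proof (cases "fst z \<in> dyadic_box k \<and> snd z \<in> dyadic_box l")
          case True
          then have "dist (fst z) (snd z) \<le> 2 * (1/2) ^ min k l" by (intro dist_dyadic_box_le) auto
          then have "ln (dist (fst z) (snd z)) \<le> ln (2 * (1/2) ^ min k l)"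
            using ne by (subst ln_le_cancel_iff) auto
          also have "\<dots> = ln 2 - ln 2 * real (min k l)"
            by (simp add: ln_mult ln_realpow ln_div)
          finally show ?thesis using UV0 by (intro mult_right_mono) auto
        next
          case False
          then have "U k (fst z) * V l (snd z) = 0" by (auto simp: U_def V_def)
          then show ?thesis by (simp only: mult_zero_right order_refl)
        qed
      qed
      finally show "profile S b (fst z) * ln (dist (fst z) (snd z)) * profile T c (snd z)
        \<le> (\<Sum>k\<in>S. \<Sum>l\<in>T. (ln 2 - ln 2 * real (min k l)) * (U k (fst z) * V l (snd z)))" .
    qed
  qed
  also have "\<dots> = (\<Sum>k\<in>S. \<integral>z. (\<Sum>l\<in>T. (ln 2 - ln 2 * real (min k l)) * (U k (fst z) * V l (snd z))) \<partial>?M)"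
    by (intro Bochner_Integration.integral_sum Bochner_Integration.integrable_sum integrable_mult_right UVi)
  also have "\<dots> = (\<Sum>k\<in>S. \<Sum>l\<in>T. \<integral>z. (ln 2 - ln 2 * real (min k l)) * (U k (fst z) * V l (snd z)) \<partial>?M)"
    by (intro sum.cong refl Bochner_Integration.integral_sum integrable_mult_right UVi)
  also have "\<dots> = (\<Sum>k\<in>S. \<Sum>l\<in>T. (ln 2 - ln 2 * real (min k l)) * (s * t))"
    unfolding integral_mult_right_zero integral_lborel_mult[OF Ui Vi] U1 V1 ..
  also have "\<dots> = (ln 2 * (real (card S) * real (card T)) - ln 2 * (\<Sum>k\<in>S. \<Sum>l\<in>T. real (min k l))) * (s * t)"
    unfolding sum_distrib_right[symmetric] by (simp add: sum_subtractf sum_distrib_left mult_ac)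
  also have "\<dots> = b * c * (ln 2 - ln 2 * ((\<Sum>k\<in>S. \<Sum>l\<in>T. real (min k l)) / (real (card S) * real (card T))))"
  proof -
    have "real (card S) \<noteq> 0" "real (card T) \<noteq> 0" using S T by auto
    then show ?thesis by (simp add: s_def t_def field_simps)
  qed
  finally show ?thesis .
qed

lemma FF_profile_le:
  fixes n :: nat and a :: "nat \<Rightarrow> nat \<Rightarrow> real" and \<beta> \<alpha> :: "nat \<Rightarrow> real" and v :: "nat \<Rightarrow> real^2"
  assumes a: "\<And>i j. i \<in> {1..n} \<Longrightarrow> j \<in> {1..n} \<Longrightarrow> 0 \<le> a i j"
    and \<beta>: "\<And>i. i \<in> {1..n} \<Longrightarrow> 0 < \<beta> i" and \<alpha>: "\<And>i. i \<in> {1..n} \<Longrightarrow> 0 < \<alpha> i"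
  obtains C where "\<And>S. (\<And>i. i \<in> {1..n} \<Longrightarrow> finite (S i) \<and> S i \<noteq> {}) \<Longrightarrow>
    (\<lambda>i. profile (S i) (\<beta> i)) \<in> Gamma n \<beta> \<and>
    FF n a v \<alpha> (\<lambda>i. profile (S i) (\<beta> i)) \<le> C - (\<Sum>i\<in>{1..n}. \<beta> i * ln (real (card (S i))))
      + ln 2 / (4 * pi) * ((\<Sum>i\<in>{1..n}. 8 * pi * \<beta> i * ((\<Sum>k\<in>S i. real k) / real (card (S i))))
        - (\<Sum>i\<in>{1..n}. \<Sum>j\<in>{1..n}. a i j * \<beta> i * \<beta> j *
            ((\<Sum>k\<in>S i. \<Sum>l\<in>S j. real (min k l)) / (real (card (S i)) * real (card (S j))))))"
proof (rule that, intro conjI)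
  let ?I = "{1..n}"
  fix S :: "nat \<Rightarrow> nat set"
  assume S: "\<And>i. i \<in> ?I \<Longrightarrow> finite (S i) \<and> S i \<noteq> {}"
  define \<rho> where "\<rho> i = profile (S i) (\<beta> i)" for i
  have adm: "admissible (\<beta> i) (\<rho> i)" if "i \<in> ?I" for i
    unfolding \<rho>_def using S[OF that] \<beta>[OF that] by (intro admissible_profile) auto
  then show "(\<lambda>i. profile (S i) (\<beta> i)) \<in> Gamma n \<beta>"
    by (simp add: Gamma_eq_admissible \<rho>_def)
  define avg where "avg i = (\<Sum>k\<in>S i. real k) / real (card (S i))" for i
  define av2 where "av2 i j = (\<Sum>k\<in>S i. \<Sum>l\<in>S j. real (min k l)) / (real (card (S i)) * real (card (S j)))" for i j
  have E: "(\<Sum>i\<in>?I. \<integral>x. \<rho> i x * ln (\<rho> i x) \<partial>lborel)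
    = (\<Sum>i\<in>?I. \<beta> i * (ln (\<beta> i) + ln 4 - ln (real (card (S i))) + ln 4 * avg i))"
    unfolding \<rho>_def avg_def using S \<beta> by (intro sum.cong refl entropy_profile) auto
  have D: "(\<Sum>i\<in>?I. \<Sum>j\<in>?I. a i j *
      (\<integral>z. \<rho> i (fst z) * ln (dist (fst z) (snd z)) * \<rho> j (snd z) \<partial>(lborel \<Otimes>\<^sub>M lborel)))
    \<le> (\<Sum>i\<in>?I. \<Sum>j\<in>?I. a i j * (\<beta> i * \<beta> j * (ln 2 - ln 2 * av2 i j)))"
    unfolding \<rho>_def av2_def using S \<beta> a by (intro sum_mono mult_left_mono interaction_profile_le) auto
  have V: "(\<Sum>i\<in>?I. \<alpha> i * (\<integral>x. norm (x - v i) ^ 2 * \<rho> i x \<partial>lborel)) \<le> (\<Sum>i\<in>?I. \<alpha> i * ((2 + norm (v i)) ^ 2 * \<beta> i))"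
    unfolding \<rho>_def using S \<beta> \<alpha> by (intro sum_mono mult_left_mono second_moment_profile_le) (auto simp: less_imp_le)
  have "FF n a v \<alpha> \<rho> \<le> (\<Sum>i\<in>?I. \<beta> i * (ln (\<beta> i) + ln 4 - ln (real (card (S i))) + ln 4 * avg i))
    + 1 / (4 * pi) * (\<Sum>i\<in>?I. \<Sum>j\<in>?I. a i j * (\<beta> i * \<beta> j * (ln 2 - ln 2 * av2 i j)))
    + (\<Sum>i\<in>?I. \<alpha> i * ((2 + norm (v i)) ^ 2 * \<beta> i))"
    unfolding FF_def E using D V by (intro add_mono mult_left_mono order_refl) auto
  also have "(\<Sum>i\<in>?I. \<beta> i * (ln (\<beta> i) + ln 4 - ln (real (card (S i))) + ln 4 * avg i))
    = (\<Sum>i\<in>?I. \<beta> i * (ln (\<beta> i) + ln 4)) - (\<Sum>i\<in>?I. \<beta> i * ln (real (card (S i))))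
      + ln 2 / (4 * pi) * (\<Sum>i\<in>?I. 8 * pi * \<beta> i * avg i)"
  proof -
    have "ln (4::real) = 2 * ln 2" using ln_realpow[of "2::real" 2] by simp
    then have "\<beta> i * (ln (\<beta> i) + ln 4 - ln (real (card (S i))) + ln 4 * avg i)
      = \<beta> i * (ln (\<beta> i) + ln 4) - \<beta> i * ln (real (card (S i))) + ln 2 / (4 * pi) * (8 * pi * \<beta> i * avg i)" for i
      by (simp add: algebra_simps)
    then show ?thesis by (simp only: sum.distrib sum_subtractf sum_distrib_left)
  qed
  also have "(\<Sum>i\<in>?I. \<Sum>j\<in>?I. a i j * (\<beta> i * \<beta> j * (ln 2 - ln 2 * av2 i j)))
    = (\<Sum>i\<in>?I. \<Sum>j\<in>?I. a i j * (\<beta> i * \<beta> j * ln 2)) - ln 2 * (\<Sum>i\<in>?I. \<Sum>j\<in>?I. a i j * \<beta> i * \<beta> j * av2 i j)"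
    by (simp add: right_diff_distrib sum_subtractf sum_distrib_left mult_ac)
  finally have "FF n a v \<alpha> \<rho> \<le> ((\<Sum>i\<in>?I. \<beta> i * (ln (\<beta> i) + ln 4))
      + 1 / (4 * pi) * (\<Sum>i\<in>?I. \<Sum>j\<in>?I. a i j * (\<beta> i * \<beta> j * ln 2))
      + (\<Sum>i\<in>?I. \<alpha> i * ((2 + norm (v i)) ^ 2 * \<beta> i)))
    - (\<Sum>i\<in>?I. \<beta> i * ln (real (card (S i))))
    + ln 2 / (4 * pi) * ((\<Sum>i\<in>?I. 8 * pi * \<beta> i * avg i) - (\<Sum>i\<in>?I. \<Sum>j\<in>?I. a i j * \<beta> i * \<beta> j * av2 i j))"
    by (simp add: right_diff_distrib)
  then show "FF n a v \<alpha> (\<lambda>i. profile (S i) (\<beta> i)) \<le> ((\<Sum>i\<in>?I. \<beta> i * (ln (\<beta> i) + ln 4))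
      + 1 / (4 * pi) * (\<Sum>i\<in>?I. \<Sum>j\<in>?I. a i j * (\<beta> i * \<beta> j * ln 2))
      + (\<Sum>i\<in>?I. \<alpha> i * ((2 + norm (v i)) ^ 2 * \<beta> i)))
    - (\<Sum>i\<in>{1..n}. \<beta> i * ln (real (card (S i))))
      + ln 2 / (4 * pi) * ((\<Sum>i\<in>{1..n}. 8 * pi * \<beta> i * ((\<Sum>k\<in>S i. real k) / real (card (S i))))
        - (\<Sum>i\<in>{1..n}. \<Sum>j\<in>{1..n}. a i j * \<beta> i * \<beta> j *
            ((\<Sum>k\<in>S i. \<Sum>l\<in>S j. real (min k l)) / (real (card (S i)) * real (card (S j))))))"
    unfolding avg_def av2_def \<rho>_def .
qed

lemma double_sum_restrict:
  fixes F :: "nat \<Rightarrow> nat \<Rightarrow> real"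
  assumes "finite I" "J \<subseteq> I" "\<And>i j. i \<notin> J \<or> j \<notin> J \<Longrightarrow> F i j = 0"
  shows "(\<Sum>i\<in>I. \<Sum>j\<in>I. F i j) = (\<Sum>i\<in>J. \<Sum>j\<in>J. F i j)"
proof -
  have "(\<Sum>i\<in>I. \<Sum>j\<in>I. F i j) = (\<Sum>i\<in>J. \<Sum>j\<in>I. F i j)"
    using assms by (intro sum.mono_neutral_right) auto
  also have "\<dots> = (\<Sum>i\<in>J. \<Sum>j\<in>J. F i j)"
    using assms by (intro sum.cong refl sum.mono_neutral_right) auto
  finally show ?thesis .
qed

lemma Lambda_eq: "Lambda a \<beta> J = (\<Sum>i\<in>J. 8 * pi * \<beta> i) - (\<Sum>i\<in>J. \<Sum>j\<in>J. a i j * \<beta> i * \<beta> j)"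
  unfolding Lambda_def by (simp add: right_diff_distrib sum_subtractf sum_distrib_left mult_ac)

lemma bounded_below_imp_Lambda_nonneg:
  fixes n :: nat and a :: "nat \<Rightarrow> nat \<Rightarrow> real" and \<beta> \<alpha> :: "nat \<Rightarrow> real" and v :: "nat \<Rightarrow> real^2"
  assumes a: "\<And>i j. i \<in> {1..n} \<Longrightarrow> j \<in> {1..n} \<Longrightarrow> 0 \<le> a i j"
    and \<beta>: "\<And>i. i \<in> {1..n} \<Longrightarrow> 0 < \<beta> i" and \<alpha>: "\<And>i. i \<in> {1..n} \<Longrightarrow> 0 < \<alpha> i"
    and bdd: "\<And>\<rho>. \<rho> \<in> Gamma n \<beta> \<Longrightarrow> B \<le> FF n a v \<alpha> \<rho>" and J: "J \<subseteq> {1..n}"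
  shows "0 \<le> Lambda a \<beta> J"
proof (rule ccontr)
  assume neg: "\<not> 0 \<le> Lambda a \<beta> J"
  let ?I = "{1..n}"
  show False
  proof (rule FF_profile_le[where n = n and a = a and \<beta> = \<beta> and \<alpha> = \<alpha> and v = v, OF a \<beta> \<alpha>])
    fix C
    assume C: "\<And>S. (\<And>i. i \<in> {1..n} \<Longrightarrow> finite (S i) \<and> S i \<noteq> {}) \<Longrightarrow>
      (\<lambda>i. profile (S i) (\<beta> i)) \<in> Gamma n \<beta> \<and>
      FF n a v \<alpha> (\<lambda>i. profile (S i) (\<beta> i)) \<le> C - (\<Sum>i\<in>{1..n}. \<beta> i * ln (real (card (S i))))
        + ln 2 / (4 * pi) * ((\<Sum>i\<in>{1..n}. 8 * pi * \<beta> i * ((\<Sum>k\<in>S i. real k) / real (card (S i))))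
          - (\<Sum>i\<in>{1..n}. \<Sum>j\<in>{1..n}. a i j * \<beta> i * \<beta> j *
              ((\<Sum>k\<in>S i. \<Sum>l\<in>S j. real (min k l)) / (real (card (S i)) * real (card (S j))))))"
    have bound: "B \<le> C + ln 2 / (4 * pi) * (real K * Lambda a \<beta> J)" for K
    proof -
      define S where "S i = {if i \<in> J then K else 0}" for i
      have 1: "(\<Sum>i\<in>?I. 8 * pi * \<beta> i * ((\<Sum>k\<in>S i. real k) / real (card (S i)))) = real K * (\<Sum>i\<in>J. 8 * pi * \<beta> i)"
        unfolding sum_distrib_left using J by (intro sum.mono_neutral_cong_right) (auto simp: S_def)
      have "(\<Sum>i\<in>?I. \<Sum>j\<in>?I. a i j * \<beta> i * \<beta> j *
          ((\<Sum>k\<in>S i. \<Sum>l\<in>S j. real (min k l)) / (real (card (S i)) * real (card (S j)))))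
        = (\<Sum>i\<in>J. \<Sum>j\<in>J. a i j * \<beta> i * \<beta> j *
          ((\<Sum>k\<in>S i. \<Sum>l\<in>S j. real (min k l)) / (real (card (S i)) * real (card (S j)))))"
        using J by (intro double_sum_restrict) (auto simp: S_def)
      also have "\<dots> = real K * (\<Sum>i\<in>J. \<Sum>j\<in>J. a i j * \<beta> i * \<beta> j)"
        unfolding sum_distrib_left by (intro sum.cong refl) (simp add: S_def)
      finally have 2: "(\<Sum>i\<in>?I. \<Sum>j\<in>?I. a i j * \<beta> i * \<beta> j *
          ((\<Sum>k\<in>S i. \<Sum>l\<in>S j. real (min k l)) / (real (card (S i)) * real (card (S j)))))
        = real K * (\<Sum>i\<in>J. \<Sum>j\<in>J. a i j * \<beta> i * \<beta> j)" .
      have 3: "(\<Sum>i\<in>?I. \<beta> i * ln (real (card (S i)))) = 0" by (simp add: S_def)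
      have "finite (S i) \<and> S i \<noteq> {}" for i by (simp add: S_def)
      then show ?thesis
        using C[of S] bdd[of "\<lambda>i. profile (S i) (\<beta> i)"]
        unfolding 1 2 3 Lambda_eq right_diff_distrib[symmetric] by fastforce
    qed
    define q where "q = - (ln 2 / (4 * pi) * Lambda a \<beta> J)"
    have "ln 2 / (4 * pi) * Lambda a \<beta> J < 0" using neg by (intro mult_pos_neg) auto
    then have q: "0 < q" by (simp add: q_def)
    obtain K :: nat where "(C - B) / q < real K" using reals_Archimedean2 by blast
    then have "C - B < real K * q" using q by (simp add: field_simps)
    with bound[of K] show False by (simp add: q_def algebra_simps)
  qed
qed

lemma bounded_below_imp_no_flat_edge:
  fixes n :: nat and a :: "nat \<Rightarrow> nat \<Rightarrow> real" and \<beta> \<alpha> :: "nat \<Rightarrow> real" and v :: "nat \<Rightarrow> real^2"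
  assumes sym: "\<forall>i\<in>{1..n}. \<forall>j\<in>{1..n}. a i j = a j i"
    and a: "\<And>i j. i \<in> {1..n} \<Longrightarrow> j \<in> {1..n} \<Longrightarrow> 0 \<le> a i j"
    and \<beta>: "\<And>i. i \<in> {1..n} \<Longrightarrow> 0 < \<beta> i" and \<alpha>: "\<And>i. i \<in> {1..n} \<Longrightarrow> 0 < \<alpha> i"
    and bdd: "\<And>\<rho>. \<rho> \<in> Gamma n \<beta> \<Longrightarrow> B \<le> FF n a v \<alpha> \<rho>"
    and J: "J \<subseteq> {1..n}" "r \<in> J" and L: "Lambda a \<beta> J = 0"
  shows "0 < a r r + Lambda a \<beta> (J - {r})"
proof (rule ccontr)
  assume "\<not> ?thesis"
  moreover have "0 \<le> Lambda a \<beta> (J - {r})"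
    by (rule bounded_below_imp_Lambda_nonneg[where n = n and a = a and \<beta> = \<beta> and \<alpha> = \<alpha> and v = v, OF a \<beta> \<alpha> bdd])
       (use J in auto)
  moreover have r: "r \<in> {1..n}" using J by auto
  ultimately have flat: "a r r = 0" "Lambda a \<beta> (J - {r}) = 0" using a[OF r r] by linarith+
  let ?I = "{1..n}" and ?J = "J - {r}"
  have fin: "finite J" using J finite_subset by blast
  have symJ: "\<forall>i\<in>J. \<forall>k\<in>J. a i k = a k i" using sym J by blast
  have cross: "\<beta> r * (8 * pi - 2 * (\<Sum>k\<in>?J. a r k * \<beta> k)) = 0"
    using Lambda_insert_split[OF fin J(2) symJ, of \<beta> "\<beta> r"] L flat by simp
  show False
  proof (rule FF_profile_le[where n = n and a = a and \<beta> = \<beta> and \<alpha> = \<alpha> and v = v, OF a \<beta> \<alpha>])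
    fix C
    assume C: "\<And>S. (\<And>i. i \<in> {1..n} \<Longrightarrow> finite (S i) \<and> S i \<noteq> {}) \<Longrightarrow>
      (\<lambda>i. profile (S i) (\<beta> i)) \<in> Gamma n \<beta> \<and>
      FF n a v \<alpha> (\<lambda>i. profile (S i) (\<beta> i)) \<le> C - (\<Sum>i\<in>{1..n}. \<beta> i * ln (real (card (S i))))
        + ln 2 / (4 * pi) * ((\<Sum>i\<in>{1..n}. 8 * pi * \<beta> i * ((\<Sum>k\<in>S i. real k) / real (card (S i))))
          - (\<Sum>i\<in>{1..n}. \<Sum>j\<in>{1..n}. a i j * \<beta> i * \<beta> j *
              ((\<Sum>k\<in>S i. \<Sum>l\<in>S j. real (min k l)) / (real (card (S i)) * real (card (S j))))))"
    have bound: "B \<le> C - \<beta> r * ln (real K)" if K: "0 < K" for K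
    proof -
      define S where "S i = (if i = r then {..<K} else if i \<in> J then {K} else {0})" for i
      define avg where "avg i = (\<Sum>k\<in>S i. real k) / real (card (S i))" for i
      define av2 where "av2 i j = (\<Sum>k\<in>S i. \<Sum>l\<in>S j. real (min k l)) / (real (card (S i)) * real (card (S j)))" for i j
      define t where "t = (\<Sum>k<K. real k) / real K"
      have avg: "avg r = t" "\<And>i. i \<in> ?J \<Longrightarrow> avg i = real K" "\<And>i. i \<notin> J \<Longrightarrow> avg i = 0"
        using J by (auto simp: avg_def S_def t_def)
      have av2: "\<And>i j. i \<in> ?J \<Longrightarrow> j \<in> ?J \<Longrightarrow> av2 i j = real K"
        "\<And>j. j \<in> ?J \<Longrightarrow> av2 r j = t" "\<And>j. j \<in> ?J \<Longrightarrow> av2 j r = t"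
        "\<And>i j. i \<notin> J \<or> j \<notin> J \<Longrightarrow> av2 i j = 0"
        using J by (auto simp: av2_def S_def t_def)
      have 1: "(\<Sum>i\<in>?I. 8 * pi * \<beta> i * avg i) = 8 * pi * \<beta> r * t + real K * (\<Sum>i\<in>?J. 8 * pi * \<beta> i)"
      proof -
        have "(\<Sum>i\<in>?I. 8 * pi * \<beta> i * avg i) = (\<Sum>i\<in>J. 8 * pi * \<beta> i * avg i)"
          using J avg(3) by (intro sum.mono_neutral_right) auto
        also have "\<dots> = 8 * pi * \<beta> r * avg r + (\<Sum>i\<in>?J. 8 * pi * \<beta> i * avg i)"
          using fin J by (intro sum.remove) auto
        also have "(\<Sum>i\<in>?J. 8 * pi * \<beta> i * avg i) = real K * (\<Sum>i\<in>?J. 8 * pi * \<beta> i)"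
          unfolding sum_distrib_left using avg(2) by (intro sum.cong refl) simp
        finally show ?thesis by (simp add: avg(1))
      qed
      have 2: "(\<Sum>i\<in>?I. \<Sum>j\<in>?I. a i j * \<beta> i * \<beta> j * av2 i j)
        = t * (2 * \<beta> r * (\<Sum>k\<in>?J. a r k * \<beta> k)) + real K * (\<Sum>i\<in>?J. \<Sum>j\<in>?J. a i j * \<beta> i * \<beta> j)"
      proof -
        define F where "F i j = a i j * \<beta> i * \<beta> j * av2 i j" for i j
        have "(\<Sum>i\<in>?I. \<Sum>j\<in>?I. F i j) = (\<Sum>i\<in>J. \<Sum>j\<in>J. F i j)"
          using J av2(4) by (intro double_sum_restrict) (auto simp: F_def)
        also have "\<dots> = (\<Sum>j\<in>J. F r j) + (\<Sum>i\<in>?J. \<Sum>j\<in>J. F i j)"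
          using fin J by (intro sum.remove) auto
        also have "\<dots> = (F r r + (\<Sum>j\<in>?J. F r j)) + (\<Sum>i\<in>?J. F i r + (\<Sum>j\<in>?J. F i j))"
          by (simp add: sum.remove[OF fin J(2)])
        also have "F r r = 0" using flat by (simp add: F_def)
        also have "(\<Sum>j\<in>?J. F r j) = t * (\<beta> r * (\<Sum>k\<in>?J. a r k * \<beta> k))"
          unfolding sum_distrib_left using av2(2) by (intro sum.cong refl) (simp add: F_def)
        also have "(\<Sum>i\<in>?J. F i r + (\<Sum>j\<in>?J. F i j)) = (\<Sum>i\<in>?J. F i r) + (\<Sum>i\<in>?J. \<Sum>j\<in>?J. F i j)"
          by (rule sum.distrib)
        also have "(\<Sum>i\<in>?J. F i r) = t * (\<beta> r * (\<Sum>k\<in>?J. a r k * \<beta> k))"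
          unfolding sum_distrib_left using av2(3) symJ J by (intro sum.cong refl) (simp add: F_def)
        also have "(\<Sum>i\<in>?J. \<Sum>j\<in>?J. F i j) = real K * (\<Sum>i\<in>?J. \<Sum>j\<in>?J. a i j * \<beta> i * \<beta> j)"
          unfolding sum_distrib_left using av2(1) by (intro sum.cong refl) (simp add: F_def)
        finally show ?thesis by (simp add: F_def)
      qed
      have "8 * pi * \<beta> r * t + real K * (\<Sum>i\<in>?J. 8 * pi * \<beta> i)
        - (t * (2 * \<beta> r * (\<Sum>k\<in>?J. a r k * \<beta> k)) + real K * (\<Sum>i\<in>?J. \<Sum>j\<in>?J. a i j * \<beta> i * \<beta> j))
        = t * (\<beta> r * (8 * pi - 2 * (\<Sum>k\<in>?J. a r k * \<beta> k))) + real K * Lambda a \<beta> ?J"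
        unfolding Lambda_eq by (simp add: algebra_simps)
      then have 3: "(\<Sum>i\<in>?I. 8 * pi * \<beta> i * avg i) - (\<Sum>i\<in>?I. \<Sum>j\<in>?I. a i j * \<beta> i * \<beta> j * av2 i j) = 0"
        unfolding 1 2 cross flat by simp
      have 4: "(\<Sum>i\<in>?I. \<beta> i * ln (real (card (S i)))) = \<beta> r * ln (real K)"
      proof -
        have "(\<Sum>i\<in>?I. \<beta> i * ln (real (card (S i)))) = (\<Sum>i\<in>{r}. \<beta> i * ln (real (card (S i))))"
          using r by (intro sum.mono_neutral_right) (auto simp: S_def)
        then show ?thesis by (simp add: S_def)
      qed
      have "finite (S i) \<and> S i \<noteq> {}" for i using K by (auto simp: S_def)
      then have "(\<lambda>i. profile (S i) (\<beta> i)) \<in> Gamma n \<beta>"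
        "FF n a v \<alpha> (\<lambda>i. profile (S i) (\<beta> i)) \<le> C - \<beta> r * ln (real K) + ln 2 / (4 * pi) * 0"
        using C[of S] unfolding 4 avg_def[symmetric] av2_def[symmetric] 3 by auto
      then show ?thesis using bdd[of "\<lambda>i. profile (S i) (\<beta> i)"] by simp
    qed
    have br: "0 < \<beta> r" using \<beta> r by simp
    obtain K :: nat where K: "exp ((C - B) / \<beta> r + 1) < real K" using reals_Archimedean2 by blast
    then have K0: "0 < real K" using exp_gt_zero less_trans by blast
    then have "(C - B) / \<beta> r + 1 < ln (real K)" using K by (metis exp_less_cancel_iff exp_ln)
    then have "C - B + \<beta> r < \<beta> r * ln (real K)" using br by (simp add: field_simps)
    moreover have "B \<le> C - \<beta> r * ln (real K)" using bound[of K] K0 by simp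
    ultimately show False using br by simp
  qed
qed

theorem theorem3:
  fixes n :: nat and a :: "nat \<Rightarrow> nat \<Rightarrow> real" and \<beta> \<alpha> :: "nat \<Rightarrow> real"
    and v :: "nat \<Rightarrow> real^2"
  assumes "n \<ge> 1"
    and "\<forall>i\<in>{1..n}. \<forall>j\<in>{1..n}. a i j = a j i"
    and "\<forall>i\<in>{1..n}. \<forall>j\<in>{1..n}. a i j \<ge> 0"
    and "\<forall>i\<in>{1..n}. \<beta> i > 0"
    and "\<forall>i\<in>{1..n}. \<alpha> i > 0"
  shows "(\<exists>C. \<forall>\<rho>\<in>Gamma n \<beta>. C \<le> FF n a v \<alpha> \<rho>) \<longleftrightarrow>
         ((\<forall>J. J \<noteq> {} \<and> J \<subseteq> {1..n} \<longrightarrow> Lambda a \<beta> J \<ge> 0) \<and>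
          (\<forall>J. J \<noteq> {} \<and> J \<subseteq> {1..n} \<and> Lambda a \<beta> J = 0 \<longrightarrow>
               (\<forall>i\<in>J. a i i + Lambda a \<beta> (J - {i}) > 0)))"
    (is "?bdd \<longleftrightarrow> ?nonneg \<and> ?edge")
proof
  assume ?bdd
  then obtain B where B: "\<And>\<rho>. \<rho> \<in> Gamma n \<beta> \<Longrightarrow> B \<le> FF n a v \<alpha> \<rho>" by blast
  have a: "\<And>i j. i \<in> {1..n} \<Longrightarrow> j \<in> {1..n} \<Longrightarrow> 0 \<le> a i j" using assms by blast
  have \<beta>: "\<And>i. i \<in> {1..n} \<Longrightarrow> 0 < \<beta> i" and \<alpha>: "\<And>i. i \<in> {1..n} \<Longrightarrow> 0 < \<alpha> i" using assms by blast+
  show "?nonneg \<and> ?edge"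
    using bounded_below_imp_Lambda_nonneg[of n a \<beta> \<alpha> B v, OF a \<beta> \<alpha> B]
      bounded_below_imp_no_flat_edge[of n a \<beta> \<alpha> B v, OF assms(2) a \<beta> \<alpha> B] by blast
next
  assume cond: "?nonneg \<and> ?edge"
  have "0 \<le> Lambda a \<beta> J" if "J \<subseteq> {1..n}" for J
    using cond that by (cases "J = {}") (auto simp: Lambda_def)
  moreover have "0 < a i i + Lambda a \<beta> (J - {i})" if "J \<subseteq> {1..n}" "i \<in> J" "Lambda a \<beta> J = 0" for J i
    using cond that by blast
  ultimately show ?bdd
    using assms by (intro FF_bounded_below) auto
qed

end
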